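(* Let $\widetilde M(\mu)$ be a complex space form and let $M$ be a totally real minimal semiparallel submanifold of $\widetilde M(\mu)$ with parallel $f$-structure in the normal bundle. Suppose that the square of the length of the second fundamental form of $M$ is constant (or, equivalently, that $M$ has constant scalar curvature $\tau$). Then $M$ is totally geodesic or $\tau\ge 0$. Moreover, if $\tau=0$, then $M$ is flat.
   Context: A complex space form $\widetilde M(\mu)$ is a Kählerian manifold (real dimension $2m$, metric $g$, complex structure $J$, Levi-Civita connection $\widetilde\nabla$) of constant holomorphic sectional curvature $\mu$. An $n$-dimensional submanifold $M$ (with induced metric and Levi-Civita connection $\nabla$) is totally real if $J T_pM\subset T_pM^\perp$ for every $p\in M$ (so $n\le m$). The second fundamental form $\sigma$ is defined by $\widetilde\nabla_XY=\nabla_XY+\sigma(X,Y)$ for tangent vector fields $X,Y$; $M$ is totally geodesic if $\sigma=0$ and minimal if the mean curvature vector $H=\frac1n\operatorname{tr}\sigma$ vanishes. For a normal vector field $\xi$, write $\widetilde\nabla_X\xi=-A_\xi X+D_X\xi$ with $-A_\xi X$ tangential and $D_X\xi$ normal; $D$ is the normal connection. $f$-structure: for a normal field $\xi$ write $J\xi=P\xi+f\xi$ with $P\xi$ tangential and $f\xi$ normal. The $f$-structure in the normal bundle is parallel if $Df=0$, i.e. $D_X(f\xi)-f D_X\xi=0$ for all tangent $X$ and normal $\xi$ (when $n=m$, $f=0$ and this holds automatically). Semiparallel: let $R$ be the curvature tensor of $M$ and $R^\perp(X,Y)\xi=D_XD_Y\xi-D_YD_X\xi-D_{[X,Y]}\xi$.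 $M$ is semiparallel if $R^\perp(X,Y)\sigma(Z,U)-\sigma(R(X,Y)Z,U)-\sigma(Z,R(X,Y)U)=0$ for all tangent $X,Y,Z,U$. *)

theory Defs
  imports "HOL-Analysis.Analysis"
begin

text \<open>
  Conventions.  The points of a manifold are the elements of a Hausdorff second countable type.
  A smooth structure is an atlas indexed by the points: \<open>A p\<close> is a chart (domain, coordinate map)
  around \<open>p\<close>.  The tangent space at \<open>p\<close> is identified with the model space by means of the
  chart \<open>A p\<close>; so a tangent vector at \<open>p\<close> is an element of the model space, and a vector field is
  a map from points into the model space.  All differential operators act on fields that are smooth
  on some open set \<open>U\<close>; their values outside \<open>U\<close> are irrelevant.
\<close>

subsection \<open>Smooth manifolds\<close>

primrec Ck_on :: "nat \<Rightarrow> 'e::euclidean_space set \<Rightarrow> ('e \<Rightarrow> 'f::real_normed_vector) \<Rightarrow> bool" where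
  "Ck_on 0 S f \<longleftrightarrow> continuous_on S f"
| "Ck_on (Suc k) S f \<longleftrightarrow> (\<forall>x\<in>S. f differentiable (at x)) \<and>
     (\<forall>v. Ck_on k S (\<lambda>x. frechet_derivative f (at x) v))"

text \<open>Both notions are only used for open \<open>S\<close>.\<close>

definition smooth_on :: "'e::euclidean_space set \<Rightarrow> ('e \<Rightarrow> 'f::real_normed_vector) \<Rightarrow> bool" where
  "smooth_on S f \<longleftrightarrow> (\<forall>k. Ck_on k S f)"

type_synonym ('a, 'e) atlas = "'a \<Rightarrow> 'a set \<times> ('a \<Rightarrow> 'e)"

definition chart_dom :: "('a, 'e) atlas \<Rightarrow> 'a \<Rightarrow> 'a set" where
  "chart_dom A p = fst (A p)"

definition chart :: "('a, 'e) atlas \<Rightarrow> 'a \<Rightarrow> 'a \<Rightarrow> 'e" where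
  "chart A p = snd (A p)"

definition chart_inv :: "('a, 'e) atlas \<Rightarrow> 'a \<Rightarrow> 'e \<Rightarrow> 'a" where
  "chart_inv A p = inv_into (chart_dom A p) (chart A p)"

definition smooth_atlas ::
  "('a::{second_countable_topology,t2_space}, 'e::euclidean_space) atlas \<Rightarrow> bool" where
  "smooth_atlas A \<longleftrightarrow>
     (\<forall>p. p \<in> chart_dom A p \<and> open (chart_dom A p) \<and> open (chart A p ` chart_dom A p) \<and>
        homeomorphism (chart_dom A p) (chart A p ` chart_dom A p) (chart A p) (chart_inv A p)) \<and>
     (\<forall>p q. smooth_on (chart A p ` (chart_dom A p \<inter> chart_dom A q)) (chart A q \<circ> chart_inv A p))"

definition smooth_fun ::
  "('a::topological_space, 'e::euclidean_space) atlas \<Rightarrow> 'a set \<Rightarrow> ('a \<Rightarrow> 'f::real_normed_vector) \<Rightarrow> bool" where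
  "smooth_fun A U f \<longleftrightarrow> (\<forall>q. smooth_on (chart A q ` (U \<inter> chart_dom A q)) (f \<circ> chart_inv A q))"

text \<open>
  \<open>mderiv A f p v\<close> is the derivative of the vector-valued function \<open>f\<close> in the direction of the
  tangent vector \<open>v\<close> at \<open>p\<close>.  In particular \<open>mderiv A (chart A q) p v\<close> is the coordinate
  representation of \<open>v\<close> in the chart at \<open>q\<close>, and this is \<open>v\<close> itself for \<open>q = p\<close>.
\<close>

definition mderiv ::
  "('a, 'e::euclidean_space) atlas \<Rightarrow> ('a \<Rightarrow> 'f::real_normed_vector) \<Rightarrow> 'a \<Rightarrow> 'e \<Rightarrow> 'f" where
  "mderiv A f p v = frechet_derivative (f \<circ> chart_inv A p) (at (chart A p p)) v"

definition smooth_map ::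
  "('b::topological_space, 'd::euclidean_space) atlas \<Rightarrow> ('a::topological_space, 'e::euclidean_space) atlas
    \<Rightarrow> ('b \<Rightarrow> 'a) \<Rightarrow> bool" where
  "smooth_map A B \<phi> \<longleftrightarrow>
     continuous_on UNIV \<phi> \<and> (\<forall>q. smooth_fun A (\<phi> -` chart_dom B q) (\<lambda>p. chart B q (\<phi> p)))"

definition tangent_map ::
  "('b, 'd::euclidean_space) atlas \<Rightarrow> ('a, 'e::euclidean_space) atlas \<Rightarrow> ('b \<Rightarrow> 'a) \<Rightarrow> 'b \<Rightarrow> 'd \<Rightarrow> 'e" where
  "tangent_map A B \<phi> p v = mderiv A (\<lambda>q. chart B (\<phi> p) (\<phi> q)) p v"

definition immersion ::
  "('b::topological_space, 'd::euclidean_space) atlas \<Rightarrow> ('a::topological_space, 'e::euclidean_space) atlas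
    \<Rightarrow> ('b \<Rightarrow> 'a) \<Rightarrow> bool" where
  "immersion A B \<phi> \<longleftrightarrow> smooth_map A B \<phi> \<and> (\<forall>p. inj (tangent_map A B \<phi> p))"

text \<open>Vector fields along a map \<open>\<phi>\<close>, i.e. sections of the pulled back tangent bundle.\<close>

definition smooth_along ::
  "('b::topological_space, 'd::euclidean_space) atlas \<Rightarrow> ('a, 'e::euclidean_space) atlas
    \<Rightarrow> ('b \<Rightarrow> 'a) \<Rightarrow> 'b set \<Rightarrow> ('b \<Rightarrow> 'e) \<Rightarrow> bool" where
  "smooth_along A B \<phi> U W \<longleftrightarrow>
     (\<forall>q. smooth_fun A (U \<inter> \<phi> -` chart_dom B q) (\<lambda>p. mderiv B (chart B q) (\<phi> p) (W p)))"

definition vector_field ::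
  "('a::topological_space, 'e::euclidean_space) atlas \<Rightarrow> 'a set \<Rightarrow> ('a \<Rightarrow> 'e) \<Rightarrow> bool" where
  "vector_field A U X \<longleftrightarrow> smooth_along A A (\<lambda>p. p) U X"

text \<open>
  The commutator \<open>X (Y f) - Y (X f)\<close> evaluated on the coordinate map \<open>f\<close> of the chart at \<open>p\<close>;
  at the point \<open>p\<close> this gives the tangent vector itself.
\<close>

definition lie_bracket ::
  "('a, 'e::euclidean_space) atlas \<Rightarrow> ('a \<Rightarrow> 'e) \<Rightarrow> ('a \<Rightarrow> 'e) \<Rightarrow> 'a \<Rightarrow> 'e" where
  "lie_bracket A X Y p =
     mderiv A (\<lambda>q. mderiv A (chart A p) q (Y q)) p (X p) -
     mderiv A (\<lambda>q. mderiv A (chart A p) q (X q)) p (Y p)"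

subsection \<open>Connections, metrics, curvature\<close>

text \<open>
  A connection \<open>D\<close> on the pulled back tangent bundle; \<open>D W p v\<close> is the covariant derivative of \<open>W\<close>
  at \<open>p\<close> in the direction \<open>v\<close>.  Linearity in \<open>v\<close> expresses linearity of \<open>D\<^sub>X W\<close> over the smooth
  functions in the argument \<open>X\<close>; the locality clause says that \<open>D\<close> depends only on the
  restriction of \<open>W\<close> to an open set.
\<close>

definition connection_along ::
  "('b::topological_space, 'd::euclidean_space) atlas \<Rightarrow> ('a, 'e::euclidean_space) atlas
    \<Rightarrow> ('b \<Rightarrow> 'a) \<Rightarrow> (('b \<Rightarrow> 'e) \<Rightarrow> 'b \<Rightarrow> 'd \<Rightarrow> 'e) \<Rightarrow> bool" where
  "connection_along A B \<phi> D \<longleftrightarrow> (\<forall>U. open U \<longrightarrow>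
     (\<forall>W. smooth_along A B \<phi> U W \<longrightarrow> (\<forall>p\<in>U. linear (D W p))) \<and>
     (\<forall>W X. smooth_along A B \<phi> U W \<and> vector_field A U X \<longrightarrow>
        smooth_along A B \<phi> U (\<lambda>p. D W p (X p))) \<and>
     (\<forall>W W'. smooth_along A B \<phi> U W \<and> smooth_along A B \<phi> U W' \<and> (\<forall>p\<in>U. W p = W' p) \<longrightarrow>
        (\<forall>p\<in>U. \<forall>v. D W p v = D W' p v)) \<and>
     (\<forall>W W'. smooth_along A B \<phi> U W \<and> smooth_along A B \<phi> U W' \<longrightarrow>
        (\<forall>p\<in>U. \<forall>v. D (\<lambda>q. W q + W' q) p v = D W p v + D W' p v)) \<and>
     (\<forall>f W. smooth_fun A U (f :: 'b \<Rightarrow> real) \<and> smooth_along A B \<phi> U W \<longrightarrow>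
        (\<forall>p\<in>U. \<forall>v. D (\<lambda>q. f q *\<^sub>R W q) p v = mderiv A f p v *\<^sub>R W p + f p *\<^sub>R D W p v)))"

definition riemannian_metric ::
  "('a::topological_space, 'e::euclidean_space) atlas \<Rightarrow> ('a \<Rightarrow> 'e \<Rightarrow> 'e \<Rightarrow> real) \<Rightarrow> bool" where
  "riemannian_metric A g \<longleftrightarrow>
     (\<forall>p. bilinear (g p) \<and> (\<forall>v w. g p v w = g p w v) \<and> (\<forall>v. v \<noteq> 0 \<longrightarrow> g p v v > 0)) \<and>
     (\<forall>U X Y. open U \<and> vector_field A U X \<and> vector_field A U Y \<longrightarrow>
        smooth_fun A U (\<lambda>p. g p (X p) (Y p)))"

definition levi_civita ::
  "('a::topological_space, 'e::euclidean_space) atlas \<Rightarrow> ('a \<Rightarrow> 'e \<Rightarrow> 'e \<Rightarrow> real)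
    \<Rightarrow> (('a \<Rightarrow> 'e) \<Rightarrow> 'a \<Rightarrow> 'e \<Rightarrow> 'e) \<Rightarrow> bool" where
  "levi_civita A g conn \<longleftrightarrow> connection_along A A (\<lambda>p. p) conn \<and>
     (\<forall>U X Y. open U \<and> vector_field A U X \<and> vector_field A U Y \<longrightarrow>
        (\<forall>p\<in>U. \<forall>v. mderiv A (\<lambda>q. g q (X q) (Y q)) p v = g p (conn X p v) (Y p) + g p (X p) (conn Y p v)) \<and>
        (\<forall>p\<in>U. conn Y p (X p) - conn X p (Y p) = lie_bracket A X Y p))"

text \<open>
  For tangent fields \<open>X\<close>, \<open>Y\<close> of the source of \<open>\<phi>\<close> and a section \<open>W\<close>:
  \<open>D\<^sub>X D\<^sub>Y W - D\<^sub>Y D\<^sub>X W - D\<^bsub>[X,Y]\<^esub> W\<close>.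
\<close>

definition curvature ::
  "('b, 'd::euclidean_space) atlas \<Rightarrow> (('b \<Rightarrow> 'e::euclidean_space) \<Rightarrow> 'b \<Rightarrow> 'd \<Rightarrow> 'e)
    \<Rightarrow> ('b \<Rightarrow> 'd) \<Rightarrow> ('b \<Rightarrow> 'd) \<Rightarrow> ('b \<Rightarrow> 'e) \<Rightarrow> 'b \<Rightarrow> 'e" where
  "curvature A D X Y W p =
     D (\<lambda>q. D W q (Y q)) p (X p) - D (\<lambda>q. D W q (X q)) p (Y p) - D W p (lie_bracket A X Y p)"

definition flat ::
  "('a::topological_space, 'e::euclidean_space) atlas \<Rightarrow> (('a \<Rightarrow> 'e) \<Rightarrow> 'a \<Rightarrow> 'e \<Rightarrow> 'e) \<Rightarrow> bool" where
  "flat A conn \<longleftrightarrow> (\<forall>U X Y Z. open U \<and> vector_field A U X \<and> vector_field A U Y \<and> vector_field A U Z \<longrightarrow>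
     (\<forall>p\<in>U. curvature A conn X Y Z p = 0))"

definition sectional_curvature ::
  "('a, 'e::euclidean_space) atlas \<Rightarrow> ('a \<Rightarrow> 'e \<Rightarrow> 'e \<Rightarrow> real) \<Rightarrow> (('a \<Rightarrow> 'e) \<Rightarrow> 'a \<Rightarrow> 'e \<Rightarrow> 'e)
    \<Rightarrow> ('a \<Rightarrow> 'e) \<Rightarrow> ('a \<Rightarrow> 'e) \<Rightarrow> 'a \<Rightarrow> real" where
  "sectional_curvature A g conn X Y p =
     g p (curvature A conn X Y Y p) (X p) / (g p (X p) (X p) * g p (Y p) (Y p) - (g p (X p) (Y p))\<^sup>2)"

text \<open>
  Vector fields near \<open>p\<close> whose values at \<open>p\<close> form an orthonormal basis of the tangent space.  They
  are used to evaluate traces of tensors at \<open>p\<close>, which do not depend on the choice.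
\<close>

definition orthonormal_at ::
  "('a::topological_space, 'e::euclidean_space) atlas \<Rightarrow> ('a \<Rightarrow> 'e \<Rightarrow> 'e \<Rightarrow> real) \<Rightarrow> 'a
    \<Rightarrow> ('e \<Rightarrow> 'a \<Rightarrow> 'e) \<Rightarrow> bool" where
  "orthonormal_at A g p E \<longleftrightarrow>
     (\<exists>U. open U \<and> p \<in> U \<and> (\<forall>i\<in>Basis. vector_field A U (E i))) \<and>
     (\<forall>i\<in>Basis. \<forall>j\<in>Basis. g p (E i p) (E j p) = (if i = j then 1 else 0))"

definition frame ::
  "('a::topological_space, 'e::euclidean_space) atlas \<Rightarrow> ('a \<Rightarrow> 'e \<Rightarrow> 'e \<Rightarrow> real) \<Rightarrow> 'a
    \<Rightarrow> 'e \<Rightarrow> 'a \<Rightarrow> 'e" where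
  "frame A g p = (SOME E. orthonormal_at A g p E)"

definition scalar_curvature ::
  "('a::topological_space, 'e::euclidean_space) atlas \<Rightarrow> ('a \<Rightarrow> 'e \<Rightarrow> 'e \<Rightarrow> real)
    \<Rightarrow> (('a \<Rightarrow> 'e) \<Rightarrow> 'a \<Rightarrow> 'e \<Rightarrow> 'e) \<Rightarrow> 'a \<Rightarrow> real" where
  "scalar_curvature A g conn p = (let E = frame A g p in
     \<Sum>i\<in>Basis. \<Sum>j\<in>Basis. g p (curvature A conn (E i) (E j) (E j) p) (E i p))"

subsection \<open>Complex space forms\<close>

definition kaehler ::
  "('a::{second_countable_topology,t2_space}, 'e::euclidean_space) atlas \<Rightarrow> ('a \<Rightarrow> 'e \<Rightarrow> 'e \<Rightarrow> real)
    \<Rightarrow> ('a \<Rightarrow> 'e \<Rightarrow> 'e) \<Rightarrow> (('a \<Rightarrow> 'e) \<Rightarrow> 'a \<Rightarrow> 'e \<Rightarrow> 'e) \<Rightarrow> bool" where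
  "kaehler B g J conn \<longleftrightarrow> smooth_atlas B \<and> riemannian_metric B g \<and> levi_civita B g conn \<and>
     (\<forall>p. linear (J p) \<and> (\<forall>v. J p (J p v) = - v) \<and> (\<forall>v w. g p (J p v) (J p w) = g p v w)) \<and>
     (\<forall>U X. open U \<and> vector_field B U X \<longrightarrow> vector_field B U (\<lambda>p. J p (X p)) \<and>
        (\<forall>p\<in>U. \<forall>v. conn (\<lambda>q. J q (X q)) p v = J p (conn X p v)))"

definition complex_space_form ::
  "('a::{second_countable_topology,t2_space}, 'e::euclidean_space) atlas \<Rightarrow> ('a \<Rightarrow> 'e \<Rightarrow> 'e \<Rightarrow> real)
    \<Rightarrow> ('a \<Rightarrow> 'e \<Rightarrow> 'e) \<Rightarrow> (('a \<Rightarrow> 'e) \<Rightarrow> 'a \<Rightarrow> 'e \<Rightarrow> 'e) \<Rightarrow> real \<Rightarrow> bool" where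
  "complex_space_form B g J conn \<mu> \<longleftrightarrow> kaehler B g J conn \<and>
     (\<forall>U X. open U \<and> vector_field B U X \<longrightarrow>
        (\<forall>p\<in>U. X p \<noteq> 0 \<longrightarrow> sectional_curvature B g conn X (\<lambda>q. J q (X q)) p = \<mu>))"

subsection \<open>Submanifolds\<close>

text \<open>
  A submanifold is given by an immersion \<open>\<phi>\<close> of a manifold with atlas \<open>A\<close> into the ambient
  manifold with atlas \<open>B\<close>.  Ambient covariant derivatives of fields along the submanifold are
  taken with the pullback \<open>D\<close>
  of the ambient connection, which is uniquely determined by the chain rule below.
\<close>

definition pullback_connection ::
  "('b::topological_space, 'd::euclidean_space) atlas \<Rightarrow> ('a::topological_space, 'e::euclidean_space) atlas
    \<Rightarrow> ('b \<Rightarrow> 'a) \<Rightarrow> (('a \<Rightarrow> 'e) \<Rightarrow> 'a \<Rightarrow> 'e \<Rightarrow> 'e) \<Rightarrow> (('b \<Rightarrow> 'e) \<Rightarrow> 'b \<Rightarrow> 'd \<Rightarrow> 'e) \<Rightarrow> bool" where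
  "pullback_connection A B \<phi> conn D \<longleftrightarrow> connection_along A B \<phi> D \<and>
     (\<forall>V Z. open V \<and> vector_field B V Z \<longrightarrow>
        (\<forall>p v. \<phi> p \<in> V \<longrightarrow> D (\<lambda>q. Z (\<phi> q)) p v = conn Z (\<phi> p) (tangent_map A B \<phi> p v)))"

definition induced_metric ::
  "('b, 'd::euclidean_space) atlas \<Rightarrow> ('a, 'e::euclidean_space) atlas \<Rightarrow> ('b \<Rightarrow> 'a)
    \<Rightarrow> ('a \<Rightarrow> 'e \<Rightarrow> 'e \<Rightarrow> real) \<Rightarrow> 'b \<Rightarrow> 'd \<Rightarrow> 'd \<Rightarrow> real" where
  "induced_metric A B \<phi> g p v w = g (\<phi> p) (tangent_map A B \<phi> p v) (tangent_map A B \<phi> p w)"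

definition totally_real ::
  "('b, 'd::euclidean_space) atlas \<Rightarrow> ('a, 'e::euclidean_space) atlas \<Rightarrow> ('b \<Rightarrow> 'a)
    \<Rightarrow> ('a \<Rightarrow> 'e \<Rightarrow> 'e \<Rightarrow> real) \<Rightarrow> ('a \<Rightarrow> 'e \<Rightarrow> 'e) \<Rightarrow> bool" where
  "totally_real A B \<phi> g J \<longleftrightarrow>
     (\<forall>p v w. g (\<phi> p) (J (\<phi> p) (tangent_map A B \<phi> p v)) (tangent_map A B \<phi> p w) = 0)"

definition tangential_part ::
  "('b, 'd::euclidean_space) atlas \<Rightarrow> ('a, 'e::euclidean_space) atlas \<Rightarrow> ('b \<Rightarrow> 'a)
    \<Rightarrow> ('a \<Rightarrow> 'e \<Rightarrow> 'e \<Rightarrow> real) \<Rightarrow> 'b \<Rightarrow> 'e \<Rightarrow> 'd" where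
  "tangential_part A B \<phi> g p w =
     (THE v. \<forall>x. g (\<phi> p) (w - tangent_map A B \<phi> p v) (tangent_map A B \<phi> p x) = 0)"

definition normal_part ::
  "('b, 'd::euclidean_space) atlas \<Rightarrow> ('a, 'e::euclidean_space) atlas \<Rightarrow> ('b \<Rightarrow> 'a)
    \<Rightarrow> ('a \<Rightarrow> 'e \<Rightarrow> 'e \<Rightarrow> real) \<Rightarrow> 'b \<Rightarrow> 'e \<Rightarrow> 'e" where
  "normal_part A B \<phi> g p w = w - tangent_map A B \<phi> p (tangential_part A B \<phi> g p w)"

definition normal_field ::
  "('b::topological_space, 'd::euclidean_space) atlas \<Rightarrow> ('a, 'e::euclidean_space) atlas \<Rightarrow> ('b \<Rightarrow> 'a)
    \<Rightarrow> ('a \<Rightarrow> 'e \<Rightarrow> 'e \<Rightarrow> real) \<Rightarrow> 'b set \<Rightarrow> ('b \<Rightarrow> 'e) \<Rightarrow> bool" where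
  "normal_field A B \<phi> g U \<xi> \<longleftrightarrow> smooth_along A B \<phi> U \<xi> \<and>
     (\<forall>p\<in>U. \<forall>x. g (\<phi> p) (\<xi> p) (tangent_map A B \<phi> p x) = 0)"

definition normal_connection ::
  "('b, 'd::euclidean_space) atlas \<Rightarrow> ('a, 'e::euclidean_space) atlas \<Rightarrow> ('b \<Rightarrow> 'a)
    \<Rightarrow> ('a \<Rightarrow> 'e \<Rightarrow> 'e \<Rightarrow> real) \<Rightarrow> (('b \<Rightarrow> 'e) \<Rightarrow> 'b \<Rightarrow> 'd \<Rightarrow> 'e) \<Rightarrow> ('b \<Rightarrow> 'e) \<Rightarrow> 'b \<Rightarrow> 'd \<Rightarrow> 'e" where
  "normal_connection A B \<phi> g D \<xi> p v = normal_part A B \<phi> g p (D \<xi> p v)"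

definition f_structure ::
  "('b, 'd::euclidean_space) atlas \<Rightarrow> ('a, 'e::euclidean_space) atlas \<Rightarrow> ('b \<Rightarrow> 'a)
    \<Rightarrow> ('a \<Rightarrow> 'e \<Rightarrow> 'e \<Rightarrow> real) \<Rightarrow> ('a \<Rightarrow> 'e \<Rightarrow> 'e) \<Rightarrow> 'b \<Rightarrow> 'e \<Rightarrow> 'e" where
  "f_structure A B \<phi> g J p w = normal_part A B \<phi> g p (J (\<phi> p) w)"

definition parallel_f_structure ::
  "('b::topological_space, 'd::euclidean_space) atlas \<Rightarrow> ('a, 'e::euclidean_space) atlas \<Rightarrow> ('b \<Rightarrow> 'a)
    \<Rightarrow> ('a \<Rightarrow> 'e \<Rightarrow> 'e \<Rightarrow> real) \<Rightarrow> ('a \<Rightarrow> 'e \<Rightarrow> 'e) \<Rightarrow> (('b \<Rightarrow> 'e) \<Rightarrow> 'b \<Rightarrow> 'd \<Rightarrow> 'e) \<Rightarrow> bool" where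
  "parallel_f_structure A B \<phi> g J D \<longleftrightarrow>
     (\<forall>U \<xi>. open U \<and> normal_field A B \<phi> g U \<xi> \<longrightarrow>
        (\<forall>p\<in>U. \<forall>v. normal_connection A B \<phi> g D (\<lambda>q. f_structure A B \<phi> g J q (\<xi> q)) p v -
           f_structure A B \<phi> g J p (normal_connection A B \<phi> g D \<xi> p v) = 0))"

definition second_fundamental_form ::
  "('b, 'd::euclidean_space) atlas \<Rightarrow> ('a, 'e::euclidean_space) atlas \<Rightarrow> ('b \<Rightarrow> 'a)
    \<Rightarrow> (('b \<Rightarrow> 'd) \<Rightarrow> 'b \<Rightarrow> 'd \<Rightarrow> 'd) \<Rightarrow> (('b \<Rightarrow> 'e) \<Rightarrow> 'b \<Rightarrow> 'd \<Rightarrow> 'e)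
    \<Rightarrow> ('b \<Rightarrow> 'd) \<Rightarrow> ('b \<Rightarrow> 'd) \<Rightarrow> 'b \<Rightarrow> 'e" where
  "second_fundamental_form A B \<phi> conn D X Y p =
     D (\<lambda>q. tangent_map A B \<phi> q (Y q)) p (X p) - tangent_map A B \<phi> p (conn Y p (X p))"

definition totally_geodesic ::
  "('b::topological_space, 'd::euclidean_space) atlas \<Rightarrow> ('a, 'e::euclidean_space) atlas \<Rightarrow> ('b \<Rightarrow> 'a)
    \<Rightarrow> (('b \<Rightarrow> 'd) \<Rightarrow> 'b \<Rightarrow> 'd \<Rightarrow> 'd) \<Rightarrow> (('b \<Rightarrow> 'e) \<Rightarrow> 'b \<Rightarrow> 'd \<Rightarrow> 'e) \<Rightarrow> bool" where
  "totally_geodesic A B \<phi> conn D \<longleftrightarrow>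
     (\<forall>U X Y. open U \<and> vector_field A U X \<and> vector_field A U Y \<longrightarrow>
        (\<forall>p\<in>U. second_fundamental_form A B \<phi> conn D X Y p = 0))"

definition mean_curvature ::
  "('b::topological_space, 'd::euclidean_space) atlas \<Rightarrow> ('a, 'e::euclidean_space) atlas \<Rightarrow> ('b \<Rightarrow> 'a)
    \<Rightarrow> ('a \<Rightarrow> 'e \<Rightarrow> 'e \<Rightarrow> real) \<Rightarrow> (('b \<Rightarrow> 'd) \<Rightarrow> 'b \<Rightarrow> 'd \<Rightarrow> 'd) \<Rightarrow> (('b \<Rightarrow> 'e) \<Rightarrow> 'b \<Rightarrow> 'd \<Rightarrow> 'e)
    \<Rightarrow> 'b \<Rightarrow> 'e" where
  "mean_curvature A B \<phi> g conn D p = (let E = frame A (induced_metric A B \<phi> g) p in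
     (1 / real DIM('d)) *\<^sub>R (\<Sum>i\<in>Basis. second_fundamental_form A B \<phi> conn D (E i) (E i) p))"

definition minimal ::
  "('b::topological_space, 'd::euclidean_space) atlas \<Rightarrow> ('a, 'e::euclidean_space) atlas \<Rightarrow> ('b \<Rightarrow> 'a)
    \<Rightarrow> ('a \<Rightarrow> 'e \<Rightarrow> 'e \<Rightarrow> real) \<Rightarrow> (('b \<Rightarrow> 'd) \<Rightarrow> 'b \<Rightarrow> 'd \<Rightarrow> 'd) \<Rightarrow> (('b \<Rightarrow> 'e) \<Rightarrow> 'b \<Rightarrow> 'd \<Rightarrow> 'e)
    \<Rightarrow> bool" where
  "minimal A B \<phi> g conn D \<longleftrightarrow> (\<forall>p. mean_curvature A B \<phi> g conn D p = 0)"

definition sff_length_sq ::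
  "('b::topological_space, 'd::euclidean_space) atlas \<Rightarrow> ('a, 'e::euclidean_space) atlas \<Rightarrow> ('b \<Rightarrow> 'a)
    \<Rightarrow> ('a \<Rightarrow> 'e \<Rightarrow> 'e \<Rightarrow> real) \<Rightarrow> (('b \<Rightarrow> 'd) \<Rightarrow> 'b \<Rightarrow> 'd \<Rightarrow> 'd) \<Rightarrow> (('b \<Rightarrow> 'e) \<Rightarrow> 'b \<Rightarrow> 'd \<Rightarrow> 'e)
    \<Rightarrow> 'b \<Rightarrow> real" where
  "sff_length_sq A B \<phi> g conn D p = (let E = frame A (induced_metric A B \<phi> g) p in
     \<Sum>i\<in>Basis. \<Sum>j\<in>Basis. g (\<phi> p) (second_fundamental_form A B \<phi> conn D (E i) (E j) p)
                              (second_fundamental_form A B \<phi> conn D (E i) (E j) p))"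

definition semiparallel ::
  "('b::topological_space, 'd::euclidean_space) atlas \<Rightarrow> ('a, 'e::euclidean_space) atlas \<Rightarrow> ('b \<Rightarrow> 'a)
    \<Rightarrow> ('a \<Rightarrow> 'e \<Rightarrow> 'e \<Rightarrow> real) \<Rightarrow> (('b \<Rightarrow> 'd) \<Rightarrow> 'b \<Rightarrow> 'd \<Rightarrow> 'd) \<Rightarrow> (('b \<Rightarrow> 'e) \<Rightarrow> 'b \<Rightarrow> 'd \<Rightarrow> 'e)
    \<Rightarrow> bool" where
  "semiparallel A B \<phi> g conn D \<longleftrightarrow>
     (let \<sigma> = second_fundamental_form A B \<phi> conn D;
          R = curvature A conn;
          R' = curvature A (normal_connection A B \<phi> g D)
      in \<forall>U X Y Z W. open U \<and> vector_field A U X \<and> vector_field A U Y \<and>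
           vector_field A U Z \<and> vector_field A U W \<longrightarrow>
           (\<forall>p\<in>U. R' X Y (\<sigma> Z W) p - \<sigma> (R X Y Z) W p - \<sigma> Z (R X Y W) p = 0))"

end

theory Submission
  imports Defs
begin

text \<open>
  The statement is pointwise. Parallelity of the f-structure applied to the normal fields
  \<open>J Y\<close> forces \<open>\<sigma>\<close> into \<open>J TM\<close>, so \<open>\<sigma>\<close> amounts to a cubic form
  \<open>S i j k = \<langle>\<sigma>(e\<^sub>i, e\<^sub>j), J e\<^sub>k\<rangle>\<close>, totally symmetric and, by minimality, traceless; and
  semiparallelity becomes \<open>R \<cdot> S = 0\<close>. With \<open>c = \<mu>/4\<close>, \<open>N = |\<sigma>|\<^sup>2\<close>, \<open>C\<close> the
  curvature-like tensor of the commutators \<open>[S\<^sub>i, S\<^sub>j]\<close> and \<open>T i j = tr (S\<^sub>i S\<^sub>j)\<close>, the Gauss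
  equation gives \<open>\<tau> = c n (n - 1) - N\<close>, and contracting \<open>R \<cdot> S = 0\<close> with \<open>S\<close> gives
  \<open>(n + 1) c N = |C|\<^sup>2 + |T|\<^sup>2\<close>. Since \<open>C\<close> has scalar curvature \<open>-N\<close> and \<open>T\<close> has trace
  \<open>N\<close>, the Cauchy-Schwarz bounds \<open>|C|\<^sup>2 \<ge> 2 N\<^sup>2 / (n (n - 1))\<close> and \<open>|T|\<^sup>2 \<ge> N\<^sup>2 / n\<close> yield
  \<open>N \<tau> \<ge> 0\<close>; if \<open>\<tau> = 0\<close> and \<open>N \<noteq> 0\<close>, equality makes \<open>R\<close> of constant curvature, hence zero.
\<close>

subsection \<open>Calculus of smooth maps on open sets\<close>

text \<open>The contraction used for \<open>R \<cdot> S = 0\<close> has its origin in Simons'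
  formula for the Laplacian of the squared length of \<sigma>: commuting two covariant derivatives
  of \<sigma> there leaves the curvature operator of \<open>e_i, e_j\<close> acting on
  \<open>S i l p\<close>, paired with \<open>S j l p\<close>. Semiparallelity annihilates exactly
  this term at each point, so the length of \<sigma> is never differentiated. Semiparallelity
  involves the normal curvature, which turns into \<open>R\<close> because \<open>J \<sigma>\<close>
  is tangent: on \<open>J TM\<close> the normal connection corresponds under \<open>J\<close> to the
  Levi-Civita connection. Most of the length goes into a bridge. The algebra lives on one tangent
  space, but the geometric notions are stated for fields on open sets, and \<open>D\<close> is
  characterized by the connection rules and its values on composites of ambient fields with \<phi>.
  A section along an immersion need not be such a composite, so sections are expanded locally in
  pulled back coordinate fields.\<close>

abbreviation fderiv :: "('e::real_normed_vector \<Rightarrow> 'f::real_normed_vector) \<Rightarrow> 'e \<Rightarrow> 'e \<Rightarrow> 'f" where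
  "fderiv f x \<equiv> frechet_derivative f (at x)"

lemma frechet_derivative_eqI:
  "(f has_derivative f') (at x) \<Longrightarrow> fderiv f x = f'"
  using frechet_derivative_at by metis

lemma Ck_on_subset: "Ck_on k S f \<Longrightarrow> T \<subseteq> S \<Longrightarrow> Ck_on k T f"
  by (induction k arbitrary: f) (auto intro: continuous_on_subset)

lemma frechet_derivative_cong_open:
  assumes "open S" "x \<in> S" "\<And>y. y \<in> S \<Longrightarrow> f y = g y"
  shows "fderiv f x = fderiv g x"
proof -
  have "(f has_derivative D) (at x) \<longleftrightarrow> (g has_derivative D) (at x)" for D
    using assms has_derivative_transform_within_open[of f D x UNIV S g]
      has_derivative_transform_within_open[of g D x UNIV S f] by auto
  then show ?thesis by (simp add: frechet_derivative_def)
qed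

lemma differentiable_cong_open:
  assumes "open S" "x \<in> S" "\<And>y. y \<in> S \<Longrightarrow> f y = g y" "f differentiable (at x)"
  shows "g differentiable (at x)"
  using assms has_derivative_transform_within_open[of f _ x UNIV S g]
  unfolding differentiable_def by blast

lemma Ck_on_cong:
  assumes "open S" "\<And>x. x \<in> S \<Longrightarrow> f x = g x" "Ck_on k S f"
  shows "Ck_on k S g"
  using assms
proof (induction k arbitrary: f g)
  case 0 then show ?case by (simp cong: continuous_on_cong)
next
  case (Suc k)
  have "g differentiable (at x)" if "x \<in> S" for x
    using differentiable_cong_open[OF Suc.prems(1) that Suc.prems(2)] Suc.prems(3) that by auto
  moreover have "Ck_on k S (\<lambda>x. fderiv g x v)" for v
  proof (rule Suc.IH[OF Suc.prems(1)])
    show "Ck_on k S (\<lambda>x. fderiv f x v)" using Suc.prems(3) by simp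
    fix x assume "x \<in> S"
    then show "fderiv f x v = fderiv g x v"
      using frechet_derivative_cong_open[OF Suc.prems(1) _ Suc.prems(2), of x] by simp
  qed
  ultimately show ?case by simp
qed

lemma Ck_on_local:
  assumes "\<And>x. x \<in> S \<Longrightarrow> \<exists>T. open T \<and> x \<in> T \<and> Ck_on k T f"
  shows "Ck_on k S f"
  using assms
proof (induction k arbitrary: f)
  case 0
  have "continuous (at x) f" if "x \<in> S" for x
    using 0[OF that] by (auto simp: continuous_on_eq_continuous_at)
  then show ?case by (simp add: continuous_at_imp_continuous_on)
next
  case (Suc k)
  have "f differentiable (at x)" if "x \<in> S" for x using Suc.prems[OF that] by auto
  moreover have "Ck_on k S (\<lambda>x. fderiv f x v)" for v
    by (rule Suc.IH) (use Suc.prems in fastforce)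
  ultimately show ?case by simp
qed

lemma Ck_on_const: "Ck_on k S (\<lambda>x. c)"
  by (induction k arbitrary: c) auto

lemma Ck_on_Suc_imp: "Ck_on (Suc k) S f \<Longrightarrow> Ck_on k S f"
proof (induction k arbitrary: f)
  case 0
  then show ?case
    by (auto intro!: continuous_at_imp_continuous_on differentiable_imp_continuous_within)
next
  case (Suc k)
  have "Ck_on k S (\<lambda>x. fderiv f x v)" for v
    by (rule Suc.IH) (use Suc.prems in simp)
  then show ?case using Suc.prems by simp
qed

lemma Ck_on_continuous: "Ck_on k S f \<Longrightarrow> continuous_on S f"
  by (induction k) (use Ck_on_Suc_imp in auto)

text \<open>The pattern of the following closure lemmas: the derivative is given by a formula valid
  only at points of \<open>S\<close>, the formula is of class \<open>k\<close> by induction, and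
  \<open>Ck_on_cong\<close>, which needs \<open>S\<close> open, transfers this to
  \<open>fderiv\<close>.\<close>

lemma Ck_on_add:
  assumes "open S" shows "Ck_on k S f \<Longrightarrow> Ck_on k S g \<Longrightarrow> Ck_on k S (\<lambda>x. f x + g x)"
proof (induction k arbitrary: f g)
  case 0 then show ?case by (simp add: continuous_on_add)
next
  case (Suc k)
  have *: "((\<lambda>x. f x + g x) has_derivative
      (\<lambda>v. fderiv f x v + fderiv g x v)) (at x)" if "x \<in> S" for x
    using Suc.prems that by (auto intro!: has_derivative_add simp: frechet_derivative_works[symmetric])
  have D1: "Ck_on k S (\<lambda>x. fderiv f x v + fderiv g x v)" for v
    using Suc.IH Suc.prems by simp
  have "Ck_on k S (\<lambda>x. fderiv (\<lambda>x. f x + g x) x v)" for v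
    by (rule Ck_on_cong[OF assms(1) _ D1[of v]]) (simp add: frechet_derivative_eqI[OF *])
  moreover have "(\<lambda>x. f x + g x) differentiable (at x)" if "x \<in> S" for x
    using *[OF that] differentiableI by blast
  ultimately show ?case by simp
qed

lemma Ck_on_sum:
  assumes "open S" "finite I" "\<And>i. i \<in> I \<Longrightarrow> Ck_on k S (f i)"
  shows "Ck_on k S (\<lambda>x. \<Sum>i\<in>I. f i x)"
  using assms(2,3) by (induction I rule: finite_induct) (auto simp: Ck_on_const intro!: Ck_on_add assms(1))

lemma Ck_on_linear:
  assumes "open S" "bounded_linear L" shows "Ck_on k S f \<Longrightarrow> Ck_on k S (\<lambda>x. L (f x))"
proof (induction k arbitrary: f)
  case 0 then show ?case using assms by (simp add: bounded_linear.continuous_on)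
next
  case (Suc k)
  have *: "((\<lambda>x. L (f x)) has_derivative (\<lambda>v. L (fderiv f x v))) (at x)"
    if "x \<in> S" for x
    using Suc.prems that
    by (auto intro!: bounded_linear.has_derivative[OF assms(2)] simp: frechet_derivative_works[symmetric])
  have D1: "Ck_on k S (\<lambda>x. L (fderiv f x v))" for v
    using Suc.IH Suc.prems by simp
  have "Ck_on k S (\<lambda>x. fderiv (\<lambda>x. L (f x)) x v)" for v
    by (rule Ck_on_cong[OF assms(1) _ D1[of v]]) (simp add: frechet_derivative_eqI[OF *])
  moreover have "(\<lambda>x. L (f x)) differentiable (at x)" if "x \<in> S" for x
    using *[OF that] differentiableI by blast
  ultimately show ?case by simp
qed

lemma Ck_on_bilinear:
  assumes "open S" "bounded_bilinear B"
  shows "Ck_on k S f \<Longrightarrow> Ck_on k S g \<Longrightarrow> Ck_on k S (\<lambda>x. B (f x) (g x))"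
proof (induction k arbitrary: f g)
  case 0 then show ?case using assms by (simp add: bounded_bilinear.continuous_on)
next
  case (Suc k)
  have *: "((\<lambda>x. B (f x) (g x)) has_derivative
      (\<lambda>v. B (f x) (fderiv g x v) + B (fderiv f x v) (g x))) (at x)"
    if "x \<in> S" for x
    using Suc.prems that
    by (auto intro!: bounded_bilinear.FDERIV[OF assms(2)] simp: frechet_derivative_works[symmetric])
  have D1: "Ck_on k S (\<lambda>x. B (f x) (fderiv g x v) + B (fderiv f x v) (g x))" for v
    using Suc.prems Ck_on_Suc_imp[OF Suc.prems(1)] Ck_on_Suc_imp[OF Suc.prems(2)]
    by (intro Ck_on_add assms Suc.IH) simp_all
  have "Ck_on k S (\<lambda>x. fderiv (\<lambda>x. B (f x) (g x)) x v)" for v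
    by (rule Ck_on_cong[OF assms(1) _ D1[of v]]) (simp add: frechet_derivative_eqI[OF *])
  moreover have "(\<lambda>x. B (f x) (g x)) differentiable (at x)" if "x \<in> S" for x
    using *[OF that] differentiableI by blast
  ultimately show ?case by simp
qed

lemma Ck_on_inverse:
  fixes f :: "'e::euclidean_space \<Rightarrow> real"
  assumes "open S" "\<And>x. x \<in> S \<Longrightarrow> f x \<noteq> 0" shows "Ck_on k S f \<Longrightarrow> Ck_on k S (\<lambda>x. inverse (f x))"
proof (induction k)
  case 0 then show ?case using assms by (simp add: continuous_on_inverse)
next
  case (Suc k)
  have *: "((\<lambda>x. inverse (f x)) has_derivative
      (\<lambda>v. - (inverse (f x) * fderiv f x v * inverse (f x)))) (at x)"
    if "x \<in> S" for x
    using Suc.prems that assms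
    by (auto intro!: has_derivative_inverse simp: frechet_derivative_works[symmetric])
  \<comment> \<open>The sign is written as a constant factor, so that the product rule is the only
    closure property used.\<close>
  have D1: "Ck_on k S (\<lambda>x. -1 * (inverse (f x) * fderiv f x v * inverse (f x)))" for v
    using Suc.prems Suc.IH[OF Ck_on_Suc_imp[OF Suc.prems]]
    by (intro Ck_on_bilinear[OF assms(1) bounded_bilinear_mult] Ck_on_const) simp_all
  have "Ck_on k S (\<lambda>x. fderiv (\<lambda>x. inverse (f x)) x v)" for v
    by (rule Ck_on_cong[OF assms(1) _ D1[of v]]) (simp add: frechet_derivative_eqI[OF *])
  moreover have "(\<lambda>x. inverse (f x)) differentiable (at x)" if "x \<in> S" for x
    using *[OF that] differentiableI by blast
  ultimately show ?case by simp
qed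

lemma linear_Basis_expand:
  fixes L :: "'e::euclidean_space \<Rightarrow> 'f::real_vector"
  assumes "linear L"
  shows "L v = (\<Sum>i\<in>Basis. (v \<bullet> i) *\<^sub>R L i)"
proof -
  have "L v = L (\<Sum>i\<in>Basis. (v \<bullet> i) *\<^sub>R i)" by (simp add: euclidean_representation)
  then show ?thesis by (simp add: linear_sum[OF assms] linear_cmul[OF assms])
qed

lemma Ck_on_compose:
  fixes g :: "'d::euclidean_space \<Rightarrow> 'e::euclidean_space"
  assumes "open S" "open T" "g ` S \<subseteq> T"
  shows "Ck_on k T f \<Longrightarrow> Ck_on k S g \<Longrightarrow> Ck_on k S (\<lambda>x. f (g x))"
proof (induction k arbitrary: f)
  case 0 then show ?case using continuous_on_compose2[of T f S g] assms by simp
next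
  case (Suc k)
  have *: "((\<lambda>x. f (g x)) has_derivative
      (\<lambda>v. fderiv f ((g x)) (fderiv g x v))) (at x)"
    if "x \<in> S" for x
  proof (rule has_derivative_compose[of g])
    show "(g has_derivative fderiv g x) (at x)"
      using Suc.prems(2) that frechet_derivative_works by auto
    show "(f has_derivative fderiv f ((g x))) (at (g x))"
      using Suc.prems(1) that assms(3) frechet_derivative_works by (metis Ck_on.simps(2) image_subset_iff)
  qed
  \<comment> \<open>\<open>Ck_on\<close> controls derivatives in fixed directions only, while the
    chain rule applies the derivative of \<open>f\<close> to a vector that moves with
    \<open>x\<close>. Expanding this vector in the basis leaves fixed directions with scalar
    coefficients.\<close>
  have D1: "Ck_on k S (\<lambda>x. \<Sum>i\<in>Basis. (fderiv g x v \<bullet> i) *\<^sub>R fderiv f ((g x)) i)" for v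
  proof (intro Ck_on_sum Ck_on_bilinear[OF assms(1) bounded_bilinear_scaleR] assms finite_Basis)
    fix i :: 'e
    show "Ck_on k S (\<lambda>x. fderiv g x v \<bullet> i)"
      using Suc.prems by (intro Ck_on_linear[OF assms(1) bounded_linear_inner_left]) auto
    show "Ck_on k S (\<lambda>x. fderiv f ((g x)) i)"
      using Suc.prems Ck_on_Suc_imp[OF Suc.prems(2)] by (intro Suc.IH) simp_all
  qed
  have "Ck_on k S (\<lambda>x. fderiv (\<lambda>x. f (g x)) x v)" for v
  proof (rule Ck_on_cong[OF assms(1) _ D1[of v]])
    fix x assume x: "x \<in> S"
    then have "f differentiable at (g x)" using Suc.prems assms by auto
    note e = linear_Basis_expand[OF linear_frechet_derivative[OF this], of "fderiv g x v"]
    show "(\<Sum>i\<in>Basis. (fderiv g x v \<bullet> i) *\<^sub>R fderiv f ((g x)) i)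
       = fderiv (\<lambda>x. f (g x)) x v"
      unfolding frechet_derivative_eqI[OF *[OF x]] by (rule e[symmetric])
  qed
  moreover have "(\<lambda>x. f (g x)) differentiable (at x)" if "x \<in> S" for x
    using *[OF that] differentiableI by blast
  ultimately show ?case by simp
qed

lemma smooth_on_subset: "smooth_on S f \<Longrightarrow> T \<subseteq> S \<Longrightarrow> smooth_on T f"
  using Ck_on_subset unfolding smooth_on_def by blast

lemma smooth_on_cong:
  "smooth_on S f \<Longrightarrow> open S \<Longrightarrow> (\<And>x. x \<in> S \<Longrightarrow> f x = g x) \<Longrightarrow> smooth_on S g"
  using Ck_on_cong unfolding smooth_on_def by blast

lemma smooth_on_local:
  "(\<And>x. x \<in> S \<Longrightarrow> \<exists>T. open T \<and> x \<in> T \<and> smooth_on T f) \<Longrightarrow> smooth_on S f"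
  unfolding smooth_on_def by (intro allI Ck_on_local) blast

lemma smooth_on_const [simp]: "smooth_on S (\<lambda>x. c)"
  by (simp add: smooth_on_def Ck_on_const)

lemma smooth_on_add:
  "open S \<Longrightarrow> smooth_on S f \<Longrightarrow> smooth_on S g \<Longrightarrow> smooth_on S (\<lambda>x. f x + g x)"
  by (simp add: smooth_on_def Ck_on_add)

lemma smooth_on_sum:
  "open S \<Longrightarrow> finite I \<Longrightarrow> (\<And>i. i \<in> I \<Longrightarrow> smooth_on S (f i)) \<Longrightarrow> smooth_on S (\<lambda>x. \<Sum>i\<in>I. f i x)"
  by (simp add: smooth_on_def Ck_on_sum)

lemma smooth_on_linear:
  "open S \<Longrightarrow> bounded_linear L \<Longrightarrow> smooth_on S f \<Longrightarrow> smooth_on S (\<lambda>x. L (f x))"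
  by (simp add: smooth_on_def Ck_on_linear)

lemma smooth_on_bilinear:
  "open S \<Longrightarrow> bounded_bilinear B \<Longrightarrow> smooth_on S f \<Longrightarrow> smooth_on S g \<Longrightarrow> smooth_on S (\<lambda>x. B (f x) (g x))"
  by (simp add: smooth_on_def Ck_on_bilinear)

lemma smooth_on_inverse:
  fixes f :: "'e::euclidean_space \<Rightarrow> real"
  shows "open S \<Longrightarrow> (\<And>x. x \<in> S \<Longrightarrow> f x \<noteq> 0) \<Longrightarrow> smooth_on S f \<Longrightarrow> smooth_on S (\<lambda>x. inverse (f x))"
  by (simp add: smooth_on_def Ck_on_inverse)

lemma smooth_on_compose:
  fixes g :: "'d::euclidean_space \<Rightarrow> 'e::euclidean_space"
  shows "smooth_on T f \<Longrightarrow> smooth_on S g \<Longrightarrow> open S \<Longrightarrow> open T \<Longrightarrow> g ` S \<subseteq> T \<Longrightarrow> smooth_on S (\<lambda>x. f (g x))"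
  by (simp add: smooth_on_def Ck_on_compose)

lemma smooth_on_imp_differentiable: "smooth_on S f \<Longrightarrow> x \<in> S \<Longrightarrow> f differentiable (at x)"
  unfolding smooth_on_def using Ck_on.simps(2)[of 0 S f] by metis

lemma smooth_on_imp_has_derivative:
  "smooth_on S f \<Longrightarrow> x \<in> S \<Longrightarrow> (f has_derivative fderiv f x) (at x)"
  using smooth_on_imp_differentiable frechet_derivative_works by blast

lemma smooth_on_imp_continuous_on: "smooth_on S f \<Longrightarrow> continuous_on S f"
  unfolding smooth_on_def using Ck_on_continuous by blast

lemma smooth_on_frechet_derivative:
  "smooth_on S f \<Longrightarrow> smooth_on S (\<lambda>x. fderiv f x v)"
  unfolding smooth_on_def using Ck_on.simps(2)[of _ S f] by metis

section \<open>Symmetry of second derivatives\<close>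

lemma has_derivative_along_line:
  fixes f :: "'e::euclidean_space \<Rightarrow> real"
  assumes "(f has_derivative f') (at (l u))" "(l has_derivative (\<lambda>h. h *\<^sub>R w)) (at u)"
  shows "((\<lambda>s. f (l s)) has_derivative (\<lambda>h. h * f' w)) (at u)"
  using has_derivative_compose[OF assms(2,1)] linear_cmul[OF has_derivative_linear[OF assms(1)]] by simp

lemma mvt_at_zero:
  fixes G :: "real \<Rightarrow> real"
  assumes "0 < t" "\<And>s. 0 \<le> s \<Longrightarrow> s \<le> t \<Longrightarrow> (G has_derivative (\<lambda>h. h * G' s)) (at s)"
  obtains s where "0 < s" "s < t" "G t - G 0 = t * G' s"
proof -
  have "DERIV G s :> G' s" if "0 \<le> s" "s \<le> t" for s
    using assms(2)[OF that] by (simp add: has_field_derivative_def mult.commute[of _ "G' s"])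
  from MVT2[OF assms(1) this] that show thesis by auto
qed

text \<open>Symmetry of second derivatives: two applications of the mean value theorem to the second
  difference \<open>f (x + tv + tw) - f (x + tv) - f (x + tw) + f x\<close> give mixed derivatives at points
  near \<open>x\<close>.\<close>

lemma second_difference_mvt:
  fixes f :: "'e::euclidean_space \<Rightarrow> real"
  assumes f: "smooth_on (ball x r) f" and t: "0 < t" "t * (norm v + norm w) < r"
  obtains z where "dist x z \<le> t * (norm v + norm w)"
    "f (x + t *\<^sub>R v + t *\<^sub>R w) - f (x + t *\<^sub>R v) - f (x + t *\<^sub>R w) + f x
      = t * t * fderiv (\<lambda>y. fderiv f y v) z w"
proof -
  have in_ball: "x + a *\<^sub>R v + b *\<^sub>R w \<in> ball x r \<and> dist x (x + a *\<^sub>R v + b *\<^sub>R w) \<le> t * (norm v + norm w)"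
    if "0 \<le> a" "a \<le> t" "0 \<le> b" "b \<le> t" for a b
  proof -
    have "norm (a *\<^sub>R v + b *\<^sub>R w) \<le> a * norm v + b * norm w"
      using norm_triangle_ineq[of "a *\<^sub>R v" "b *\<^sub>R w"] that by simp
    also have "\<dots> \<le> t * (norm v + norm w)" using that by (simp add: distrib_left add_mono mult_right_mono)
    finally have "norm (a *\<^sub>R v + b *\<^sub>R w) \<le> t * (norm v + norm w)" .
    moreover have "dist x (x + a *\<^sub>R v + b *\<^sub>R w) = norm (a *\<^sub>R v + b *\<^sub>R w)"
      by (metis add.assoc add_diff_cancel_left' dist_commute dist_norm)
    ultimately have "dist x (x + a *\<^sub>R v + b *\<^sub>R w) \<le> t * (norm v + norm w)" by simp
    then show ?thesis using t by simp
  qed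
  let ?Df = "\<lambda>y. fderiv f y"
  let ?G = "\<lambda>s. f (x + s *\<^sub>R v + t *\<^sub>R w) - f (x + s *\<^sub>R v)"
  have dG: "(?G has_derivative (\<lambda>h. h * (?Df (x + s *\<^sub>R v + t *\<^sub>R w) v - ?Df (x + s *\<^sub>R v) v))) (at s)"
    if s: "0 \<le> s" "s \<le> t" for s
  proof -
    have 1: "(f has_derivative ?Df (x + s *\<^sub>R v + t *\<^sub>R w)) (at (x + s *\<^sub>R v + t *\<^sub>R w))"
      using in_ball[of s t] s t by (intro smooth_on_imp_has_derivative[OF f]) auto
    have 2: "(f has_derivative ?Df (x + s *\<^sub>R v)) (at (x + s *\<^sub>R v))"
      using in_ball[of s 0] s t by (intro smooth_on_imp_has_derivative[OF f]) auto
    have "((\<lambda>s. f (x + s *\<^sub>R v + t *\<^sub>R w)) has_derivative (\<lambda>h. h * ?Df (x + s *\<^sub>R v + t *\<^sub>R w) v)) (at s)"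
      by (rule has_derivative_along_line[where l = "\<lambda>s. x + s *\<^sub>R v + t *\<^sub>R w", OF 1]) (auto intro!: derivative_eq_intros)
    moreover have "((\<lambda>s. f (x + s *\<^sub>R v)) has_derivative (\<lambda>h. h * ?Df (x + s *\<^sub>R v) v)) (at s)"
      by (rule has_derivative_along_line[where l = "\<lambda>s. x + s *\<^sub>R v", OF 2]) (auto intro!: derivative_eq_intros)
    ultimately have "(?G has_derivative (\<lambda>h. h * ?Df (x + s *\<^sub>R v + t *\<^sub>R w) v - h * ?Df (x + s *\<^sub>R v) v)) (at s)"
      by (rule has_derivative_diff)
    then show ?thesis by (simp add: right_diff_distrib)
  qed
  define G where "G = ?G"
  define G' where "G' s = ?Df (x + s *\<^sub>R v + t *\<^sub>R w) v - ?Df (x + s *\<^sub>R v) v" for s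
  have dG': "(G has_derivative (\<lambda>h. h * G' s)) (at s)" if "0 \<le> s" "s \<le> t" for s
    using dG[OF that] unfolding G_def G'_def .
  obtain s where s: "0 < s" "s < t" "G t - G 0 = t * G' s"
    using mvt_at_zero[of t G G', OF t(1) dG'] .
  let ?g = "\<lambda>y. ?Df y v"
  let ?H = "\<lambda>u. ?g (x + s *\<^sub>R v + u *\<^sub>R w)"
  have dH: "(?H has_derivative (\<lambda>h. h * fderiv ?g ((x + s *\<^sub>R v + u *\<^sub>R w)) w)) (at u)"
    if u: "0 \<le> u" "u \<le> t" for u
  proof -
    have 1: "(?g has_derivative fderiv ?g ((x + s *\<^sub>R v + u *\<^sub>R w))) (at (x + s *\<^sub>R v + u *\<^sub>R w))"
      using in_ball[of s u] s t u by (intro smooth_on_imp_has_derivative[OF smooth_on_frechet_derivative[OF f]]) auto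
    show ?thesis
      by (rule has_derivative_along_line[where l = "\<lambda>u. x + s *\<^sub>R v + u *\<^sub>R w", OF 1]) (auto intro!: derivative_eq_intros)
  qed
  define H where "H = ?H"
  define H' where "H' u = fderiv ?g ((x + s *\<^sub>R v + u *\<^sub>R w)) w" for u
  have dH': "(H has_derivative (\<lambda>h. h * H' u)) (at u)" if "0 \<le> u" "u \<le> t" for u
    using dH[OF that] unfolding H_def H'_def .
  obtain u where u: "0 < u" "u < t" "H t - H 0 = t * H' u"
    using mvt_at_zero[of t H H', OF t(1) dH'] .
  have "f (x + t *\<^sub>R v + t *\<^sub>R w) - f (x + t *\<^sub>R v) - f (x + t *\<^sub>R w) + f x = G t - G 0"
    by (simp add: G_def)
  also have "\<dots> = t * (H t - H 0)" unfolding s(3) by (simp add: G'_def H_def)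
  also have "\<dots> = t * t * H' u" unfolding u(3) by simp
  finally show thesis
    using that[of "x + s *\<^sub>R v + u *\<^sub>R w"] in_ball[of s u] s(1,2) u(1,2) unfolding H'_def by simp
qed

lemma second_derivative_symmetric:
  fixes f :: "'e::euclidean_space \<Rightarrow> real"
  assumes "open S" "smooth_on S f" "x \<in> S"
  shows "fderiv (\<lambda>y. fderiv f y v) x w
       = fderiv (\<lambda>y. fderiv f y w) x v"
proof -
  obtain r where r: "0 < r" "ball x r \<subseteq> S" using assms by (meson openE)
  \<comment> \<open>The summand 1 keeps \<open>N\<close> positive when both vectors vanish; the
    scale \<open>t n\<close> is chosen so that \<open>t n * N\<close> is
    \<open>r / real (Suc (Suc n))\<close>.\<close>
  define N where "N = norm v + norm w + 1"
  define t where "t n = r / (N * real (Suc (Suc n)))" for n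
  have N: "N > 0" "norm v + norm w < N" by (auto simp: N_def add_nonneg_pos)
  have t: "0 < t n" for n using r N by (simp add: t_def)
  have tN: "t n * N = r / real (Suc (Suc n))" for n using N by (simp add: t_def)
  have lim0: "(\<lambda>n. t n * N) \<longlonglongrightarrow> 0"
    unfolding tN by (rule LIMSEQ_Suc, rule LIMSEQ_Suc) (rule lim_const_over_n)
  have tr: "t n * (norm v + norm w) < r" for n
  proof -
    have "t n * (norm v + norm w) < t n * N" using t N by simp
    also have "\<dots> \<le> r" unfolding tN using r by (simp add: divide_simps)
    finally show ?thesis .
  qed
  have tr': "t n * (norm w + norm v) < r" for n using tr[of n] by (simp add: add.commute)
  have sm: "smooth_on (ball x r) f" using smooth_on_subset[OF assms(2) r(2)] .
  let ?F = "\<lambda>v w y. fderiv (\<lambda>y. fderiv f y v) y w"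
  \<comment> \<open>The second difference is symmetric in \<open>v\<close> and \<open>w\<close>.
    Evaluating it in both orders gives, at each scale, two points near \<open>x\<close> where the
    two mixed derivatives agree; continuity carries this to \<open>x\<close>.\<close>
  define P where "P n z z' \<longleftrightarrow> dist x z \<le> t n * N \<and> dist x z' \<le> t n * N \<and> ?F v w z = ?F w v z'" for n z z'
  have "\<exists>z z'. P n z z'" for n
  proof -
    obtain z where z: "dist x z \<le> t n * (norm v + norm w)"
      "f (x + t n *\<^sub>R v + t n *\<^sub>R w) - f (x + t n *\<^sub>R v) - f (x + t n *\<^sub>R w) + f x = t n * t n * ?F v w z"
      using second_difference_mvt[OF sm t tr] by blast
    obtain z' where z': "dist x z' \<le> t n * (norm w + norm v)"
      "f (x + t n *\<^sub>R w + t n *\<^sub>R v) - f (x + t n *\<^sub>R w) - f (x + t n *\<^sub>R v) + f x = t n * t n * ?F w v z'"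
      using second_difference_mvt[OF sm t tr'] by blast
    have "t n * t n * ?F v w z = t n * t n * ?F w v z'"
    proof -
      have e: "x + t n *\<^sub>R w + t n *\<^sub>R v = x + t n *\<^sub>R v + t n *\<^sub>R w" by simp
      show ?thesis by (rule trans[OF z(2)[symmetric]], rule trans[OF _ z'(2)[unfolded e]]) simp
    qed
    note c = this
    have "t n * t n \<noteq> 0" using t[of n] by simp
    from mult_left_cancel[THEN iffD1, OF this c] have "?F v w z = ?F w v z'" .
    moreover have "t n * (norm v + norm w) \<le> t n * N" using t[of n] N by simp
    ultimately have "P n z z'"
      using z(1) z'(1) unfolding P_def add.commute[of "norm w"] by (intro conjI) (rule order_trans, assumption+)+
    then show ?thesis by blast
  qed
  then obtain z z' where P: "\<And>n. P n (z n) (z' n)" by metis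
  note zz = P[unfolded P_def, THEN conjunct1] P[unfolded P_def, THEN conjunct2, THEN conjunct1]
    P[unfolded P_def, THEN conjunct2, THEN conjunct2]
  have lim: "y \<longlonglongrightarrow> x" if "\<And>n. dist x (y n) \<le> t n * N" for y
  proof -
    have "(\<lambda>n. dist (y n) x) \<longlonglongrightarrow> 0"
      by (rule tendsto_sandwich[OF _ _ tendsto_const lim0]) (use that in \<open>auto simp: dist_commute\<close>)
    then show ?thesis by (rule tendsto_dist_iff[THEN iffD2])
  qed
  have cont: "isCont (?F v w) x" for v w
    using smooth_on_imp_continuous_on[OF smooth_on_frechet_derivative[OF smooth_on_frechet_derivative[OF assms(2)]]]
      assms(1,3) continuous_on_eq_continuous_at by blast
  have "(\<lambda>n. ?F v w (z n)) \<longlonglongrightarrow> ?F v w x" "(\<lambda>n. ?F w v (z' n)) \<longlonglongrightarrow> ?F w v x"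
    by (rule isCont_tendsto_compose[OF cont lim[OF zz(1)]], rule isCont_tendsto_compose[OF cont lim[OF zz(2)]])
  then show ?thesis unfolding zz(3) by (rule LIMSEQ_unique)
qed

text \<open>Separates the derivative of the field \<open>h\<close> from a second derivative of
  \<open>F\<close> with \<open>h\<close> frozen at \<open>x\<close>. In a commutator of two fields
  the second derivatives cancel by symmetry.\<close>

lemma frechet_derivative_field:
  fixes F :: "'e::euclidean_space \<Rightarrow> real"
  assumes "open S" "smooth_on S F" "smooth_on S h" "x \<in> S"
  shows "fderiv (\<lambda>y. fderiv F y (h y)) x v
    = fderiv F x (fderiv h x v)
      + fderiv (\<lambda>y. fderiv F y (h x)) x v"
proof -
  let ?D = "\<lambda>y. fderiv F y"
  have lin: "?D y w = (\<Sum>i\<in>Basis. (w \<bullet> i) *\<^sub>R ?D y i)" if "y \<in> S" for y w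
    by (rule linear_Basis_expand[OF linear_frechet_derivative[OF smooth_on_imp_differentiable[OF assms(2) that]]])
  have Di: "((\<lambda>y. ?D y i) has_derivative fderiv (\<lambda>y. ?D y i) x) (at x)" for i
    by (rule smooth_on_imp_has_derivative[OF smooth_on_frechet_derivative[OF assms(2)] assms(4)])
  have hi: "((\<lambda>y. h y \<bullet> i) has_derivative (\<lambda>v. fderiv h x v \<bullet> i)) (at x)" for i
    by (rule has_derivative_inner_left[OF smooth_on_imp_has_derivative[OF assms(3,4)]])
  have 1: "((\<lambda>y. \<Sum>i\<in>Basis. (h y \<bullet> i) *\<^sub>R ?D y i) has_derivative (\<lambda>v. \<Sum>i\<in>Basis.
      (h x \<bullet> i) *\<^sub>R fderiv (\<lambda>y. ?D y i) x v + (fderiv h x v \<bullet> i) *\<^sub>R ?D x i)) (at x)"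
    by (intro has_derivative_sum has_derivative_scaleR hi Di)
  have 2: "((\<lambda>y. \<Sum>i\<in>Basis. (h x \<bullet> i) *\<^sub>R ?D y i) has_derivative (\<lambda>v. \<Sum>i\<in>Basis.
      (h x \<bullet> i) *\<^sub>R fderiv (\<lambda>y. ?D y i) x v)) (at x)"
    by (intro has_derivative_sum has_derivative_scaleR_right Di)
  have e1: "fderiv (\<lambda>y. ?D y (h y)) x = fderiv (\<lambda>y. \<Sum>i\<in>Basis. (h y \<bullet> i) *\<^sub>R ?D y i) x"
    by (rule frechet_derivative_cong_open[OF assms(1,4)]) (rule lin)
  have e2: "fderiv (\<lambda>y. ?D y (h x)) x = fderiv (\<lambda>y. \<Sum>i\<in>Basis. (h x \<bullet> i) *\<^sub>R ?D y i) x"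
    by (rule frechet_derivative_cong_open[OF assms(1,4)]) (rule lin)
  show ?thesis
    unfolding e1 e2 frechet_derivative_eqI[OF 1] frechet_derivative_eqI[OF 2]
      lin[OF assms(4), of "fderiv h x v"] sum.distrib by (rule add.commute)
qed

subsection \<open>Smooth functions and coordinate fields on a manifold\<close>

locale smooth_manifold =
  fixes A :: "('a::{second_countable_topology,t2_space}, 'e::euclidean_space) atlas"
  assumes atlas: "smooth_atlas A"
begin

lemma chart_dom_mem [simp]: "p \<in> chart_dom A p"
  and open_chart_dom [simp]: "open (chart_dom A p)"
  and chart_homeomorphism: "homeomorphism (chart_dom A p) (chart A p ` chart_dom A p) (chart A p) (chart_inv A p)"
  and open_chart_range: "open (chart A p ` chart_dom A p)"
  and transition_smooth: "smooth_on (chart A p ` (chart_dom A p \<inter> chart_dom A q)) (chart A q \<circ> chart_inv A p)"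
  using atlas unfolding smooth_atlas_def by auto

lemma chart_inv_chart [simp]: "q \<in> chart_dom A p \<Longrightarrow> chart_inv A p (chart A p q) = q"
  using chart_homeomorphism[of p] unfolding homeomorphism_def by auto

lemma open_chart_image:
  assumes "open U" shows "open (chart A p ` (U \<inter> chart_dom A p))"
proof -
  have "openin (top_of_set (chart_dom A p)) (U \<inter> chart_dom A p)"
    using assms by (auto simp: openin_open)
  then have "openin (top_of_set (chart A p ` chart_dom A p)) (chart A p ` (U \<inter> chart_dom A p))"
    using homeomorphism_imp_open_map[OF chart_homeomorphism] by blast
  then show ?thesis using openin_open_trans open_chart_range by blast
qed

lemma smooth_fun_subset: "smooth_fun A U f \<Longrightarrow> V \<subseteq> U \<Longrightarrow> smooth_fun A V f"
  unfolding smooth_fun_def by (blast intro: smooth_on_subset)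

lemma smooth_fun_cong:
  assumes "smooth_fun A U f" "open U" "\<And>p. p \<in> U \<Longrightarrow> f p = g p"
  shows "smooth_fun A U g"
  unfolding smooth_fun_def
proof
  fix q show "smooth_on (chart A q ` (U \<inter> chart_dom A q)) (g \<circ> chart_inv A q)"
    by (rule smooth_on_cong[OF assms(1)[unfolded smooth_fun_def, rule_format] open_chart_image[OF assms(2)]])
       (use assms(3) in auto)
qed

lemma smooth_fun_local:
  assumes "\<And>p. p \<in> U \<Longrightarrow> \<exists>V. open V \<and> p \<in> V \<and> smooth_fun A V f"
  shows "smooth_fun A U f"
  unfolding smooth_fun_def
proof (intro allI smooth_on_local)
  fix q x assume "x \<in> chart A q ` (U \<inter> chart_dom A q)"
  then obtain p where p: "p \<in> U" "p \<in> chart_dom A q" "x = chart A q p" by auto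
  obtain V where V: "open V" "p \<in> V" "smooth_fun A V f" using assms p by blast
  show "\<exists>T. open T \<and> x \<in> T \<and> smooth_on T (f \<circ> chart_inv A q)"
    using V p open_chart_image unfolding smooth_fun_def by blast
qed

text \<open>A single chart suffices, since the other coordinate representations differ by transition
  maps.\<close>

lemma smooth_fun_chartI:
  assumes "open U" "U \<subseteq> chart_dom A p" "smooth_on (chart A p ` U) (f \<circ> chart_inv A p)"
  shows "smooth_fun A U f"
  unfolding smooth_fun_def
proof
  fix q
  let ?S = "chart A q ` (U \<inter> chart_dom A q)"
  have o: "open ?S" "open (chart A p ` U)"
    using open_chart_image[OF assms(1), of q] open_chart_image[OF assms(1), of p]
    by (simp_all add: Int_absorb2[OF assms(2)])
  have "smooth_on ?S (\<lambda>x. (f \<circ> chart_inv A p) ((chart A p \<circ> chart_inv A q) x))"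
  proof (rule smooth_on_compose[OF assms(3) smooth_on_subset[OF transition_smooth] o])
    show "?S \<subseteq> chart A q ` (chart_dom A q \<inter> chart_dom A p)" using assms(2) by auto
  qed (use assms(2) in auto)
  then show "smooth_on ?S (f \<circ> chart_inv A q)"
    by (rule smooth_on_cong[OF _ o(1)]) (use assms(2) in auto)
qed

lemma smooth_fun_const [simp]: "smooth_fun A U (\<lambda>p. c)"
  by (simp add: smooth_fun_def comp_def)

lemma smooth_fun_bilinear:
  "open U \<Longrightarrow> bounded_bilinear B \<Longrightarrow> smooth_fun A U f \<Longrightarrow> smooth_fun A U g \<Longrightarrow> smooth_fun A U (\<lambda>p. B (f p) (g p))"
  unfolding smooth_fun_def comp_def
  by (rule allI, rule smooth_on_bilinear, rule open_chart_image, assumption, assumption, erule spec, erule spec)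

lemmas smooth_fun_scaleR = smooth_fun_bilinear[OF _ bounded_bilinear_scaleR]
lemmas smooth_fun_mult = smooth_fun_bilinear[OF _ bounded_bilinear_mult[where 'a = real]]

lemma smooth_fun_linear:
  "open U \<Longrightarrow> bounded_linear L \<Longrightarrow> smooth_fun A U f \<Longrightarrow> smooth_fun A U (\<lambda>p. L (f p))"
  unfolding smooth_fun_def comp_def
  by (rule allI, rule smooth_on_linear, rule open_chart_image, assumption, assumption, erule spec)

lemma smooth_fun_add:
  "open U \<Longrightarrow> smooth_fun A U f \<Longrightarrow> smooth_fun A U g \<Longrightarrow> smooth_fun A U (\<lambda>p. f p + g p)"
  unfolding smooth_fun_def comp_def by (intro allI smooth_on_add open_chart_image) auto

lemma smooth_fun_minus: "open U \<Longrightarrow> smooth_fun A U f \<Longrightarrow> smooth_fun A U (\<lambda>p. - f p)"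
  by (rule smooth_fun_linear[OF _ bounded_linear_minus[OF bounded_linear_ident]])

lemma smooth_fun_diff:
  "open U \<Longrightarrow> smooth_fun A U f \<Longrightarrow> smooth_fun A U g \<Longrightarrow> smooth_fun A U (\<lambda>p. f p - g p)"
  using smooth_fun_add[of U f "\<lambda>p. - g p"] smooth_fun_minus[of U g] by simp

lemma smooth_fun_sum:
  "open U \<Longrightarrow> finite I \<Longrightarrow> (\<And>i. i \<in> I \<Longrightarrow> smooth_fun A U (f i)) \<Longrightarrow> smooth_fun A U (\<lambda>p. \<Sum>i\<in>I. f i p)"
  unfolding smooth_fun_def comp_def by (intro allI smooth_on_sum open_chart_image) auto

lemma smooth_fun_inverse:
  fixes f :: "'a \<Rightarrow> real"
  assumes "open U" "smooth_fun A U f" "\<And>p. p \<in> U \<Longrightarrow> f p \<noteq> 0"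
  shows "smooth_fun A U (\<lambda>p. inverse (f p))"
  using assms unfolding smooth_fun_def comp_def
  by (intro allI smooth_on_inverse open_chart_image) auto

lemma smooth_fun_inner_left:
  fixes f :: "'a \<Rightarrow> 'f::real_inner"
  shows "open U \<Longrightarrow> smooth_fun A U f \<Longrightarrow> smooth_fun A U (\<lambda>p. f p \<bullet> i)"
  by (rule smooth_fun_linear[OF _ bounded_linear_inner_left])

lemma smooth_fun_has_derivative:
  assumes "open U" "smooth_fun A U f" "q \<in> U" "q \<in> chart_dom A p"
  shows "((f \<circ> chart_inv A p) has_derivative fderiv (f \<circ> chart_inv A p) ((chart A p q))) (at (chart A p q))"
  using assms unfolding smooth_fun_def
  by (intro smooth_on_imp_has_derivative[of "chart A p ` (U \<inter> chart_dom A p)"]) auto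

lemma mderiv_has_derivative:
  assumes "open U" "smooth_fun A U f" "p \<in> U"
  shows "((f \<circ> chart_inv A p) has_derivative mderiv A f p) (at (chart A p p))"
  using smooth_fun_has_derivative[OF assms chart_dom_mem] unfolding mderiv_def .

lemma linear_mderiv: "open U \<Longrightarrow> smooth_fun A U f \<Longrightarrow> p \<in> U \<Longrightarrow> linear (mderiv A f p)"
  using mderiv_has_derivative has_derivative_linear by blast

lemma mderiv_eqI:
  "((f \<circ> chart_inv A p) has_derivative f') (at (chart A p p)) \<Longrightarrow> mderiv A f p v = f' v"
  by (simp add: mderiv_def frechet_derivative_eqI)

lemma mderiv_cong:
  assumes "open U" "p \<in> U" "\<And>q. q \<in> U \<Longrightarrow> f q = g q"
  shows "mderiv A f p v = mderiv A g p v"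
  unfolding mderiv_def
  by (subst frechet_derivative_cong_open[OF open_chart_image[OF assms(1), of p]]) (use assms in auto)

lemma mderiv_const [simp]: "mderiv A (\<lambda>q. c) p v = 0"
  by (simp add: mderiv_def comp_def)

lemma mderiv_bilinear:
  assumes "open U" "bounded_bilinear B" "smooth_fun A U f" "smooth_fun A U g" "p \<in> U"
  shows "mderiv A (\<lambda>q. B (f q) (g q)) p v = B (f p) (mderiv A g p v) + B (mderiv A f p v) (g p)"
  using bounded_bilinear.FDERIV[OF assms(2) mderiv_has_derivative[OF assms(1,3,5)] mderiv_has_derivative[OF assms(1,4,5)]]
  by (subst mderiv_eqI) (auto simp: comp_def)

lemmas mderiv_mult = mderiv_bilinear[OF _ bounded_bilinear_mult[where 'a = real]]

lemma mderiv_linear: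
  assumes "open U" "bounded_linear L" "smooth_fun A U f" "p \<in> U"
  shows "mderiv A (\<lambda>q. L (f q)) p v = L (mderiv A f p v)"
  using bounded_linear.has_derivative[OF assms(2) mderiv_has_derivative[OF assms(1,3,4)]]
  by (subst mderiv_eqI) (auto simp: comp_def)

lemma mderiv_inner_left:
  fixes f :: "'a \<Rightarrow> 'f::real_inner"
  shows "open U \<Longrightarrow> smooth_fun A U f \<Longrightarrow> p \<in> U \<Longrightarrow> mderiv A (\<lambda>q. f q \<bullet> i) p v = mderiv A f p v \<bullet> i"
  by (rule mderiv_linear[OF _ bounded_linear_inner_left])

lemma mderiv_add:
  assumes "open U" "smooth_fun A U f" "smooth_fun A U g" "p \<in> U"
  shows "mderiv A (\<lambda>q. f q + g q) p v = mderiv A f p v + mderiv A g p v"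
  using has_derivative_add[OF mderiv_has_derivative[OF assms(1,2,4)] mderiv_has_derivative[OF assms(1,3,4)]]
  by (subst mderiv_eqI) (auto simp: comp_def)

lemma mderiv_diff:
  assumes "open U" "smooth_fun A U f" "smooth_fun A U g" "p \<in> U"
  shows "mderiv A (\<lambda>q. f q - g q) p v = mderiv A f p v - mderiv A g p v"
  using has_derivative_diff[OF mderiv_has_derivative[OF assms(1,2,4)] mderiv_has_derivative[OF assms(1,3,4)]]
  by (subst mderiv_eqI) (auto simp: comp_def)

lemma smooth_fun_chart: "smooth_fun A (chart_dom A p) (chart A p)"
proof (rule smooth_fun_chartI[OF open_chart_dom subset_refl])
  show "smooth_on (chart A p ` chart_dom A p) (chart A p \<circ> chart_inv A p)"
    using transition_smooth[of p p] by simp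
qed

text \<open>\<open>mderiv\<close> refers to a different chart at each point. To differentiate
  \<open>mderiv A f q (X q)\<close> in \<open>q\<close>, it has to be expressed in one chart for all
  \<open>q\<close> near a given point.\<close>

lemma mderiv_chart:
  assumes "open U" "smooth_fun A U f" "q \<in> U" "q \<in> chart_dom A p"
  shows "mderiv A f q v = fderiv (f \<circ> chart_inv A p) ((chart A p q)) (mderiv A (chart A p) q v)"
proof -
  let ?V = "U \<inter> chart_dom A p"
  have V: "open ?V" "q \<in> ?V" using assms by auto
  have 1: "((chart A p \<circ> chart_inv A q) has_derivative mderiv A (chart A p) q) (at (chart A q q))"
    by (rule mderiv_has_derivative[OF open_chart_dom smooth_fun_chart assms(4)])
  have "((f \<circ> chart_inv A p) has_derivative fderiv (f \<circ> chart_inv A p) ((chart A p q)))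
      (at ((chart A p \<circ> chart_inv A q) (chart A q q)))"
    using smooth_fun_has_derivative[OF assms] by simp
  from has_derivative_compose[OF 1 this]
  have "((f \<circ> chart_inv A q) has_derivative
      (\<lambda>v. fderiv (f \<circ> chart_inv A p) ((chart A p q)) (mderiv A (chart A p) q v))) (at (chart A q q))"
    by (rule has_derivative_transform_within_open[OF _ open_chart_image[OF V(1), of q]]) (use V in auto)
  then show ?thesis by (rule mderiv_eqI)
qed

lemma mderiv_chart_self [simp]: "mderiv A (chart A p) p v = v"
proof -
  have "((chart A p \<circ> chart_inv A p) has_derivative (\<lambda>v. v)) (at (chart A p p))"
    by (rule has_derivative_transform_within_open[OF has_derivative_ident open_chart_range]) auto
  then show ?thesis by (rule mderiv_eqI)
qed

lemma linear_mderiv_chart: "q \<in> chart_dom A p \<Longrightarrow> linear (mderiv A (chart A p) q)"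
  by (rule linear_mderiv[OF open_chart_dom smooth_fun_chart])

text \<open>The vector field with constant components \<open>v\<close> in the chart at
  \<open>p\<close>. Its value at \<open>q\<close> is converted to the chart at \<open>q\<close>,
  because that chart identifies the tangent space there with the model space.\<close>

definition coord :: "'a \<Rightarrow> 'e \<Rightarrow> 'a \<Rightarrow> 'e" where
  "coord p v q = fderiv (chart A q \<circ> chart_inv A p) ((chart A p q)) v"

lemma mderiv_coord:
  assumes "open U" "smooth_fun A U f" "q \<in> U" "q \<in> chart_dom A p"
  shows "mderiv A f q (coord p v q) = fderiv (f \<circ> chart_inv A p) ((chart A p q)) v"
proof -
  let ?V = "U \<inter> chart_dom A q \<inter> chart_dom A p"
  have V: "open ?V" "q \<in> ?V" using assms by (auto intro!: open_Int)
  have 1: "((chart A q \<circ> chart_inv A p) has_derivative (\<lambda>v. coord p v q)) (at (chart A p q))"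
    using smooth_fun_has_derivative[OF open_chart_dom smooth_fun_chart chart_dom_mem assms(4)]
    by (simp add: coord_def[abs_def])
  have "((f \<circ> chart_inv A q) has_derivative mderiv A f q) (at ((chart A q \<circ> chart_inv A p) (chart A p q)))"
    using mderiv_has_derivative[OF assms(1-3)] assms(4) by simp
  from has_derivative_compose[OF 1 this]
  have "((f \<circ> chart_inv A p) has_derivative (\<lambda>v. mderiv A f q (coord p v q))) (at (chart A p q))"
    by (rule has_derivative_transform_within_open[OF _ open_chart_image[OF V(1), of p]]) (use V in auto)
  then show ?thesis by (simp add: frechet_derivative_eqI)
qed

lemma mderiv_chart_coord [simp]:
  assumes "q \<in> chart_dom A p" shows "mderiv A (chart A p) q (coord p v q) = v"
proof -
  have "((chart A p \<circ> chart_inv A p) has_derivative (\<lambda>v. v)) (at (chart A p q))"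
    by (rule has_derivative_transform_within_open[OF has_derivative_ident open_chart_range]) (use assms in auto)
  then show ?thesis
    by (simp add: mderiv_coord[OF open_chart_dom smooth_fun_chart assms assms] frechet_derivative_eqI)
qed

lemma coord_mderiv_chart:
  "q \<in> chart_dom A p \<Longrightarrow> coord p (mderiv A (chart A p) q w) q = w"
  using mderiv_chart[OF open_chart_dom smooth_fun_chart chart_dom_mem, of q p w] by (simp add: coord_def)

lemma coord_self [simp]: "coord p v p = v"
  using coord_mderiv_chart[of p p v] by simp

lemma linear_coord: "q \<in> chart_dom A p \<Longrightarrow> linear (\<lambda>v. coord p v q)"
  using has_derivative_linear[OF smooth_fun_has_derivative[OF open_chart_dom smooth_fun_chart chart_dom_mem]]
  by (simp add: coord_def[abs_def])

lemma mderiv_chart_inject: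
  "q \<in> chart_dom A p \<Longrightarrow> mderiv A (chart A p) q v = mderiv A (chart A p) q w \<Longrightarrow> v = w"
  using coord_mderiv_chart by metis

lemma smooth_fun_compose_smooth_on:
  fixes h :: "'a \<Rightarrow> 'f::euclidean_space"
  assumes "open U" "smooth_fun A U h" "open S" "smooth_on S G" "\<And>p. p \<in> U \<Longrightarrow> h p \<in> S"
  shows "smooth_fun A U (\<lambda>p. G (h p))"
  unfolding smooth_fun_def
proof
  fix q
  have "smooth_on (chart A q ` (U \<inter> chart_dom A q)) (\<lambda>x. G ((h \<circ> chart_inv A q) x))"
    by (rule smooth_on_compose[OF assms(4) assms(2)[unfolded smooth_fun_def, rule_format] open_chart_image[OF assms(1)] assms(3)])
      (use assms(5) in auto)
  then show "smooth_on (chart A q ` (U \<inter> chart_dom A q)) ((\<lambda>p. G (h p)) \<circ> chart_inv A q)"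
    by (simp add: comp_def)
qed

end

subsection \<open>Smooth maps and fields along a map\<close>

locale smooth_manifold_map = dom: smooth_manifold A + cod: smooth_manifold B
  for A :: "('b::{second_countable_topology,t2_space}, 'd::euclidean_space) atlas"
    and B :: "('a::{second_countable_topology,t2_space}, 'e::euclidean_space) atlas" +
  fixes \<phi> :: "'b \<Rightarrow> 'a"
  assumes smooth_map: "smooth_map A B \<phi>"
begin

abbreviation "smooth_sec \<equiv> smooth_along A B \<phi>"

lemma open_vimage_map: "open V \<Longrightarrow> open (\<phi> -` V)"
  using smooth_map unfolding smooth_map_def by (auto intro: open_vimage)

lemma smooth_fun_chart_map: "smooth_fun A (\<phi> -` chart_dom B q) (\<lambda>p. chart B q (\<phi> p))"
  using smooth_map unfolding smooth_map_def by blast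

lemma smooth_fun_comp:
  assumes "open V" "smooth_fun B V f"
  shows "smooth_fun A (\<phi> -` V) (\<lambda>p. f (\<phi> p))"
proof (rule dom.smooth_fun_local)
  fix p assume p: "p \<in> \<phi> -` V"
  let ?r = "\<phi> p"
  let ?U = "\<phi> -` (V \<inter> chart_dom B ?r)"
  have o: "open ?U" by (rule open_vimage_map) (use assms in auto)
  have "smooth_fun A ?U (\<lambda>q. (f \<circ> chart_inv B ?r) (chart B ?r (\<phi> q)))"
  proof (rule dom.smooth_fun_compose_smooth_on[OF o, where h = "\<lambda>q. chart B ?r (\<phi> q)"
        and S = "chart B ?r ` (V \<inter> chart_dom B ?r)"])
    show "smooth_fun A ?U (\<lambda>q. chart B ?r (\<phi> q))"
      by (rule dom.smooth_fun_subset[OF smooth_fun_chart_map]) auto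
    show "open (chart B ?r ` (V \<inter> chart_dom B ?r))" by (rule cod.open_chart_image[OF assms(1)])
    show "smooth_on (chart B ?r ` (V \<inter> chart_dom B ?r)) (f \<circ> chart_inv B ?r)"
      using assms(2) unfolding smooth_fun_def by blast
  qed auto
  then have "smooth_fun A ?U (\<lambda>q. f (\<phi> q))"
    by (rule dom.smooth_fun_cong[OF _ o]) auto
  then show "\<exists>V. open V \<and> p \<in> V \<and> smooth_fun A V (\<lambda>p. f (\<phi> p))"
    using o p by auto
qed

lemma tangent_map_has_derivative:
  "((\<lambda>x. chart B (\<phi> p) (\<phi> (chart_inv A p x))) has_derivative tangent_map A B \<phi> p) (at (chart A p p))"
  using dom.mderiv_has_derivative[OF open_vimage_map[OF cod.open_chart_dom] smooth_fun_chart_map, of p "\<phi> p"]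
  by (simp add: tangent_map_def[abs_def] comp_def)

lemma linear_tangent_map: "linear (tangent_map A B \<phi> p)"
  using tangent_map_has_derivative has_derivative_linear by blast

lemma mderiv_comp:
  assumes "open V" "smooth_fun B V f" "\<phi> p \<in> V"
  shows "mderiv A (\<lambda>q. f (\<phi> q)) p v = mderiv B f (\<phi> p) (tangent_map A B \<phi> p v)"
proof -
  let ?U = "\<phi> -` chart_dom B (\<phi> p)"
  have U: "open ?U" by (rule open_vimage_map) simp
  have "((f \<circ> chart_inv B (\<phi> p)) has_derivative mderiv B f (\<phi> p)) (at (chart B (\<phi> p) (\<phi> (chart_inv A p (chart A p p)))))"
    using cod.mderiv_has_derivative[OF assms] by simp
  from has_derivative_compose[OF tangent_map_has_derivative this]
  have "(((\<lambda>q. f (\<phi> q)) \<circ> chart_inv A p) has_derivative (\<lambda>v. mderiv B f (\<phi> p) (tangent_map A B \<phi> p v))) (at (chart A p p))"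
    by (rule has_derivative_transform_within_open[OF _ dom.open_chart_image[OF U, of p]]) auto
  then show ?thesis by (rule dom.mderiv_eqI)
qed

lemma smooth_alongD:
  "smooth_sec U W \<Longrightarrow> smooth_fun A (U \<inter> \<phi> -` chart_dom B q) (\<lambda>p. mderiv B (chart B q) (\<phi> p) (W p))"
  by (simp add: smooth_along_def)

lemma smooth_along_subset: "smooth_sec U W \<Longrightarrow> V \<subseteq> U \<Longrightarrow> smooth_sec V W"
  unfolding smooth_along_def by (intro allI, erule allE, erule dom.smooth_fun_subset) auto

lemma open_Int_vimage_chart: "open U \<Longrightarrow> open (U \<inter> \<phi> -` chart_dom B q)"
  using open_vimage_map by (intro open_Int) auto

lemma smooth_along_cong:
  assumes "smooth_sec U W" "open U" "\<And>p. p \<in> U \<Longrightarrow> W p = W' p"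
  shows "smooth_sec U W'"
  unfolding smooth_along_def
  by (intro allI, rule dom.smooth_fun_cong[OF smooth_alongD[OF assms(1)] open_Int_vimage_chart[OF assms(2)]])
    (use assms(3) in auto)

lemma smooth_along_local:
  assumes "\<And>p. p \<in> U \<Longrightarrow> \<exists>V. open V \<and> p \<in> V \<and> smooth_sec V W"
  shows "smooth_sec U W"
  unfolding smooth_along_def
proof (rule allI, rule dom.smooth_fun_local)
  fix q p assume p: "p \<in> U \<inter> \<phi> -` chart_dom B q"
  then obtain V where V: "open V" "p \<in> V" "smooth_sec V W" using assms by blast
  show "\<exists>V. open V \<and> p \<in> V \<and> smooth_fun A V (\<lambda>p. mderiv B (chart B q) (\<phi> p) (W p))"
    by (rule exI[of _ "V \<inter> \<phi> -` chart_dom B q"]) (use V p open_Int_vimage_chart smooth_alongD in auto)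
qed

lemma smooth_along_chartI:
  assumes "open U" "U \<subseteq> \<phi> -` chart_dom B r" "smooth_fun A U (\<lambda>p. mderiv B (chart B r) (\<phi> p) (W p))"
  shows "smooth_sec U W"
  unfolding smooth_along_def
proof
  fix s
  let ?U = "U \<inter> \<phi> -` chart_dom B s"
  let ?S = "chart B r ` (chart_dom B s \<inter> chart_dom B r)"
  let ?F = "chart B s \<circ> chart_inv B r"
  have U: "open ?U" by (rule open_Int_vimage_chart[OF assms(1)])
  have F: "smooth_on ?S ?F" using cod.transition_smooth[of r s] by (simp add: Int_commute)
  have "smooth_fun A ?U (\<lambda>p. \<Sum>i\<in>Basis. (mderiv B (chart B r) (\<phi> p) (W p) \<bullet> i) *\<^sub>R fderiv ?F ((chart B r (\<phi> p))) i)"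
  proof (rule dom.smooth_fun_sum[OF U finite_Basis], rule dom.smooth_fun_scaleR[OF U])
    fix i :: 'e
    show "smooth_fun A ?U (\<lambda>p. mderiv B (chart B r) (\<phi> p) (W p) \<bullet> i)"
      by (rule dom.smooth_fun_inner_left[OF U], rule dom.smooth_fun_subset[OF assms(3)]) auto
    show "smooth_fun A ?U (\<lambda>p. fderiv ?F ((chart B r (\<phi> p))) i)"
    proof (rule dom.smooth_fun_compose_smooth_on[OF U, where h = "\<lambda>p. chart B r (\<phi> p)" and S = ?S
          and G = "\<lambda>x. fderiv ?F x i"])
      show "smooth_fun A ?U (\<lambda>p. chart B r (\<phi> p))"
        by (rule dom.smooth_fun_subset[OF smooth_fun_chart_map]) (use assms(2) in auto)
      show "open ?S" by (rule cod.open_chart_image[OF cod.open_chart_dom])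
      show "smooth_on ?S (\<lambda>x. fderiv ?F x i)" by (rule smooth_on_frechet_derivative[OF F])
    qed (use assms(2) in auto)
  qed
  then show "smooth_fun A ?U (\<lambda>p. mderiv B (chart B s) (\<phi> p) (W p))"
  proof (rule dom.smooth_fun_cong[OF _ U])
    fix p assume p: "p \<in> ?U"
    then have m: "\<phi> p \<in> chart_dom B s" "\<phi> p \<in> chart_dom B r" using assms(2) by auto
    have "linear (fderiv ?F ((chart B r (\<phi> p))))"
      by (rule has_derivative_linear[OF cod.smooth_fun_has_derivative[OF cod.open_chart_dom cod.smooth_fun_chart m]])
    from linear_Basis_expand[OF this, of "mderiv B (chart B r) (\<phi> p) (W p)"]
    show "(\<Sum>i\<in>Basis. (mderiv B (chart B r) (\<phi> p) (W p) \<bullet> i) *\<^sub>R fderiv ?F ((chart B r (\<phi> p))) i)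
      = mderiv B (chart B s) (\<phi> p) (W p)"
      unfolding cod.mderiv_chart[OF cod.open_chart_dom cod.smooth_fun_chart m] by (rule sym)
  qed
qed

lemma smooth_along_zero: "smooth_sec U (\<lambda>p. 0)"
  unfolding smooth_along_def
proof
  fix q
  have "smooth_fun A (\<phi> -` chart_dom B q) (\<lambda>p. mderiv B (chart B q) (\<phi> p) 0)"
    by (rule dom.smooth_fun_cong[OF dom.smooth_fun_const[of _ 0] open_vimage_map[OF cod.open_chart_dom]])
      (simp add: linear_0[OF cod.linear_mderiv_chart])
  then show "smooth_fun A (U \<inter> \<phi> -` chart_dom B q) (\<lambda>p. mderiv B (chart B q) (\<phi> p) 0)"
    by (rule dom.smooth_fun_subset) simp
qed

lemma smooth_along_add:
  assumes "open U" "smooth_sec U W" "smooth_sec U W'"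
  shows "smooth_sec U (\<lambda>p. W p + W' p)"
  unfolding smooth_along_def
proof
  fix q
  have o: "open (U \<inter> \<phi> -` chart_dom B q)" by (rule open_Int_vimage_chart[OF assms(1)])
  show "smooth_fun A (U \<inter> \<phi> -` chart_dom B q) (\<lambda>p. mderiv B (chart B q) (\<phi> p) (W p + W' p))"
    by (rule dom.smooth_fun_cong[OF dom.smooth_fun_add[OF o smooth_alongD[OF assms(2)] smooth_alongD[OF assms(3)]] o])
      (use linear_add[OF cod.linear_mderiv_chart] in auto)
qed

lemma smooth_along_scale:
  assumes "open U" "smooth_fun A U f" "smooth_sec U W"
  shows "smooth_sec U (\<lambda>p. f p *\<^sub>R W p)"
  unfolding smooth_along_def
proof
  fix q
  have o: "open (U \<inter> \<phi> -` chart_dom B q)" by (rule open_Int_vimage_chart[OF assms(1)])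
  show "smooth_fun A (U \<inter> \<phi> -` chart_dom B q) (\<lambda>p. mderiv B (chart B q) (\<phi> p) (f p *\<^sub>R W p))"
    by (rule dom.smooth_fun_cong[OF dom.smooth_fun_scaleR[OF o dom.smooth_fun_subset[OF assms(2)] smooth_alongD[OF assms(3)]] o])
      (use linear_cmul[OF cod.linear_mderiv_chart] in auto)
qed

lemma smooth_along_cscale:
  "open U \<Longrightarrow> smooth_sec U W \<Longrightarrow> smooth_sec U (\<lambda>p. c *\<^sub>R W p)"
  by (rule smooth_along_scale[OF _ dom.smooth_fun_const])

lemma smooth_along_minus:
  "open U \<Longrightarrow> smooth_sec U W \<Longrightarrow> smooth_sec U (\<lambda>p. - W p)"
  using smooth_along_cscale[of U W "-1"] by simp

lemma smooth_along_diff: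
  "open U \<Longrightarrow> smooth_sec U W \<Longrightarrow> smooth_sec U W' \<Longrightarrow> smooth_sec U (\<lambda>p. W p - W' p)"
  using smooth_along_add[of U W "\<lambda>p. - W' p"] smooth_along_minus[of U W'] by simp

lemma smooth_along_sum:
  assumes "open U" "finite I" "\<And>i. i \<in> I \<Longrightarrow> smooth_sec U (W i)"
  shows "smooth_sec U (\<lambda>p. \<Sum>i\<in>I. W i p)"
  using assms(2,3)
proof (induction I rule: finite_induct)
  case empty then show ?case using smooth_along_zero by simp
next
  case (insert i I)
  then show ?case using smooth_along_add[OF assms(1), of "W i" "\<lambda>p. \<Sum>i\<in>I. W i p"] by simp
qed

end

text \<open>Vector fields are the sections along the identity, so closure properties of sections
  specialize to fields.\<close>

lemma (in smooth_manifold) smooth_manifold_map_id: "smooth_manifold_map A A (\<lambda>p. p)"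
proof
  show "smooth_map A A (\<lambda>p. p)"
    by (simp add: smooth_map_def smooth_fun_chart vimage_def)
qed

section \<open>Vector fields and Lie brackets\<close>

context smooth_manifold
begin

interpretation idm: smooth_manifold_map A A "\<lambda>p. p" by (rule smooth_manifold_map_id)

lemmas vector_field_subset = idm.smooth_along_subset[folded vector_field_def]
  and vector_field_scale = idm.smooth_along_scale[folded vector_field_def]
  and vector_field_cscale = idm.smooth_along_cscale[folded vector_field_def]
  and vector_field_diff = idm.smooth_along_diff[folded vector_field_def]
  and vector_field_sum = idm.smooth_along_sum[folded vector_field_def]

lemma vector_fieldD: "vector_field A U X \<Longrightarrow> smooth_fun A (U \<inter> chart_dom A q) (\<lambda>p. mderiv A (chart A q) p (X p))"
  by (simp add: vector_field_def smooth_along_def vimage_def)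

lemma vector_fieldI: "(\<And>q. smooth_fun A (U \<inter> chart_dom A q) (\<lambda>p. mderiv A (chart A q) p (X p))) \<Longrightarrow> vector_field A U X"
  by (simp add: vector_field_def smooth_along_def vimage_def)

lemma vector_field_coord: "vector_field A (chart_dom A p) (coord p v)"
  unfolding vector_field_def
proof (rule idm.smooth_along_chartI[of _ p])
  show "smooth_fun A (chart_dom A p) (\<lambda>q. mderiv A (chart A p) q (coord p v q))"
    by (rule smooth_fun_cong[OF smooth_fun_const[of _ v]]) auto
qed auto

lemma tangent_map_id [simp]: "tangent_map A A (\<lambda>p. p) p v = v"
  by (simp add: tangent_map_def)

lemma smooth_fun_mderiv:
  assumes "open U" "smooth_fun A U f" "vector_field A U X"
  shows "smooth_fun A U (\<lambda>q. mderiv A f q (X q))"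
proof (rule smooth_fun_local)
  fix p assume p: "p \<in> U"
  let ?U = "U \<inter> chart_dom A p"
  let ?F = "f \<circ> chart_inv A p"
  have U: "open ?U" using assms(1) by (auto intro: open_Int)
  have F: "smooth_on (chart A p ` ?U) ?F" using assms(2) unfolding smooth_fun_def by blast
  have "smooth_fun A ?U (\<lambda>q. \<Sum>i\<in>Basis. (mderiv A (chart A p) q (X q) \<bullet> i) *\<^sub>R fderiv ?F ((chart A p q)) i)"
  proof (rule smooth_fun_sum[OF U finite_Basis], rule smooth_fun_scaleR[OF U])
    fix i :: 'e
    show "smooth_fun A ?U (\<lambda>q. mderiv A (chart A p) q (X q) \<bullet> i)"
      by (rule smooth_fun_inner_left[OF U vector_fieldD[OF assms(3)]])
    show "smooth_fun A ?U (\<lambda>q. fderiv ?F ((chart A p q)) i)"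
      by (rule smooth_fun_compose_smooth_on[where h = "chart A p" and G = "\<lambda>x. fderiv ?F x i",
          OF U smooth_fun_subset[OF smooth_fun_chart] open_chart_image[OF assms(1)]
          smooth_on_frechet_derivative[OF F]]) auto
  qed
  then have "smooth_fun A ?U (\<lambda>q. mderiv A f q (X q))"
  proof (rule smooth_fun_cong[OF _ U])
    fix q assume q: "q \<in> ?U"
    have "linear (fderiv ?F ((chart A p q)))"
      by (rule has_derivative_linear[OF smooth_fun_has_derivative[OF assms(1,2)]]) (use q in auto)
    from linear_Basis_expand[OF this, of "mderiv A (chart A p) q (X q)"]
    show "(\<Sum>i\<in>Basis. (mderiv A (chart A p) q (X q) \<bullet> i) *\<^sub>R fderiv ?F ((chart A p q)) i) = mderiv A f q (X q)"
      using mderiv_chart[OF assms(1,2), of q p "X q"] q by simp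
  qed
  then show "\<exists>V. open V \<and> p \<in> V \<and> smooth_fun A V (\<lambda>q. mderiv A f q (X q))"
    using U p by (intro exI[of _ ?U]) auto
qed

text \<open>The bracket is defined through the coordinate map of the chart at \<open>p\<close>
  alone. For other functions, \<open>frechet_derivative_field\<close> splits each iterated
  derivative into a first derivative along the differentiated field and a second derivative, and the
  latter is symmetric.\<close>

lemma mderiv_lie_bracket:
  fixes f :: "'a \<Rightarrow> real"
  assumes "open U" "smooth_fun A U f" "vector_field A U X" "vector_field A U Y" "p \<in> U"
  shows "mderiv A f p (lie_bracket A X Y p)
    = mderiv A (\<lambda>q. mderiv A f q (Y q)) p (X p) - mderiv A (\<lambda>q. mderiv A f q (X q)) p (Y p)"
proof -
  let ?U = "U \<inter> chart_dom A p"
  let ?S = "chart A p ` ?U"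
  let ?F = "f \<circ> chart_inv A p"
  let ?x = "chart A p p"
  let ?h = "\<lambda>X q. mderiv A (chart A p) q (X q)"
  have U: "open ?U" "p \<in> ?U" using assms(1,5) by (auto intro: open_Int)
  have S: "open ?S" "?x \<in> ?S" using open_chart_image[OF assms(1)] assms(5) by auto
  have F: "smooth_on ?S ?F" using assms(2) unfolding smooth_fun_def by blast
  have h: "smooth_on ?S (?h Z \<circ> chart_inv A p)" if "vector_field A U Z" for Z
    using vector_fieldD[OF that, of p] unfolding smooth_fun_def by (metis inf.right_idem)
  have *: "mderiv A (\<lambda>q. mderiv A f q (Z q)) p v = mderiv A f p (mderiv A (?h Z) p v)
     + fderiv (\<lambda>y. fderiv ?F y (Z p)) ?x v" if Z: "vector_field A U Z" for Z v
  proof -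
    have "mderiv A (\<lambda>q. mderiv A f q (Z q)) p v
        = fderiv (\<lambda>y. fderiv ?F y ((?h Z \<circ> chart_inv A p) y)) ?x v"
      unfolding mderiv_def[of A "\<lambda>q. mderiv A f q (Z q)"]
    proof (subst frechet_derivative_cong_open[OF S])
      fix y assume "y \<in> ?S"
      then obtain q where q: "q \<in> U" "q \<in> chart_dom A p" "y = chart A p q" by auto
      then show "((\<lambda>q. mderiv A f q (Z q)) \<circ> chart_inv A p) y
          = fderiv ?F y ((?h Z \<circ> chart_inv A p) y)"
        by (simp add: mderiv_chart[OF assms(1,2) q(1,2)])
    qed simp
    also have "\<dots> = fderiv ?F ?x (fderiv (?h Z \<circ> chart_inv A p) ?x v)
      + fderiv (\<lambda>y. fderiv ?F y ((?h Z \<circ> chart_inv A p) ?x)) ?x v"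
      by (rule frechet_derivative_field[OF S(1) F h[OF Z] S(2)])
    finally show ?thesis by (simp add: mderiv_def[of A "?h Z"] mderiv_def[of A f])
  qed
  have "mderiv A f p (mderiv A (?h Y) p (X p) - mderiv A (?h X) p (Y p))
     = mderiv A f p (mderiv A (?h Y) p (X p)) - mderiv A f p (mderiv A (?h X) p (Y p))"
    by (rule linear_diff[OF linear_mderiv[OF assms(1,2,5)]])
  then show ?thesis
    unfolding lie_bracket_def *[OF assms(3)] *[OF assms(4)]
    using second_derivative_symmetric[OF S(1) F S(2), of "X p" "Y p"] by simp
qed

text \<open>Expresses the bracket in a fixed chart \<open>r\<close> instead of the chart at the
  moving point, which shows that it is a smooth field. The proof goes by components because
  \<open>mderiv_lie_bracket\<close> concerns real functions.\<close>

lemma mderiv_chart_lie_bracket: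
  assumes "open U" "vector_field A U X" "vector_field A U Y" "p \<in> U" "p \<in> chart_dom A r"
  shows "mderiv A (chart A r) p (lie_bracket A X Y p)
    = mderiv A (\<lambda>q. mderiv A (chart A r) q (Y q)) p (X p) - mderiv A (\<lambda>q. mderiv A (chart A r) q (X q)) p (Y p)"
proof (rule euclidean_eqI)
  fix i :: 'e
  let ?U = "U \<inter> chart_dom A r"
  have U: "open ?U" "p \<in> ?U" using assms by (auto intro: open_Int)
  have XY: "vector_field A ?U X" "vector_field A ?U Y" using vector_field_subset assms(2,3) by auto
  have ch: "smooth_fun A ?U (chart A r)" by (rule smooth_fun_subset[OF smooth_fun_chart]) auto
  have ch': "mderiv A (\<lambda>q. chart A r q \<bullet> i) q v = mderiv A (chart A r) q v \<bullet> i" if "q \<in> ?U" for q v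
    by (rule mderiv_inner_left[OF U(1) ch that])
  have i: "mderiv A (\<lambda>q. mderiv A (chart A r) q (Z q)) p v \<bullet> i = mderiv A (\<lambda>q. mderiv A (\<lambda>q. chart A r q \<bullet> i) q (Z q)) p v"
    if "vector_field A ?U Z" for Z v
  proof (rule trans[OF mderiv_inner_left[OF U(1) smooth_fun_mderiv[OF U(1) ch that] U(2), symmetric]])
    show "mderiv A (\<lambda>q. mderiv A (chart A r) q (Z q) \<bullet> i) p v = mderiv A (\<lambda>q. mderiv A (\<lambda>q. chart A r q \<bullet> i) q (Z q)) p v"
      by (rule mderiv_cong[OF U]) (rule ch'[symmetric])
  qed
  show "mderiv A (chart A r) p (lie_bracket A X Y p) \<bullet> i = (mderiv A (\<lambda>q. mderiv A (chart A r) q (Y q)) p (X p)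
      - mderiv A (\<lambda>q. mderiv A (chart A r) q (X q)) p (Y p)) \<bullet> i"
    unfolding inner_diff_left i[OF XY(1)] i[OF XY(2)] ch'[OF U(2), symmetric]
    by (rule mderiv_lie_bracket[OF U(1) smooth_fun_inner_left[OF U(1) ch] XY U(2)])
qed

lemma vector_field_lie_bracket:
  assumes "open U" "vector_field A U X" "vector_field A U Y"
  shows "vector_field A U (lie_bracket A X Y)"
proof (rule vector_fieldI)
  fix r
  let ?U = "U \<inter> chart_dom A r"
  have U: "open ?U" using assms by (auto intro: open_Int)
  have XY: "vector_field A ?U X" "vector_field A ?U Y" using vector_field_subset assms(2,3) by auto
  have ch: "smooth_fun A ?U (chart A r)" by (rule smooth_fun_subset[OF smooth_fun_chart]) auto
  show "smooth_fun A ?U (\<lambda>p. mderiv A (chart A r) p (lie_bracket A X Y p))"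
    by (rule smooth_fun_cong[OF smooth_fun_diff[OF U smooth_fun_mderiv[OF U smooth_fun_mderiv[OF U ch XY(2)] XY(1)]
        smooth_fun_mderiv[OF U smooth_fun_mderiv[OF U ch XY(1)] XY(2)]] U])
      (use mderiv_chart_lie_bracket[OF assms] in auto)
qed

lemma lie_bracket_coord:
  assumes "p \<in> chart_dom A r" shows "lie_bracket A (coord r v) (coord r w) p = 0"
proof -
  have 0: "mderiv A (\<lambda>q. mderiv A (chart A r) q (coord r w q)) p u = 0" for u w
    using mderiv_cong[OF open_chart_dom assms, of "\<lambda>q. mderiv A (chart A r) q (coord r w q)" "\<lambda>q. w"] by simp
  have "mderiv A (chart A r) p (lie_bracket A (coord r v) (coord r w) p) = mderiv A (chart A r) p 0"
    unfolding mderiv_chart_lie_bracket[OF open_chart_dom vector_field_coord vector_field_coord assms assms] 0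
    by (simp add: linear_0[OF linear_mderiv_chart[OF assms]])
  then show ?thesis by (rule mderiv_chart_inject[OF assms])
qed

end

context smooth_manifold_map
begin

lemma smooth_along_comp:
  assumes "open V" "vector_field B V Z"
  shows "smooth_sec (\<phi> -` V) (\<lambda>p. Z (\<phi> p))"
  unfolding smooth_along_def
proof
  fix r
  show "smooth_fun A (\<phi> -` V \<inter> \<phi> -` chart_dom B r) (\<lambda>p. mderiv B (chart B r) (\<phi> p) (Z (\<phi> p)))"
    using smooth_fun_comp[OF _ cod.vector_fieldD[OF assms(2)], of r] assms(1) by (simp add: open_Int)
qed

lemma mderiv_chart_tangent_map:
  "\<phi> p \<in> chart_dom B r \<Longrightarrow> mderiv B (chart B r) (\<phi> p) (tangent_map A B \<phi> p v) = mderiv A (\<lambda>q. chart B r (\<phi> q)) p v"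
  using mderiv_comp[OF cod.open_chart_dom cod.smooth_fun_chart] by simp

lemma smooth_along_tangent_map:
  assumes "open U" "vector_field A U X"
  shows "smooth_sec U (\<lambda>p. tangent_map A B \<phi> p (X p))"
  unfolding smooth_along_def
proof
  fix r
  let ?U = "U \<inter> \<phi> -` chart_dom B r"
  have U: "open ?U" by (rule open_Int_vimage_chart[OF assms(1)])
  have "smooth_fun A ?U (\<lambda>p. mderiv A (\<lambda>q. chart B r (\<phi> q)) p (X p))"
    by (rule dom.smooth_fun_mderiv[OF U dom.smooth_fun_subset[OF smooth_fun_chart_map] dom.vector_field_subset[OF assms(2)]]) auto
  then show "smooth_fun A ?U (\<lambda>p. mderiv B (chart B r) (\<phi> p) (tangent_map A B \<phi> p (X p)))"
    by (rule dom.smooth_fun_cong[OF _ U]) (auto simp: mderiv_chart_tangent_map)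
qed

lemma smooth_along_component:
  assumes "open U" "smooth_sec U W"
  shows "smooth_fun A (U \<inter> \<phi> -` chart_dom B r) (\<lambda>p. mderiv B (chart B r) (\<phi> p) (W p) \<bullet> i)"
  by (rule dom.smooth_fun_inner_left[OF open_Int_vimage_chart[OF assms(1)] smooth_alongD[OF assms(2)]])

lemma coord_expansion:
  assumes "\<phi> p \<in> chart_dom B r"
  shows "w = (\<Sum>i\<in>Basis. (mderiv B (chart B r) (\<phi> p) w \<bullet> i) *\<^sub>R cod.coord r i (\<phi> p))"
  using linear_Basis_expand[OF cod.linear_coord[OF assms], of "mderiv B (chart B r) (\<phi> p) w"]
  by (simp add: cod.coord_mderiv_chart[OF assms])

end

subsection \<open>Connections along a map and their curvature\<close>

locale connection_map = smooth_manifold_map A B \<phi>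
  for A :: "('b::{second_countable_topology,t2_space}, 'd::euclidean_space) atlas"
    and B :: "('a::{second_countable_topology,t2_space}, 'e::euclidean_space) atlas"
    and \<phi> :: "'b \<Rightarrow> 'a" +
  fixes D :: "('b \<Rightarrow> 'e) \<Rightarrow> 'b \<Rightarrow> 'd \<Rightarrow> 'e"
  assumes connection: "connection_along A B \<phi> D"
begin

lemmas connection_rule = connection[unfolded connection_along_def, THEN spec, THEN mp]

lemma D_linear: "open U \<Longrightarrow> smooth_sec U W \<Longrightarrow> p \<in> U \<Longrightarrow> linear (D W p)"
  by (rule connection_rule[THEN conjunct1, rule_format])

lemma D_smooth: "open U \<Longrightarrow> smooth_sec U W \<Longrightarrow> vector_field A U X \<Longrightarrow> smooth_sec U (\<lambda>p. D W p (X p))"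
  by (rule connection_rule[THEN conjunct2, THEN conjunct1, rule_format, OF _ conjI])

lemma D_cong:
  "open U \<Longrightarrow> smooth_sec U W \<Longrightarrow> smooth_sec U W' \<Longrightarrow> (\<And>q. q \<in> U \<Longrightarrow> W q = W' q) \<Longrightarrow> p \<in> U \<Longrightarrow> D W p v = D W' p v"
  by (rule connection_rule[THEN conjunct2, THEN conjunct2, THEN conjunct1, rule_format, OF _ conjI[OF _ conjI[OF _ ballI]]])

lemma D_add:
  "open U \<Longrightarrow> smooth_sec U W \<Longrightarrow> smooth_sec U W' \<Longrightarrow> p \<in> U \<Longrightarrow> D (\<lambda>q. W q + W' q) p v = D W p v + D W' p v"
  by (rule connection_rule[THEN conjunct2, THEN conjunct2, THEN conjunct2, THEN conjunct1, rule_format, OF _ conjI])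

lemma D_scale:
  "open U \<Longrightarrow> smooth_fun A U f \<Longrightarrow> smooth_sec U W \<Longrightarrow> p \<in> U
    \<Longrightarrow> D (\<lambda>q. f q *\<^sub>R W q) p v = mderiv A f p v *\<^sub>R W p + f p *\<^sub>R D W p v"
  by (rule connection_rule[THEN conjunct2, THEN conjunct2, THEN conjunct2, THEN conjunct2, rule_format, OF _ conjI])

lemma D_cscale: "open U \<Longrightarrow> smooth_sec U W \<Longrightarrow> p \<in> U \<Longrightarrow> D (\<lambda>q. c *\<^sub>R W q) p v = c *\<^sub>R D W p v"
  using D_scale[of U "\<lambda>q. c" W p v] by simp

lemma D_zero: "D (\<lambda>q. 0) p v = 0"
  using D_cscale[OF open_UNIV smooth_along_zero, of p 0 v] by simp

lemma D_sum:
  assumes "open U" "finite I" "\<And>i. i \<in> I \<Longrightarrow> smooth_sec U (W i)" "p \<in> U"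
  shows "D (\<lambda>q. \<Sum>i\<in>I. W i q) p v = (\<Sum>i\<in>I. D (W i) p v)"
  using assms(2,3)
proof (induction I rule: finite_induct)
  case empty then show ?case by (simp add: D_zero)
next
  case (insert i I)
  have "smooth_sec U (\<lambda>q. \<Sum>i\<in>I. W i q)" by (rule smooth_along_sum[OF assms(1)]) (use insert in auto)
  from D_add[OF assms(1) _ this assms(4), of "W i" v] show ?case using insert by simp
qed

lemma D_sum_scale:
  assumes "open U" "finite I" "\<And>i. i \<in> I \<Longrightarrow> smooth_fun A U (f i)" "\<And>i. i \<in> I \<Longrightarrow> smooth_sec U (W i)" "p \<in> U"
  shows "D (\<lambda>q. \<Sum>i\<in>I. f i q *\<^sub>R W i q) p v = (\<Sum>i\<in>I. mderiv A (f i) p v *\<^sub>R W i p + f i p *\<^sub>R D (W i) p v)"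
proof -
  have "D (\<lambda>q. \<Sum>i\<in>I. f i q *\<^sub>R W i q) p v = (\<Sum>i\<in>I. D (\<lambda>q. f i q *\<^sub>R W i q) p v)"
    by (rule D_sum[OF assms(1,2) smooth_along_scale[OF assms(1,3,4)] assms(5)])
  also have "\<dots> = (\<Sum>i\<in>I. mderiv A (f i) p v *\<^sub>R W i p + f i p *\<^sub>R D (W i) p v)"
    by (rule sum.cong[OF refl]) (rule D_scale[OF assms(1,3,4,5)])
  finally show ?thesis .
qed

lemma curvature_cong:
  assumes "open U" "vector_field A U X" "vector_field A U Y" "smooth_sec U W" "smooth_sec U W'"
    "\<And>q. q \<in> U \<Longrightarrow> W q = W' q" "p \<in> U"
  shows "curvature A D X Y W p = curvature A D X Y W' p"
proof -
  have *: "D W q v = D W' q v" if "q \<in> U" for q v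
    by (rule D_cong[OF assms(1,4,5,6) that])
  have **: "D (\<lambda>q. D W q (Z q)) p v = D (\<lambda>q. D W' q (Z q)) p v" if "vector_field A U Z" for Z v
    by (rule D_cong[OF assms(1) D_smooth[OF assms(1,4) that] D_smooth[OF assms(1,5) that] * assms(7)])
  show ?thesis unfolding curvature_def **[OF assms(2)] **[OF assms(3)] *[OF assms(7)] ..
qed

lemma curvature_add:
  assumes "open U" "vector_field A U X" "vector_field A U Y" "smooth_sec U W" "smooth_sec U W'" "p \<in> U"
  shows "curvature A D X Y (\<lambda>q. W q + W' q) p = curvature A D X Y W p + curvature A D X Y W' p"
proof -
  have s: "smooth_sec U (\<lambda>q. W q + W' q)" by (rule smooth_along_add[OF assms(1,4,5)])
  have *: "D (\<lambda>q. W q + W' q) q v = D W q v + D W' q v" if "q \<in> U" for q v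
    by (rule D_add[OF assms(1,4,5) that])
  have "D (\<lambda>q. D (\<lambda>q. W q + W' q) q (Z q)) p v = D (\<lambda>q. D W q (Z q)) p v + D (\<lambda>q. D W' q (Z q)) p v"
    if Z: "vector_field A U Z" for Z v
  proof -
    note sm = D_smooth[OF assms(1,4) Z] D_smooth[OF assms(1,5) Z]
    show ?thesis
      using D_cong[OF assms(1) D_smooth[OF assms(1) s Z] smooth_along_add[OF assms(1) sm] * assms(6)]
        D_add[OF assms(1) sm assms(6)] by simp
  qed
  note ** = this
  show ?thesis unfolding curvature_def **[OF assms(2)] **[OF assms(3)] *[OF assms(6)] by simp
qed

text \<open>Terms with one derivative on \<open>f\<close> cancel under antisymmetrization; those
  with two combine to the derivative of \<open>f\<close> along the bracket, which the bracket term
  of the curvature removes.\<close>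

lemma curvature_scale:
  assumes "open U" "vector_field A U X" "vector_field A U Y" "smooth_fun A U f" "smooth_sec U W" "p \<in> U"
  shows "curvature A D X Y (\<lambda>q. f q *\<^sub>R W q) p = f p *\<^sub>R curvature A D X Y W p"
proof -
  have s: "smooth_sec U (\<lambda>q. f q *\<^sub>R W q)" by (rule smooth_along_scale[OF assms(1,4,5)])
  have *: "D (\<lambda>q. f q *\<^sub>R W q) q v = mderiv A f q v *\<^sub>R W q + f q *\<^sub>R D W q v" if "q \<in> U" for q v
    by (rule D_scale[OF assms(1,4,5) that])
  have **: "D (\<lambda>q. D (\<lambda>q. f q *\<^sub>R W q) q (Z q)) p v
     = (mderiv A (\<lambda>q. mderiv A f q (Z q)) p v *\<^sub>R W p + mderiv A f p (Z p) *\<^sub>R D W p v)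
       + (mderiv A f p v *\<^sub>R D W p (Z p) + f p *\<^sub>R D (\<lambda>q. D W q (Z q)) p v)"
    if Z: "vector_field A U Z" for Z v
  proof -
    note m = dom.smooth_fun_mderiv[OF assms(1,4) Z]
    note d = D_smooth[OF assms(1,5) Z]
    note s1 = smooth_along_scale[OF assms(1) m assms(5)]
    note s2 = smooth_along_scale[OF assms(1,4) d]
    have "D (\<lambda>q. D (\<lambda>q. f q *\<^sub>R W q) q (Z q)) p v = D (\<lambda>q. mderiv A f q (Z q) *\<^sub>R W q + f q *\<^sub>R D W q (Z q)) p v"
      by (rule D_cong[OF assms(1) D_smooth[OF assms(1) s Z] smooth_along_add[OF assms(1) s1 s2] * assms(6)])
    also have "\<dots> = D (\<lambda>q. mderiv A f q (Z q) *\<^sub>R W q) p v + D (\<lambda>q. f q *\<^sub>R D W q (Z q)) p v"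
      by (rule D_add[OF assms(1) s1 s2 assms(6)])
    also have "\<dots> = (mderiv A (\<lambda>q. mderiv A f q (Z q)) p v *\<^sub>R W p + mderiv A f p (Z p) *\<^sub>R D W p v)
       + (mderiv A f p v *\<^sub>R D W p (Z p) + f p *\<^sub>R D (\<lambda>q. D W q (Z q)) p v)"
      unfolding D_scale[OF assms(1) m assms(5,6)] D_scale[OF assms(1,4) d assms(6)] ..
    finally show ?thesis .
  qed
  show ?thesis
    unfolding curvature_def **[OF assms(2)] **[OF assms(3)] *[OF assms(6)]
      dom.mderiv_lie_bracket[OF assms(1,4,2,3,6)]
    by (simp add: algebra_simps)
qed

lemma curvature_sum_scale:
  assumes "open U" "vector_field A U X" "vector_field A U Y" "finite I"
    "\<And>i. i \<in> I \<Longrightarrow> smooth_fun A U (f i)" "\<And>i. i \<in> I \<Longrightarrow> smooth_sec U (W i)" "p \<in> U"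
  shows "curvature A D X Y (\<lambda>q. \<Sum>i\<in>I. f i q *\<^sub>R W i q) p = (\<Sum>i\<in>I. f i p *\<^sub>R curvature A D X Y (W i) p)"
  using assms(4-6)
proof (induction I rule: finite_induct)
  case empty
  show ?case by (simp add: curvature_def D_zero)
next
  case (insert i I)
  have s: "smooth_sec U (\<lambda>q. f j q *\<^sub>R W j q)" if "j \<in> insert i I" for j
    by (rule smooth_along_scale[OF assms(1)]) (use insert that in auto)
  have "smooth_sec U (\<lambda>q. \<Sum>i\<in>I. f i q *\<^sub>R W i q)"
    by (rule smooth_along_sum[OF assms(1)]) (use insert s in auto)
  from curvature_add[OF assms(1-3) s this assms(7), of i]
    curvature_scale[OF assms(1-3), of "f i" "W i" p] assms(7)
  show ?case using insert by simp
qed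

end

text \<open>The curvature of coordinate fields at \<open>q\<close>, extended multilinearly to
  vectors. Linearity is thereby built in, and what has to be proved is agreement with
  \<open>curvature\<close> on arbitrary fields.\<close>

definition curv_tensor ::
  "('a::{second_countable_topology,t2_space}, 'e::euclidean_space) atlas \<Rightarrow> (('a \<Rightarrow> 'e) \<Rightarrow> 'a \<Rightarrow> 'e \<Rightarrow> 'e)
    \<Rightarrow> 'a \<Rightarrow> 'e \<Rightarrow> 'e \<Rightarrow> 'e \<Rightarrow> 'e" where
  "curv_tensor B amb q u v w = (\<Sum>k\<in>Basis. \<Sum>i\<in>Basis. \<Sum>j\<in>Basis. ((u \<bullet> i) * (v \<bullet> j) * (w \<bullet> k)) *\<^sub>R
     curvature B amb (smooth_manifold.coord B q i) (smooth_manifold.coord B q j) (smooth_manifold.coord B q k) q)"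

lemma linear_curv_tensor:
  shows "linear (\<lambda>u. curv_tensor B amb q u v w)" "linear (\<lambda>v. curv_tensor B amb q u v w)"
    "linear (\<lambda>w. curv_tensor B amb q u v w)"
  unfolding curv_tensor_def
  by (intro linearI; simp add: inner_add_left distrib_left distrib_right scaleR_add_left sum.distrib scaleR_sum_right mult_ac)+

section \<open>Pullback connections and their curvature\<close>

locale pullback_map = connection_map A B \<phi> D
  for A :: "('b::{second_countable_topology,t2_space}, 'd::euclidean_space) atlas"
    and B :: "('a::{second_countable_topology,t2_space}, 'e::euclidean_space) atlas"
    and \<phi> :: "'b \<Rightarrow> 'a" and D :: "('b \<Rightarrow> 'e) \<Rightarrow> 'b \<Rightarrow> 'd \<Rightarrow> 'e" +
  fixes amb :: "('a \<Rightarrow> 'e) \<Rightarrow> 'a \<Rightarrow> 'e \<Rightarrow> 'e"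
  assumes connection_amb: "connection_along B B (\<lambda>p. p) amb"
    and pullback: "pullback_connection A B \<phi> amb D"
begin

sublocale amb: connection_map B B "\<lambda>p. p" amb
  unfolding connection_map_def connection_map_axioms_def
  using cod.smooth_manifold_map_id connection_amb by simp

abbreviation tm :: "'b \<Rightarrow> 'd \<Rightarrow> 'e" where "tm \<equiv> tangent_map A B \<phi>"

lemma D_comp:
  "open V \<Longrightarrow> vector_field B V Z \<Longrightarrow> \<phi> p \<in> V \<Longrightarrow> D (\<lambda>q. Z (\<phi> q)) p v = amb Z (\<phi> p) (tm p v)"
  using pullback unfolding pullback_connection_def by blast

text \<open>A component of the image of \<open>X\<close> in the chart at \<open>r\<close>, see
  \<open>tcomp_eq\<close>. Writing it as the derivative of a function on the source makes
  \<open>smooth_fun_mderiv\<close> and \<open>mderiv_lie_bracket\<close> applicable.\<close>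

definition tcomp :: "'a \<Rightarrow> ('b \<Rightarrow> 'd) \<Rightarrow> 'e \<Rightarrow> 'b \<Rightarrow> real" where
  "tcomp r X j q = mderiv A (\<lambda>q. chart B r (\<phi> q) \<bullet> j) q (X q)"

lemma smooth_fun_chart_map_inner: "smooth_fun A (\<phi> -` chart_dom B r) (\<lambda>q. chart B r (\<phi> q) \<bullet> j)"
  by (rule dom.smooth_fun_inner_left[OF open_vimage_map[OF cod.open_chart_dom] smooth_fun_chart_map])

lemma tcomp_eq:
  "\<phi> q \<in> chart_dom B r \<Longrightarrow> tcomp r X j q = mderiv B (chart B r) (\<phi> q) (tm q (X q)) \<bullet> j"
  using dom.mderiv_inner_left[OF open_vimage_map[OF cod.open_chart_dom] smooth_fun_chart_map, of q r j "X q"]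
  by (simp add: tcomp_def mderiv_chart_tangent_map)

lemma tcomp_self: "tcomp (\<phi> p) X j p = tm p (X p) \<bullet> j"
  by (simp add: tcomp_eq)

lemma tangent_map_expansion:
  "\<phi> q \<in> chart_dom B r \<Longrightarrow> tm q (X q) = (\<Sum>j\<in>Basis. tcomp r X j q *\<^sub>R cod.coord r j (\<phi> q))"
  by (subst coord_expansion[of q r]) (simp_all add: tcomp_eq)

lemma smooth_fun_tcomp:
  assumes "open U" "vector_field A U X"
  shows "smooth_fun A (U \<inter> \<phi> -` chart_dom B r) (tcomp r X j)"
  unfolding tcomp_def[abs_def]
  by (rule dom.smooth_fun_mderiv[OF open_Int_vimage_chart[OF assms(1)]
      dom.smooth_fun_subset[OF smooth_fun_chart_map_inner] dom.vector_field_subset[OF assms(2)]]) auto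

lemma tcomp_lie_bracket:
  assumes "open U" "vector_field A U X" "vector_field A U Y" "p \<in> U" "\<phi> p \<in> chart_dom B r"
  shows "tcomp r (lie_bracket A X Y) j p = mderiv A (tcomp r Y j) p (X p) - mderiv A (tcomp r X j) p (Y p)"
proof -
  let ?U = "U \<inter> \<phi> -` chart_dom B r"
  have "mderiv A (\<lambda>q. chart B r (\<phi> q) \<bullet> j) p (lie_bracket A X Y p)
    = mderiv A (\<lambda>q. mderiv A (\<lambda>q. chart B r (\<phi> q) \<bullet> j) q (Y q)) p (X p) - mderiv A (\<lambda>q. mderiv A (\<lambda>q. chart B r (\<phi> q) \<bullet> j) q (X q)) p (Y p)"
    by (rule dom.mderiv_lie_bracket[of ?U]; (rule open_Int_vimage_chart dom.smooth_fun_subset[OF smooth_fun_chart_map_inner]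
        dom.vector_field_subset[OF assms(2)] dom.vector_field_subset[OF assms(3)] assms)?) (use assms in auto)
  then show ?thesis unfolding tcomp_def[abs_def] .
qed

lemma smooth_sec_coord: "smooth_sec (\<phi> -` chart_dom B r) (\<lambda>q. cod.coord r k (\<phi> q))"
  by (rule smooth_along_comp[OF cod.open_chart_dom cod.vector_field_coord])

lemma D_coord:
  assumes "\<phi> q \<in> chart_dom B r"
  shows "D (\<lambda>q. cod.coord r k (\<phi> q)) q (X q) = (\<Sum>j\<in>Basis. tcomp r X j q *\<^sub>R amb (cod.coord r k) (\<phi> q) (cod.coord r j (\<phi> q)))"
proof -
  have l: "linear (amb (cod.coord r k) (\<phi> q))"
    by (rule amb.D_linear[OF cod.open_chart_dom _ assms]) (rule cod.vector_field_coord[unfolded vector_field_def])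
  show ?thesis
    unfolding D_comp[OF cod.open_chart_dom cod.vector_field_coord assms] tangent_map_expansion[OF assms]
    by (simp add: linear_sum[OF l] linear_cmul[OF l])
qed

text \<open>On pulled back coordinate fields \<open>D\<close> is known from the chain rule. The
  derivatives of the components \<open>tcomp\<close> cancel against the bracket term, and since
  coordinate fields commute, the remaining second derivatives are the ambient curvature.\<close>

lemma curvature_coord:
  assumes "open U" "vector_field A U X" "vector_field A U Y" "p \<in> U"
  shows "curvature A D X Y (\<lambda>q. cod.coord (\<phi> p) k (\<phi> q)) p = (\<Sum>i\<in>Basis. \<Sum>j\<in>Basis. (tcomp (\<phi> p) X i p * tcomp (\<phi> p) Y j p) *\<^sub>R
     curvature B amb (cod.coord (\<phi> p) i) (cod.coord (\<phi> p) j) (cod.coord (\<phi> p) k) (\<phi> p))"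
proof -
  define r where "r = \<phi> p"
  define F where "F = cod.coord r"
  define G where "G j s = amb (F k) s (F j s)" for j s
  let ?V = "chart_dom B r"
  let ?U = "U \<inter> \<phi> -` ?V"
  have U: "open ?U" "p \<in> ?U" using open_Int_vimage_chart[OF assms(1)] assms(4) by (auto simp: r_def)
  have F: "vector_field B ?V (F j)" for j unfolding F_def by (rule cod.vector_field_coord)
  have G: "vector_field B ?V (G j)" for j
    unfolding G_def[abs_def] vector_field_def
    by (rule amb.D_smooth[OF cod.open_chart_dom F[unfolded vector_field_def] F])
  have sF: "smooth_sec ?U (\<lambda>q. F k (\<phi> q))"
    unfolding F_def by (rule smooth_along_subset[OF smooth_sec_coord]) auto
  have sG: "smooth_sec ?U (\<lambda>q. G j (\<phi> q))" for j
    by (rule smooth_along_subset[OF smooth_along_comp[OF cod.open_chart_dom G]]) auto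
  have DF: "D (\<lambda>q. F k (\<phi> q)) q (Z q) = (\<Sum>j\<in>Basis. tcomp r Z j q *\<^sub>R G j (\<phi> q))" if "q \<in> ?U" for q and Z :: "'b \<Rightarrow> 'd"
    unfolding F_def G_def by (rule D_coord) (use that in auto)
  have pV: "\<phi> p \<in> ?V" using U by auto
  have linG: "linear (amb (G j) (\<phi> p))" for j
    by (rule amb.D_linear[OF cod.open_chart_dom G[unfolded vector_field_def] pV])
  have DG: "D (\<lambda>q. G j (\<phi> q)) p (X p) = (\<Sum>i\<in>Basis. tcomp r X i p *\<^sub>R amb (G j) (\<phi> p) (F i (\<phi> p)))" for j X
    unfolding D_comp[OF cod.open_chart_dom G pV] tangent_map_expansion[OF pV]
    by (simp add: linear_sum[OF linG] linear_cmul[OF linG] F_def)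
  have DD: "D (\<lambda>q. D (\<lambda>q. F k (\<phi> q)) q (Y q)) p (X p) = (\<Sum>j\<in>Basis. mderiv A (tcomp r Y j) p (X p) *\<^sub>R G j (\<phi> p))
      + (\<Sum>j\<in>Basis. \<Sum>i\<in>Basis. (tcomp r X i p * tcomp r Y j p) *\<^sub>R amb (G j) (\<phi> p) (F i (\<phi> p)))"
    if Y: "vector_field A U Y" for X Y
  proof -
    have Y': "vector_field A ?U Y" by (rule dom.vector_field_subset[OF Y]) auto
    have t: "smooth_fun A ?U (tcomp r Y j)" for j by (rule smooth_fun_tcomp[OF assms(1) Y])
    have "D (\<lambda>q. D (\<lambda>q. F k (\<phi> q)) q (Y q)) p (X p) = D (\<lambda>q. \<Sum>j\<in>Basis. tcomp r Y j q *\<^sub>R G j (\<phi> q)) p (X p)"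
      by (rule D_cong[OF U(1) D_smooth[OF U(1) sF Y'] smooth_along_sum[OF U(1) finite_Basis smooth_along_scale[OF U(1) t sG]] _ U(2)])
        (rule DF)
    also have "\<dots> = (\<Sum>j\<in>Basis. mderiv A (tcomp r Y j) p (X p) *\<^sub>R G j (\<phi> p) + tcomp r Y j p *\<^sub>R D (\<lambda>q. G j (\<phi> q)) p (X p))"
      by (rule D_sum_scale[OF U(1) finite_Basis t sG U(2)])
    finally show ?thesis
      by (simp add: DG sum.distrib scaleR_sum_right mult_ac)
  qed
  have br: "D (\<lambda>q. F k (\<phi> q)) p (lie_bracket A X Y p) = (\<Sum>j\<in>Basis. mderiv A (tcomp r Y j) p (X p) *\<^sub>R G j (\<phi> p))
     - (\<Sum>j\<in>Basis. mderiv A (tcomp r X j) p (Y p) *\<^sub>R G j (\<phi> p))"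
    unfolding DF[OF U(2)] tcomp_lie_bracket[OF assms pV] by (simp add: scaleR_diff_left sum_subtractf)
  have curvF: "curvature B amb (F i) (F j) (F k) (\<phi> p) = amb (G j) (\<phi> p) (F i (\<phi> p)) - amb (G i) (\<phi> p) (F j (\<phi> p))" for i j
  proof -
    have "lie_bracket B (F i) (F j) (\<phi> p) = 0" unfolding F_def by (rule cod.lie_bracket_coord[OF pV])
    moreover have "amb (F k) (\<phi> p) 0 = 0"
      by (rule linear_0[OF amb.D_linear[OF cod.open_chart_dom F[unfolded vector_field_def] pV]])
    ultimately show ?thesis by (simp add: curvature_def G_def[abs_def])
  qed
  have "curvature A D X Y (\<lambda>q. F k (\<phi> q)) p =
     (\<Sum>j\<in>Basis. \<Sum>i\<in>Basis. (tcomp r X i p * tcomp r Y j p) *\<^sub>R amb (G j) (\<phi> p) (F i (\<phi> p)))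
     - (\<Sum>j\<in>Basis. \<Sum>i\<in>Basis. (tcomp r Y i p * tcomp r X j p) *\<^sub>R amb (G j) (\<phi> p) (F i (\<phi> p)))"
    unfolding curvature_def DD[OF assms(3)] DD[OF assms(2)] br by simp
  also have "(\<Sum>j\<in>Basis. \<Sum>i\<in>Basis. (tcomp r X i p * tcomp r Y j p) *\<^sub>R amb (G j) (\<phi> p) (F i (\<phi> p)))
    = (\<Sum>i\<in>Basis. \<Sum>j\<in>Basis. (tcomp r X i p * tcomp r Y j p) *\<^sub>R amb (G j) (\<phi> p) (F i (\<phi> p)))"
    by (rule sum.swap)
  finally show ?thesis
    unfolding r_def[symmetric] F_def[symmetric] curvF[folded r_def]
    by (simp add: scaleR_diff_right sum_subtractf mult.commute)
qed

text \<open>Near \<open>p\<close> a section is a combination of pulled back coordinate fields with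
  smooth coefficients, and curvature is linear over functions. With the identity as \<phi> the same
  statement says that the curvature of a connection on a manifold is a tensor.\<close>

theorem curvature_eq_curv_tensor:
  assumes "open U" "vector_field A U X" "vector_field A U Y" "smooth_sec U W" "p \<in> U"
  shows "curvature A D X Y W p = curv_tensor B amb (\<phi> p) (tm p (X p)) (tm p (Y p)) (W p)"
proof -
  let ?r = "\<phi> p"
  let ?U = "U \<inter> \<phi> -` chart_dom B ?r"
  let ?w = "\<lambda>k q. mderiv B (chart B ?r) (\<phi> q) (W q) \<bullet> k"
  have U: "open ?U" "p \<in> ?U" using open_Int_vimage_chart[OF assms(1)] assms(5) by auto
  have X: "vector_field A ?U X" "vector_field A ?U Y" using dom.vector_field_subset assms(2,3) by auto
  have w: "smooth_fun A ?U (?w k)" for k by (rule smooth_along_component[OF assms(1,4)])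
  have F: "smooth_sec ?U (\<lambda>q. cod.coord ?r k (\<phi> q))" for k
    by (rule smooth_along_subset[OF smooth_sec_coord]) auto
  have "curvature A D X Y W p = curvature A D X Y (\<lambda>q. \<Sum>k\<in>Basis. ?w k q *\<^sub>R cod.coord ?r k (\<phi> q)) p"
  proof (rule curvature_cong[OF U(1) X])
    show "smooth_sec ?U W" by (rule smooth_along_subset[OF assms(4)]) auto
    show "smooth_sec ?U (\<lambda>q. \<Sum>k\<in>Basis. ?w k q *\<^sub>R cod.coord ?r k (\<phi> q))"
      by (rule smooth_along_sum[OF U(1) finite_Basis smooth_along_scale[OF U(1) w F]])
  qed (use U coord_expansion in auto)
  also have "\<dots> = (\<Sum>k\<in>Basis. ?w k p *\<^sub>R curvature A D X Y (\<lambda>q. cod.coord ?r k (\<phi> q)) p)"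
    by (rule curvature_sum_scale[OF U(1) X finite_Basis w F U(2)])
  finally show ?thesis
    unfolding curvature_coord[OF assms(1,2,3,5)] tcomp_self curv_tensor_def
    by (simp add: scaleR_sum_right mult_ac)
qed

end

section \<open>Induction on germs of sections\<close>

context smooth_manifold_map
begin

text \<open>By the coordinate expansion, composites of ambient fields with \<phi> generate all germs
  of sections under sums and function multiples. Properties of \<open>D\<close> are thus reduced to
  those of the ambient connection.\<close>

lemma smooth_along_germ_induct:
  assumes "open U" "p \<in> U" "smooth_sec U W"
    and cong: "\<And>U W W'. open U \<Longrightarrow> p \<in> U \<Longrightarrow> smooth_sec U W \<Longrightarrow> smooth_sec U W' \<Longrightarrow>
       (\<And>q. q \<in> U \<Longrightarrow> W q = W' q) \<Longrightarrow> P W \<Longrightarrow> P W'"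
    and comp: "\<And>V Z. open V \<Longrightarrow> \<phi> p \<in> V \<Longrightarrow> vector_field B V Z \<Longrightarrow> P (\<lambda>q. Z (\<phi> q))"
    and add: "\<And>U W W'. open U \<Longrightarrow> p \<in> U \<Longrightarrow> smooth_sec U W \<Longrightarrow> smooth_sec U W' \<Longrightarrow>
       P W \<Longrightarrow> P W' \<Longrightarrow> P (\<lambda>q. W q + W' q)"
    and scale: "\<And>U f W. open U \<Longrightarrow> p \<in> U \<Longrightarrow> smooth_fun A U f \<Longrightarrow> smooth_sec U W \<Longrightarrow> P W \<Longrightarrow> P (\<lambda>q. f q *\<^sub>R W q)"
  shows "P W"
proof -
  let ?r = "\<phi> p"
  let ?U = "U \<inter> \<phi> -` chart_dom B ?r"
  let ?w = "\<lambda>k q. mderiv B (chart B ?r) (\<phi> q) (W q) \<bullet> k"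
  have U: "open ?U" "p \<in> ?U" using open_Int_vimage_chart[OF assms(1)] assms(2) by auto
  have w: "smooth_fun A ?U (?w k)" for k by (rule smooth_along_component[OF assms(1,3)])
  have F: "smooth_sec ?U (\<lambda>q. cod.coord ?r k (\<phi> q))" for k
    by (rule smooth_along_subset[OF smooth_along_comp[OF cod.open_chart_dom cod.vector_field_coord]]) auto
  have PF: "P (\<lambda>q. ?w k q *\<^sub>R cod.coord ?r k (\<phi> q))" for k
    by (rule scale[OF U w F]) (rule comp[OF cod.open_chart_dom cod.chart_dom_mem cod.vector_field_coord])
  have wF: "smooth_sec ?U (\<lambda>q. ?w k q *\<^sub>R cod.coord ?r k (\<phi> q))" for k
    by (rule smooth_along_scale[OF U(1) w F])
  \<comment> \<open>The empty sum is obtained as the zero multiple of a coordinate field.\<close>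
  have P0: "P (\<lambda>q. 0)"
    using scale[OF U dom.smooth_fun_const[of _ 0] F comp[OF cod.open_chart_dom cod.chart_dom_mem cod.vector_field_coord]] by simp
  have "P (\<lambda>q. \<Sum>k\<in>I. ?w k q *\<^sub>R cod.coord ?r k (\<phi> q))" if "finite I" for I
    using that
  proof (induction I rule: finite_induct)
    case empty
    then show ?case using P0 by simp
  next
    case (insert k I)
    have "P (\<lambda>q. ?w k q *\<^sub>R cod.coord ?r k (\<phi> q) + (\<Sum>k\<in>I. ?w k q *\<^sub>R cod.coord ?r k (\<phi> q)))"
      by (rule add[OF U wF smooth_along_sum[OF U(1) insert(1) wF] PF insert(3)])
    then show ?case using insert(1,2) by simp
  qed
  then have "P (\<lambda>q. \<Sum>k\<in>Basis. ?w k q *\<^sub>R cod.coord ?r k (\<phi> q))" by simp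
  then show "P W"
  proof (rule cong[OF U smooth_along_sum[OF U(1) finite_Basis wF] smooth_along_subset[OF assms(3)], rotated 2])
    fix q assume "q \<in> ?U"
    then show "(\<Sum>k\<in>Basis. ?w k q *\<^sub>R cod.coord ?r k (\<phi> q)) = W q"
      using coord_expansion[of q ?r "W q"] by simp
  qed auto
qed

end

subsection \<open>Curvature tensors of constant holomorphic sectional curvature\<close>

text \<open>\<open>K x y z w\<close> stands for \<open>g (R x y z) w\<close> at one point, so that
  \<open>K x y y x\<close> is the numerator of the sectional curvature.\<close>

locale hol_curvature =
  fixes K :: "'v::real_vector \<Rightarrow> 'v \<Rightarrow> 'v \<Rightarrow> 'v \<Rightarrow> real" and ip :: "'v \<Rightarrow> 'v \<Rightarrow> real" and J :: "'v \<Rightarrow> 'v" and \<mu> :: real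
  assumes lin1: "linear (\<lambda>x. K x y z w)" and lin2: "linear (\<lambda>y. K x y z w)"
    and lin3: "linear (\<lambda>z. K x y z w)" and lin4: "linear (\<lambda>w. K x y z w)"
    and skew12: "K x y z w = - K y x z w" and skew34: "K x y z w = - K x y w z"
    and bianchi: "K x y z w + K y z x w + K z x y w = 0"
    and K_J: "K x y (J z) (J w) = K x y z w"
    and lin_J: "linear J" and J_J: "J (J x) = - x"
    and bilin: "bilinear ip" and ip_sym: "ip x y = ip y x" and ip_J: "ip (J x) (J y) = ip x y"
    and hol: "K u (J u) (J u) u = \<mu> * (ip u u)\<^sup>2"
begin

text \<open>The four Bianchi identities for the cyclic permutations of the arguments combine
  linearly; the skew symmetries match up their terms.\<close>

lemma K_pair: "K x y z w = K z w x y"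
proof -
  have "K y z w x = - K y z x w" "K z w y x = - K z w x y" "K w x z y = - K w x y z" "K x y w z = - K x y z w"
    by (rule skew34)+
  moreover have "K w y z x = K y w x z" "K x z w y = K z x y w"
    by (simp_all only: skew12[of w y] skew34[of y w z x] skew12[of x z] skew34[of z x w y] minus_minus)
  ultimately show ?thesis
    using bianchi[of x y z w] bianchi[of y z w x] bianchi[of z w x y] bianchi[of w x y z] by linarith
qed

lemma K_J': "K (J x) (J y) z w = K x y z w"
  by (simp only: K_pair[of "J x"] K_J K_pair[of z w])

text \<open>Apply \<open>J\<close> to both of the first two arguments, use
  \<open>J (J b) = - b\<close>, and exchange them.\<close>

lemma K_swap_J: "K a (J b) z w = K b (J a) z w"
proof -
  have "K a (J b) z w = K (J a) (- b) z w" by (simp only: J_J[symmetric] K_J')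
  also have "\<dots> = - K (J a) b z w" by (rule linear_neg[OF lin2])
  finally show ?thesis by (simp only: skew12[of "J a"] minus_minus)
qed

lemma K_swap_J': "K z w (J a) b = K z w (J b) a"
  using K_swap_J[of b a z w] by (simp only: K_pair[of z w] skew12[of "J a"] skew12[of "J b"])

lemmas ip_simps = bilinear_ladd[OF bilin] bilinear_radd[OF bilin] bilinear_lsub[OF bilin] bilinear_rsub[OF bilin]

text \<open>Adding \<open>hol\<close> for \<open>x + y\<close> and \<open>x - y\<close> leaves six
  mixed terms of degree two in each vector. Four equal \<open>K x (J y) (J y) x\<close>; two equal
  \<open>K x (J x) (J y) y\<close>, which the Bianchi identity splits as
  \<open>K x y y x + K x (J y) (J y) x\<close>. Hence the coefficients 2 and 6.\<close>

lemma hol_polar: "2 * K x y y x + 6 * K x (J y) (J y) x = \<mu> * (2 * ip x x * ip y y + 4 * (ip x y)\<^sup>2)"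
proof -
  have "K (x + y) (J (x + y)) (J (x + y)) (x + y) + K (x - y) (J (x - y)) (J (x - y)) (x - y)
    = 2 * (K x (J x) (J x) x + K y (J y) (J y) y + K y (J y) (J x) x + K x (J x) (J y) y + K y (J x) (J y) x
       + K x (J y) (J x) y + K y (J x) (J x) y + K x (J y) (J y) x)"
    by (simp add: linear_add[OF lin1] linear_add[OF lin2] linear_add[OF lin3] linear_add[OF lin4]
       linear_diff[OF lin1] linear_diff[OF lin2] linear_diff[OF lin3] linear_diff[OF lin4]
       linear_add[OF lin_J] linear_diff[OF lin_J] algebra_simps)
  moreover have "ip (x + y) (x + y) = ip x x + ip y y + 2 * ip x y" "ip (x - y) (x - y) = ip x x + ip y y - 2 * ip x y"
    using ip_sym[of y x] by (simp_all add: ip_simps)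
  ultimately have e: "K y (J y) (J x) x + K x (J x) (J y) y + K y (J x) (J y) x + K x (J y) (J x) y + K y (J x) (J x) y + K x (J y) (J y) x
     = \<mu> * (2 * ip x x * ip y y + 4 * (ip x y)\<^sup>2)"
    unfolding hol by (simp add: power2_eq_square algebra_simps)
  have 1: "K y (J y) (J x) x = K x (J x) (J y) y"
    by (simp only: K_pair[of y] skew12[of "J x"] skew34[of x "J x" y] minus_minus)
  have 3: "K y (J x) (J y) x = K x (J y) (J y) x" by (rule K_swap_J)
  have 4: "K x (J y) (J x) y = K x (J y) (J y) x" by (rule K_swap_J')
  have 5: "K y (J x) (J x) y = K x (J y) (J y) x" by (simp only: K_swap_J[of y x] K_swap_J'[of _ _ x y])
  have "K x (J x) (J y) y + K (J x) (J y) x y + K (J y) x (J x) y = 0" by (rule bianchi)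
  then have "K x (J x) (J y) y = K x y y x + K x (J y) (J y) x"
    using K_J'[of x y x y] skew34[of x y x y] skew12[of "J y" x "J x" y] 4 by linarith
  then show ?thesis using e 1 3 4 5 by linarith
qed

text \<open>Replacing \<open>y\<close> by \<open>J y\<close> in \<open>hol_polar\<close> exchanges
  the two unknown curvatures. Three times the second equation minus the first gives
  \<open>16 * K x y y x\<close>, with a right-hand side divisible by 4; this is the source of
  \<mu>/4.\<close>

lemma sectional: "K x y y x = \<mu> / 4 * (ip x x * ip y y - (ip x y)\<^sup>2 + 3 * (ip x (J y))\<^sup>2)"
proof -
  have n: "K x (- y) (- y) x = K x y y x"
    by (simp add: linear_neg[OF lin2] linear_neg[OF lin3])
  show ?thesis
    using hol_polar[of x y] hol_polar[of x "J y"] unfolding J_J n ip_J by (simp add: algebra_simps)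
qed

lemma sectional_polar:
  "K x y y z = \<mu> / 4 * (ip x z * ip y y - ip x y * ip z y + 3 * ip x (J y) * ip z (J y))"
proof -
  have "K z y y x = K x y y z"
    by (simp only: K_pair[of z] skew12[of y x] skew34[of x y z y] minus_minus)
  then have "2 * K x y y z = K (x + z) y y (x + z) - K x y y x - K z y y z"
    by (simp add: linear_add[OF lin1] linear_add[OF lin4])
  then show ?thesis
    using ip_sym[of z x] unfolding sectional by (simp add: ip_simps power2_eq_square algebra_simps)
qed

text \<open>Polarizing in the middle arguments determines only the symmetrized
  \<open>K a b c w + K a c b w\<close>; the Bianchi identity recovers three times
  \<open>K x y z w\<close> from two such sums. Terms with \<open>J\<close> carry a factor pairing
  \<open>w\<close> with \<open>J\<close> of a middle argument, which vanishes.\<close>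

lemma totally_real_curvature:
  assumes "ip x (J y) = 0" "ip x (J z) = 0" "ip y (J z) = 0" "ip w (J x) = 0" "ip w (J y) = 0" "ip w (J z) = 0"
    "ip y (J x) = 0" "ip z (J y) = 0"
  shows "K x y z w = \<mu> / 4 * (ip y z * ip x w - ip x z * ip y w)"
proof -
  have polar: "K a b c w + K a c b w = \<mu> / 4 * (2 * ip a w * ip b c - ip a b * ip w c - ip a c * ip w b)"
    if "ip w (J b) = 0" "ip w (J c) = 0" for a b c
  proof -
    have "K a b c w + K a c b w = K a (b + c) (b + c) w - K a b b w - K a c c w"
      by (simp add: linear_add[OF lin2] linear_add[OF lin3])
    then show ?thesis
      using ip_sym[of c b] that unfolding sectional_polar
      by (simp add: ip_simps linear_add[OF lin_J] algebra_simps)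
  qed
  have "K x z y w = - K z x y w" "K y x z w = - K x y z w" by (rule skew12)+
  then have "3 * K x y z w = (K x y z w + K x z y w) - (K y z x w + K y x z w)"
    using bianchi[of x y z w] by linarith
  then show ?thesis
    unfolding polar[OF assms(5,6)] polar[OF assms(6,4)]
    by (simp add: ip_sym[of z x] ip_sym[of z y] ip_sym[of y x] ip_sym[of w] algebra_simps)
qed

end

subsection \<open>Kaehler metrics and connections along a map\<close>

locale kaehler_map = pullback_map A B \<phi> D amb
  for A :: "('b::{second_countable_topology,t2_space}, 'd::euclidean_space) atlas"
    and B :: "('a::{second_countable_topology,t2_space}, 'e::euclidean_space) atlas"
    and \<phi> :: "'b \<Rightarrow> 'a" and D :: "('b \<Rightarrow> 'e) \<Rightarrow> 'b \<Rightarrow> 'd \<Rightarrow> 'e"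
    and amb :: "('a \<Rightarrow> 'e) \<Rightarrow> 'a \<Rightarrow> 'e \<Rightarrow> 'e" +
  fixes g :: "'a \<Rightarrow> 'e \<Rightarrow> 'e \<Rightarrow> real" and J :: "'a \<Rightarrow> 'e \<Rightarrow> 'e"
  assumes kaehler: "kaehler B g J amb"
begin

lemma metric_amb: "riemannian_metric B g" and levi_civita_amb: "levi_civita B g amb"
  using kaehler unfolding kaehler_def by blast+

lemma bilinear_g: "bilinear (g q)" and g_sym: "g q v w = g q w v" and g_pos: "v \<noteq> 0 \<Longrightarrow> g q v v > 0"
  using metric_amb unfolding riemannian_metric_def by blast+

lemma g_smooth: "open U \<Longrightarrow> vector_field B U X \<Longrightarrow> vector_field B U Y \<Longrightarrow> smooth_fun B U (\<lambda>p. g p (X p) (Y p))"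
  using metric_amb unfolding riemannian_metric_def by blast

lemmas g_simps = bilinear_ladd[OF bilinear_g] bilinear_radd[OF bilinear_g] bilinear_lsub[OF bilinear_g]
  bilinear_rsub[OF bilinear_g] bilinear_lmul[OF bilinear_g] bilinear_rmul[OF bilinear_g]
  bilinear_lneg[OF bilinear_g] bilinear_rneg[OF bilinear_g] bilinear_lzero[OF bilinear_g] bilinear_rzero[OF bilinear_g]

lemma g_linear_left: "linear (\<lambda>v. g q v w)" and g_linear_right: "linear (\<lambda>w. g q v w)"
  using bilinear_g[of q] unfolding bilinear_def by auto

lemma g_eq_0_iff: "g q v v = 0 \<longleftrightarrow> v = 0"
  using g_pos[of v q] g_simps(9)[of q v] by (cases "v = 0") auto

lemma J_linear: "linear (J q)" and J_J: "J q (J q v) = - v" and g_J: "g q (J q v) (J q w) = g q v w"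
  using kaehler unfolding kaehler_def by blast+

lemma J_skew: "g q (J q v) w = - g q v (J q w)"
  using g_J[of q "J q v" w] by (simp add: J_J g_simps)

lemma J_smooth: "open U \<Longrightarrow> vector_field B U X \<Longrightarrow> vector_field B U (\<lambda>p. J p (X p))"
  and amb_J: "open U \<Longrightarrow> vector_field B U X \<Longrightarrow> p \<in> U \<Longrightarrow> amb (\<lambda>q. J q (X q)) p v = J p (amb X p v)"
  using kaehler unfolding kaehler_def by blast+

lemma amb_metric:
  "open U \<Longrightarrow> vector_field B U X \<Longrightarrow> vector_field B U Y \<Longrightarrow> p \<in> U
    \<Longrightarrow> mderiv B (\<lambda>q. g q (X q) (Y q)) p v = g p (amb X p v) (Y p) + g p (X p) (amb Y p v)"
  and amb_torsion: "open U \<Longrightarrow> vector_field B U X \<Longrightarrow> vector_field B U Y \<Longrightarrow> p \<in> U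
    \<Longrightarrow> amb Y p (X p) - amb X p (Y p) = lie_bracket B X Y p"
  using levi_civita_amb unfolding levi_civita_def by blast+

lemma smooth_metric:
  assumes "open U" "smooth_sec U V" "smooth_sec U W"
  shows "smooth_fun A U (\<lambda>q. g (\<phi> q) (V q) (W q))"
proof (rule dom.smooth_fun_local)
  fix p assume p: "p \<in> U"
  let ?r = "\<phi> p"
  let ?U = "U \<inter> \<phi> -` chart_dom B ?r"
  let ?w = "\<lambda>W k q. mderiv B (chart B ?r) (\<phi> q) (W q) \<bullet> k"
  let ?F = "cod.coord ?r"
  have U: "open ?U" "p \<in> ?U" using open_Int_vimage_chart[OF assms(1)] p by auto
  have w: "smooth_fun A ?U (?w W k)" if "smooth_sec U W" for W k
    by (rule smooth_along_component[OF assms(1) that])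
  have gF: "smooth_fun A ?U (\<lambda>q. g (\<phi> q) (?F i (\<phi> q)) (?F j (\<phi> q)))" for i j
    by (rule dom.smooth_fun_subset[OF smooth_fun_comp[OF cod.open_chart_dom
          g_smooth[OF cod.open_chart_dom cod.vector_field_coord cod.vector_field_coord]]]) auto
  have "smooth_fun A ?U (\<lambda>q. \<Sum>i\<in>Basis. \<Sum>j\<in>Basis. ?w V i q * (?w W j q * g (\<phi> q) (?F i (\<phi> q)) (?F j (\<phi> q))))"
    by (rule dom.smooth_fun_sum[OF U(1) finite_Basis], rule dom.smooth_fun_sum[OF U(1) finite_Basis],
        rule dom.smooth_fun_mult[OF U(1) w[OF assms(2)] dom.smooth_fun_mult[OF U(1) w[OF assms(3)] gF]])
  then have "smooth_fun A ?U (\<lambda>q. g (\<phi> q) (V q) (W q))"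
  proof (rule dom.smooth_fun_cong[OF _ U(1)])
    fix q assume "q \<in> ?U"
    then have q: "\<phi> q \<in> chart_dom B ?r" by simp
    have "g (\<phi> q) (V q) (W q) = g (\<phi> q) (\<Sum>i\<in>Basis. ?w V i q *\<^sub>R ?F i (\<phi> q)) (\<Sum>i\<in>Basis. ?w W i q *\<^sub>R ?F i (\<phi> q))"
      using coord_expansion[OF q, of "V q"] coord_expansion[OF q, of "W q"] by simp
    then show "(\<Sum>i\<in>Basis. \<Sum>j\<in>Basis. ?w V i q * (?w W j q * g (\<phi> q) (?F i (\<phi> q)) (?F j (\<phi> q)))) = g (\<phi> q) (V q) (W q)"
      by (subst sum.swap) (simp add: mult.left_commute linear_sum[OF g_linear_left] linear_sum[OF g_linear_right] g_simps sum_distrib_left)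
  qed
  then show "\<exists>V'. open V' \<and> p \<in> V' \<and> smooth_fun A V' (\<lambda>q. g (\<phi> q) (V q) (W q))"
    using U by blast
qed

lemma metric_rule_scale:
  assumes "open U" "p \<in> U" "smooth_fun A U f" "smooth_sec U W" "smooth_sec U V"
    "mderiv A (\<lambda>q. g (\<phi> q) (V q) (W q)) p v = g (\<phi> p) (D V p v) (W p) + g (\<phi> p) (V p) (D W p v)"
  shows "mderiv A (\<lambda>q. g (\<phi> q) (V q) (f q *\<^sub>R W q)) p v = g (\<phi> p) (D V p v) (f p *\<^sub>R W p) + g (\<phi> p) (V p) (D (\<lambda>q. f q *\<^sub>R W q) p v)"
proof -
  have "mderiv A (\<lambda>q. f q * g (\<phi> q) (V q) (W q)) p v = f p * mderiv A (\<lambda>q. g (\<phi> q) (V q) (W q)) p v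
     + mderiv A f p v * g (\<phi> p) (V p) (W p)"
    by (rule dom.mderiv_mult[OF assms(1,3) smooth_metric[OF assms(1,5,4)] assms(2)])
  then show ?thesis
    unfolding D_scale[OF assms(1,3,4,2)] by (simp add: g_simps assms(6) algebra_simps)
qed

lemma metric_rule_add:
  assumes "open U" "p \<in> U" "smooth_sec U W" "smooth_sec U W'" "smooth_sec U V"
    "mderiv A (\<lambda>q. g (\<phi> q) (V q) (W q)) p v = g (\<phi> p) (D V p v) (W p) + g (\<phi> p) (V p) (D W p v)"
    "mderiv A (\<lambda>q. g (\<phi> q) (V q) (W' q)) p v = g (\<phi> p) (D V p v) (W' p) + g (\<phi> p) (V p) (D W' p v)"
  shows "mderiv A (\<lambda>q. g (\<phi> q) (V q) (W q + W' q)) p v = g (\<phi> p) (D V p v) (W p + W' p) + g (\<phi> p) (V p) (D (\<lambda>q. W q + W' q) p v)"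
  using dom.mderiv_add[OF assms(1) smooth_metric[OF assms(1,5,3)] smooth_metric[OF assms(1,5,4)] assms(2), of v]
  unfolding D_add[OF assms(1,3,4,2)] by (simp add: g_simps assms(6,7) algebra_simps)

text \<open>Germ induction in the second section with the first one fixed. Two uses, with the
  symmetry of \<open>g\<close> in between, reduce \<open>D_metric\<close> to two pulled back ambient
  fields.\<close>

lemma D_metric_half:
  assumes "open U" "p \<in> U" "smooth_sec U W" "open U0" "p \<in> U0" "smooth_sec U0 V"
    and comp: "\<And>V' Z. open V' \<Longrightarrow> \<phi> p \<in> V' \<Longrightarrow> vector_field B V' Z \<Longrightarrow>
      mderiv A (\<lambda>q. g (\<phi> q) (V q) (Z (\<phi> q))) p v = g (\<phi> p) (D V p v) (Z (\<phi> p)) + g (\<phi> p) (V p) (D (\<lambda>q. Z (\<phi> q)) p v)"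
  shows "mderiv A (\<lambda>q. g (\<phi> q) (V q) (W q)) p v = g (\<phi> p) (D V p v) (W p) + g (\<phi> p) (V p) (D W p v)"
proof (rule smooth_along_germ_induct[where P = "\<lambda>W. mderiv A (\<lambda>q. g (\<phi> q) (V q) (W q)) p v = g (\<phi> p) (D V p v) (W p) + g (\<phi> p) (V p) (D W p v)",
    OF assms(1-3)], goal_cases)
  case (1 U W W')
  have "mderiv A (\<lambda>q. g (\<phi> q) (V q) (W q)) p v = mderiv A (\<lambda>q. g (\<phi> q) (V q) (W' q)) p v"
    by (rule dom.mderiv_cong[OF 1(1,2)]) (simp add: 1(5))
  then show ?case using 1(5)[OF 1(2)] D_cong[OF 1(1,3,4,5,2), of v] 1(6) by simp
next
  case (2 V' Z)
  then show ?case by (rule comp)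
next
  case (3 U W W')
  have U: "open (U \<inter> U0)" "p \<in> U \<inter> U0" using 3 assms by (auto intro: open_Int)
  show ?case
    by (rule metric_rule_add[OF U smooth_along_subset[OF 3(3)] smooth_along_subset[OF 3(4)] smooth_along_subset[OF assms(6)] 3(5,6)]) auto
next
  case (4 U f W)
  have U: "open (U \<inter> U0)" "p \<in> U \<inter> U0" using 4 assms by (auto intro: open_Int)
  show ?case
    by (rule metric_rule_scale[OF U dom.smooth_fun_subset[OF 4(3)] smooth_along_subset[OF 4(4)] smooth_along_subset[OF assms(6)] 4(5)]) auto
qed

lemma D_metric:
  assumes "open U" "p \<in> U" "smooth_sec U V" "smooth_sec U W"
  shows "mderiv A (\<lambda>q. g (\<phi> q) (V q) (W q)) p v = g (\<phi> p) (D V p v) (W p) + g (\<phi> p) (V p) (D W p v)"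
proof (rule D_metric_half[OF assms(1,2,4) assms(1,2,3)])
  fix V' Z assume Z: "open V'" "\<phi> p \<in> V'" "vector_field B V' Z"
  have sZ: "smooth_sec (\<phi> -` V') (\<lambda>q. Z (\<phi> q))" "open (\<phi> -` V')" "p \<in> \<phi> -` V'"
    using smooth_along_comp[OF Z(1,3)] open_vimage_map[OF Z(1)] Z(2) by auto
  have "mderiv A (\<lambda>q. g (\<phi> q) (Z (\<phi> q)) (V q)) p v = g (\<phi> p) (D (\<lambda>q. Z (\<phi> q)) p v) (V p) + g (\<phi> p) (Z (\<phi> p)) (D V p v)"
  proof (rule D_metric_half[OF assms(1,2,3) sZ(2,3,1)])
    fix V'' Z' assume Z': "open V''" "\<phi> p \<in> V''" "vector_field B V'' Z'"
    let ?V = "V' \<inter> V''"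
    have V: "open ?V" "\<phi> p \<in> ?V" using Z Z' by auto
    have vf: "vector_field B ?V Z" "vector_field B ?V Z'"
      using cod.vector_field_subset Z(3) Z'(3) by auto
    show "mderiv A (\<lambda>q. g (\<phi> q) (Z (\<phi> q)) (Z' (\<phi> q))) p v
      = g (\<phi> p) (D (\<lambda>q. Z (\<phi> q)) p v) (Z' (\<phi> p)) + g (\<phi> p) (Z (\<phi> p)) (D (\<lambda>q. Z' (\<phi> q)) p v)"
      unfolding D_comp[OF V(1) vf(1) V(2)] D_comp[OF V(1) vf(2) V(2)]
      using mderiv_comp[OF V(1) g_smooth[OF V(1) vf] V(2), of v] amb_metric[OF V(1) vf V(2), of "tm p v"] by simp
  qed
  then show "mderiv A (\<lambda>q. g (\<phi> q) (V q) (Z (\<phi> q))) p v = g (\<phi> p) (D V p v) (Z (\<phi> p)) + g (\<phi> p) (V p) (D (\<lambda>q. Z (\<phi> q)) p v)"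
    unfolding g_sym[of "\<phi> _" _ "Z (\<phi> _)"] g_sym[of "\<phi> p" "D _ p v" "V p"]
    by simp
qed

text \<open>Smoothness of \<open>J W\<close> and the derivative rule go through the induction
  together, because \<open>D_add\<close> and \<open>D_scale\<close> apply only to sections already
  known to be smooth near \<open>p\<close>.\<close>

lemma J_germ:
  assumes "open U" "p \<in> U" "smooth_sec U W"
  shows "(\<exists>U. open U \<and> p \<in> U \<and> smooth_sec U (\<lambda>q. J (\<phi> q) (W q))) \<and> (\<forall>v. D (\<lambda>q. J (\<phi> q) (W q)) p v = J (\<phi> p) (D W p v))"
proof (rule smooth_along_germ_induct[where P = "\<lambda>W. (\<exists>U. open U \<and> p \<in> U \<and> smooth_sec U (\<lambda>q. J (\<phi> q) (W q))) \<and>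
    (\<forall>v. D (\<lambda>q. J (\<phi> q) (W q)) p v = J (\<phi> p) (D W p v))", OF assms], goal_cases)
  case (1 U W W')
  then obtain V where V: "open V" "p \<in> V" "smooth_sec V (\<lambda>q. J (\<phi> q) (W q))" by blast
  have UV: "open (U \<inter> V)" "p \<in> U \<inter> V" using 1 V by auto
  have s: "smooth_sec (U \<inter> V) (\<lambda>q. J (\<phi> q) (W q))" by (rule smooth_along_subset[OF V(3)]) auto
  have s': "smooth_sec (U \<inter> V) (\<lambda>q. J (\<phi> q) (W' q))"
    by (rule smooth_along_cong[OF s UV(1)]) (use 1(5) in auto)
  have "D (\<lambda>q. J (\<phi> q) (W' q)) p v = J (\<phi> p) (D W' p v)" for v
  proof -
    have "D (\<lambda>q. J (\<phi> q) (W q)) p v = D (\<lambda>q. J (\<phi> q) (W' q)) p v"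
      by (rule D_cong[OF UV(1) s s' _ UV(2)]) (use 1(5) in auto)
    moreover have "D W p v = D W' p v" by (rule D_cong[OF 1(1,3,4,5,2)])
    ultimately show ?thesis using 1(6) by simp
  qed
  then show ?case using UV s' by blast
next
  case (2 V Z)
  note jz = J_smooth[OF 2(1,3)]
  have "D (\<lambda>q. J (\<phi> q) (Z (\<phi> q))) p v = J (\<phi> p) (D (\<lambda>q. Z (\<phi> q)) p v)" for v
    unfolding D_comp[OF 2(1) jz 2(2)] D_comp[OF 2(1,3,2)] by (rule amb_J[OF 2(1,3,2)])
  moreover have "smooth_sec (\<phi> -` V) (\<lambda>q. J (\<phi> q) (Z (\<phi> q)))" by (rule smooth_along_comp[OF 2(1) jz])
  ultimately show ?case using open_vimage_map[OF 2(1)] 2(2) by blast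
next
  case (3 U W W')
  then obtain V V' where V: "open V" "p \<in> V" "smooth_sec V (\<lambda>q. J (\<phi> q) (W q))"
    "open V'" "p \<in> V'" "smooth_sec V' (\<lambda>q. J (\<phi> q) (W' q))" by blast
  let ?V = "V \<inter> V'"
  have UV: "open ?V" "p \<in> ?V" using V by auto
  have s: "smooth_sec ?V (\<lambda>q. J (\<phi> q) (W q))" "smooth_sec ?V (\<lambda>q. J (\<phi> q) (W' q))"
    using smooth_along_subset V by auto
  have "D (\<lambda>q. J (\<phi> q) (W q + W' q)) p v = J (\<phi> p) (D (\<lambda>q. W q + W' q) p v)" for v
    using D_add[OF UV(1) s UV(2), of v] 3(5,6) unfolding D_add[OF 3(1,3,4,2)]
    by (simp add: linear_add[OF J_linear])
  moreover have "smooth_sec ?V (\<lambda>q. J (\<phi> q) (W q + W' q))"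
    using smooth_along_add[OF UV(1) s] by (simp add: linear_add[OF J_linear])
  ultimately show ?case using UV by blast
next
  case (4 U f W)
  then obtain V where V: "open V" "p \<in> V" "smooth_sec V (\<lambda>q. J (\<phi> q) (W q))" by blast
  let ?V = "U \<inter> V"
  have UV: "open ?V" "p \<in> ?V" using V 4 by auto
  have s: "smooth_sec ?V (\<lambda>q. J (\<phi> q) (W q))" "smooth_fun A ?V f"
    using smooth_along_subset[OF V(3)] dom.smooth_fun_subset[OF 4(3)] by auto
  have "D (\<lambda>q. J (\<phi> q) (f q *\<^sub>R W q)) p v = J (\<phi> p) (D (\<lambda>q. f q *\<^sub>R W q) p v)" for v
    using D_scale[OF UV(1) s(2,1) UV(2), of v] 4(5) unfolding D_scale[OF 4(1,3,4,2)]
    by (simp add: linear_add[OF J_linear] linear_cmul[OF J_linear])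
  moreover have "smooth_sec ?V (\<lambda>q. J (\<phi> q) (f q *\<^sub>R W q))"
    using smooth_along_scale[OF UV(1) s(2,1)] by (simp add: linear_cmul[OF J_linear])
  ultimately show ?case using UV by blast
qed

lemma D_J: "open U \<Longrightarrow> p \<in> U \<Longrightarrow> smooth_sec U W \<Longrightarrow> D (\<lambda>q. J (\<phi> q) (W q)) p v = J (\<phi> p) (D W p v)"
  using J_germ by blast

lemma smooth_J: "open U \<Longrightarrow> smooth_sec U W \<Longrightarrow> smooth_sec U (\<lambda>q. J (\<phi> q) (W q))"
  by (rule smooth_along_local) (use J_germ in blast)

text \<open>In pulled back coordinate fields, the terms containing \<open>amb\<close> are symmetric,
  as \<open>amb\<close> has no torsion and coordinate fields commute. The derivatives of the
  components remain and form the bracket by \<open>tcomp_lie_bracket\<close>.\<close>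

lemma D_torsion:
  assumes "open U" "vector_field A U X" "vector_field A U Y" "p \<in> U"
  shows "D (\<lambda>q. tm q (Y q)) p (X p) - D (\<lambda>q. tm q (X q)) p (Y p) = tm p (lie_bracket A X Y p)"
proof -
  let ?r = "\<phi> p"
  let ?U = "U \<inter> \<phi> -` chart_dom B ?r"
  let ?F = "cod.coord ?r"
  have U: "open ?U" "p \<in> ?U" using open_Int_vimage_chart[OF assms(1)] assms(4) by auto
  have sF: "smooth_sec ?U (\<lambda>q. ?F j (\<phi> q))" for j
    by (rule smooth_along_subset[OF smooth_sec_coord]) auto
  have *: "D (\<lambda>q. tm q (Y q)) p (X p) = (\<Sum>j\<in>Basis. mderiv A (tcomp ?r Y j) p (X p) *\<^sub>R ?F j ?r)
    + (\<Sum>j\<in>Basis. \<Sum>i\<in>Basis. (tcomp ?r Y j p * tcomp ?r X i p) *\<^sub>R amb (?F j) ?r (?F i ?r))"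
    if Y: "vector_field A U Y" for X Y
  proof -
    have t: "smooth_fun A ?U (tcomp ?r Y j)" for j by (rule smooth_fun_tcomp[OF assms(1) Y])
    have s: "smooth_sec ?U (\<lambda>q. tm q (Y q))"
      by (rule smooth_along_subset[OF smooth_along_tangent_map[OF assms(1) Y]]) auto
    have "D (\<lambda>q. tm q (Y q)) p (X p) = D (\<lambda>q. \<Sum>j\<in>Basis. tcomp ?r Y j q *\<^sub>R ?F j (\<phi> q)) p (X p)"
      by (rule D_cong[OF U(1) s smooth_along_sum[OF U(1) finite_Basis smooth_along_scale[OF U(1) t sF]] _ U(2)])
        (use tangent_map_expansion in auto)
    also have "\<dots> = (\<Sum>j\<in>Basis. mderiv A (tcomp ?r Y j) p (X p) *\<^sub>R ?F j ?r + tcomp ?r Y j p *\<^sub>R D (\<lambda>q. ?F j (\<phi> q)) p (X p))"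
      by (rule D_sum_scale[OF U(1) finite_Basis t sF U(2)])
    finally show ?thesis
      by (simp add: D_coord[OF cod.chart_dom_mem] sum.distrib scaleR_sum_right)
  qed
  have sw: "amb (?F j) ?r (?F i ?r) = amb (?F i) ?r (?F j ?r)" for i j
    using amb_torsion[OF cod.open_chart_dom cod.vector_field_coord cod.vector_field_coord cod.chart_dom_mem, of ?r i j]
      cod.lie_bracket_coord[OF cod.chart_dom_mem, of ?r i j] cod.lie_bracket_coord[OF cod.chart_dom_mem, of ?r j i] by simp
  have "(\<Sum>j\<in>Basis. \<Sum>i\<in>Basis. (tcomp ?r Y j p * tcomp ?r X i p) *\<^sub>R amb (?F j) ?r (?F i ?r))
    = (\<Sum>i\<in>Basis. \<Sum>j\<in>Basis. (tcomp ?r Y j p * tcomp ?r X i p) *\<^sub>R amb (?F j) ?r (?F i ?r))"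
    by (rule sum.swap)
  also have "\<dots> = (\<Sum>i\<in>Basis. \<Sum>j\<in>Basis. (tcomp ?r X i p * tcomp ?r Y j p) *\<^sub>R amb (?F i) ?r (?F j ?r))"
    by (intro sum.cong refl) (simp only: sw mult.commute)
  finally have "D (\<lambda>q. tm q (Y q)) p (X p) - D (\<lambda>q. tm q (X q)) p (Y p)
    = (\<Sum>j\<in>Basis. (mderiv A (tcomp ?r Y j) p (X p) - mderiv A (tcomp ?r X j) p (Y p)) *\<^sub>R ?F j ?r)"
    unfolding *[OF assms(2)] *[OF assms(3)] by (simp add: scaleR_diff_left sum_subtractf)
  also have "\<dots> = tm p (lie_bracket A X Y p)"
    unfolding tcomp_lie_bracket[OF assms cod.chart_dom_mem, symmetric]
    by (rule tangent_map_expansion[OF cod.chart_dom_mem, symmetric])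
  finally show ?thesis .
qed

text \<open>Differentiate the function \<open>g W W\<close> twice: the commutator is the derivative
  along the bracket, and products of first derivatives cancel. Skew symmetry in the last two
  arguments follows later by polarization.\<close>

lemma curvature_metric:
  assumes "open U" "vector_field A U X" "vector_field A U Y" "smooth_sec U W" "p \<in> U"
  shows "g (\<phi> p) (curvature A D X Y W p) (W p) = 0"
proof -
  let ?f = "\<lambda>q. g (\<phi> q) (W q) (W q)"
  have f: "smooth_fun A U ?f" by (rule smooth_metric[OF assms(1,4,4)])
  have 1: "mderiv A ?f q v = 2 * g (\<phi> q) (D W q v) (W q)" if "q \<in> U" for q v
    using D_metric[OF assms(1) that assms(4,4), of v] g_sym[of "\<phi> q" "W q"] by simp
  have 2: "mderiv A (\<lambda>q. mderiv A ?f q (Z q)) p v = 2 * (g (\<phi> p) (D (\<lambda>q. D W q (Z q)) p v) (W p) + g (\<phi> p) (D W p (Z p)) (D W p v))"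
    if Z: "vector_field A U Z" for Z v
  proof -
    note s = D_smooth[OF assms(1,4) Z]
    have "mderiv A (\<lambda>q. mderiv A ?f q (Z q)) p v = mderiv A (\<lambda>q. 2 * g (\<phi> q) (D W q (Z q)) (W q)) p v"
      by (rule dom.mderiv_cong[OF assms(1,5)]) (rule 1)
    also have "\<dots> = 2 * mderiv A (\<lambda>q. g (\<phi> q) (D W q (Z q)) (W q)) p v"
      by (rule dom.mderiv_linear[OF assms(1) bounded_linear_mult_right smooth_metric[OF assms(1) s assms(4)] assms(5)])
    finally show ?thesis unfolding D_metric[OF assms(1,5) s assms(4)] .
  qed
  have "2 * g (\<phi> p) (D W p (lie_bracket A X Y p)) (W p)
    = mderiv A (\<lambda>q. mderiv A ?f q (Y q)) p (X p) - mderiv A (\<lambda>q. mderiv A ?f q (X q)) p (Y p)"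
    unfolding 1[OF assms(5), symmetric] by (rule dom.mderiv_lie_bracket[OF assms(1) f assms(2,3,5)])
  then show ?thesis
    unfolding 2[OF assms(2)] 2[OF assms(3)] curvature_def
    using g_sym[of "\<phi> p" "D W p (X p)" "D W p (Y p)"] by (simp add: g_simps)
qed

lemma curvature_J:
  assumes "open U" "vector_field A U X" "vector_field A U Y" "smooth_sec U W" "p \<in> U"
  shows "curvature A D X Y (\<lambda>q. J (\<phi> q) (W q)) p = J (\<phi> p) (curvature A D X Y W p)"
proof -
  note s = smooth_J[OF assms(1,4)]
  have 1: "D (\<lambda>q. J (\<phi> q) (W q)) q v = J (\<phi> q) (D W q v)" if "q \<in> U" for q v
    by (rule D_J[OF assms(1) that assms(4)])
  have 2: "D (\<lambda>q. D (\<lambda>q. J (\<phi> q) (W q)) q (Z q)) p v = J (\<phi> p) (D (\<lambda>q. D W q (Z q)) p v)"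
    if Z: "vector_field A U Z" for Z v
  proof -
    note s' = D_smooth[OF assms(1,4) Z]
    have "D (\<lambda>q. D (\<lambda>q. J (\<phi> q) (W q)) q (Z q)) p v = D (\<lambda>q. J (\<phi> q) (D W q (Z q))) p v"
      by (rule D_cong[OF assms(1) D_smooth[OF assms(1) s Z] smooth_J[OF assms(1) s'] 1 assms(5)])
    then show ?thesis unfolding D_J[OF assms(1,5) s'] .
  qed
  show ?thesis
    unfolding curvature_def 1[OF assms(5)] 2[OF assms(2)] 2[OF assms(3)] by (simp add: linear_diff[OF J_linear])
qed

end

text \<open>Applied to the identity map, the rules along a map describe the ambient space itself.\<close>

lemma kaehler_map_id:
  assumes "kaehler B g J amb" shows "kaehler_map B B (\<lambda>p. p) amb amb g J"
proof -
  interpret smooth_manifold B using assms by unfold_locales (simp add: kaehler_def)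
  interpret smooth_manifold_map B B "\<lambda>p. p" by (rule smooth_manifold_map_id)
  have c: "connection_along B B (\<lambda>p. p) amb" using assms by (simp add: kaehler_def levi_civita_def)
  show ?thesis
    by unfold_locales (use assms c in \<open>auto simp: pullback_connection_def\<close>)
qed

section \<open>The ambient curvature of a complex space form\<close>

locale space_form =
  fixes B :: "('a::{second_countable_topology,t2_space}, 'e::euclidean_space) atlas"
    and g :: "'a \<Rightarrow> 'e \<Rightarrow> 'e \<Rightarrow> real" and J :: "'a \<Rightarrow> 'e \<Rightarrow> 'e"
    and amb :: "('a \<Rightarrow> 'e) \<Rightarrow> 'a \<Rightarrow> 'e \<Rightarrow> 'e" and \<mu> :: real
  assumes space_form: "complex_space_form B g J amb \<mu>"
begin

sublocale kaehler_map B B "\<lambda>p. p" amb amb g J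
  by (rule kaehler_map_id) (use space_form in \<open>simp add: complex_space_form_def\<close>)

lemma curv_tensor_eq:
  assumes "open U" "vector_field B U X" "vector_field B U Y" "vector_field B U Z" "p \<in> U"
  shows "curvature B amb X Y Z p = curv_tensor B amb p (X p) (Y p) (Z p)"
  using curvature_eq_curv_tensor[OF assms(1-3) assms(4)[unfolded vector_field_def] assms(5)] by simp

lemma hol_curvature: "hol_curvature (\<lambda>x y z w. g q (curv_tensor B amb q x y z) w) (g q) (J q) \<mu>"
proof -
  let ?R = "curv_tensor B amb q"
  let ?E = "dom.coord q"
  let ?V = "chart_dom B q"
  note V = dom.open_chart_dom[of q]
  note vf = dom.vector_field_coord[of q]
  note vf' = vf[unfolded vector_field_def]
  \<comment> \<open>Vectors are extended by coordinate fields because their brackets vanish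
    throughout the chart domain.\<close>
  have R: "?R x y z = curvature B amb (?E x) (?E y) (?E z) q" for x y z
    using curv_tensor_eq[OF V vf vf vf dom.chart_dom_mem] by simp
  have l1: "linear (\<lambda>x. g q (?R x y z) w)" for y z w
    using linear_compose[OF linear_curv_tensor(1) g_linear_left] by (simp add: comp_def)
  have l2: "linear (\<lambda>y. g q (?R x y z) w)" for x z w
    using linear_compose[OF linear_curv_tensor(2) g_linear_left] by (simp add: comp_def)
  have l3: "linear (\<lambda>z. g q (?R x y z) w)" for x y w
    using linear_compose[OF linear_curv_tensor(3) g_linear_left] by (simp add: comp_def)
  have l4: "linear (\<lambda>w. g q (?R x y z) w)" for x y z by (rule g_linear_right)
  have k12: "g q (?R x y z) w = - g q (?R y x z) w" for x y z w
  proof -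
    have "?R x y z = - ?R y x z"
      unfolding R curvature_def dom.lie_bracket_coord[OF dom.chart_dom_mem] by simp
         (simp add: linear_0[OF D_linear[OF V vf' dom.chart_dom_mem]])
    then show ?thesis by (simp add: g_simps)
  qed
  have k34: "g q (?R x y z) w = - g q (?R x y w) z" for x y z w
  proof -
    have 0: "g q (?R x y z) z = 0" for z
      using curvature_metric[OF V vf vf vf' dom.chart_dom_mem] unfolding R by simp
    have "?R x y (z + w) = ?R x y z + ?R x y w" by (rule linear_add[OF linear_curv_tensor(3)])
    then show ?thesis using 0[of "z + w"] 0[of z] 0[of w] by (simp add: g_simps)
  qed
  have bi: "g q (?R x y z) w + g q (?R y z x) w + g q (?R z x y) w = 0" for x y z w
  proof -
    \<comment> \<open>Vanishing torsion and vanishing brackets give this symmetry on the whole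
      domain and not only at \<open>q\<close>, so it may be differentiated once more; the second
      derivatives then cancel in the cyclic sum.\<close>
    have sw: "amb (?E v) s (?E u s) = amb (?E u) s (?E v s)" if "s \<in> ?V" for u v s
      using amb_torsion[OF V vf vf that, of u v] dom.lie_bracket_coord[OF that, of v u]
        dom.lie_bracket_coord[OF that, of u v] by simp
    have sw2: "amb (\<lambda>s. amb (?E v) s (?E u s)) q t = amb (\<lambda>s. amb (?E u) s (?E v s)) q t" for u v t
      by (rule D_cong[OF V D_smooth[OF V vf' vf] D_smooth[OF V vf' vf] sw dom.chart_dom_mem])
    have z: "amb (?E v) q 0 = 0" for v by (rule linear_0[OF D_linear[OF V vf' dom.chart_dom_mem]])
    have "?R x y z + ?R y z x + ?R z x y = 0"
      unfolding R curvature_def dom.lie_bracket_coord[OF dom.chart_dom_mem] z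
      using sw2[of y z] sw2[of x z] sw2[of x y] by simp
    then have "g q (?R x y z + ?R y z x + ?R z x y) w = 0" by (simp add: g_simps)
    then show ?thesis by (simp add: g_simps)
  qed
  have RJ: "?R x y (J q z) = J q (?R x y z)" for x y z
  proof -
    have "curvature B amb (?E x) (?E y) (\<lambda>s. J s (?E z s)) q = J q (?R x y z)"
      unfolding R by (rule curvature_J[OF V vf vf vf' dom.chart_dom_mem])
    then show ?thesis using curv_tensor_eq[OF V vf vf J_smooth[OF V vf] dom.chart_dom_mem] by simp
  qed
  have kJ: "g q (?R x y (J q z)) (J q w) = g q (?R x y z) w" for x y z w
    unfolding RJ by (rule g_J)
  have base: "linear (J q)" "J q (J q x) = - x" "bilinear (g q)" "g q x y = g q y x" "g q (J q x) (J q y) = g q x y" for x y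
    by (rule J_linear J_J bilinear_g g_sym g_J)+
  have hl: "g q (?R u (J q u) (J q u)) u = \<mu> * (g q u u)\<^sup>2" for u
  proof (cases "u = 0")
    case True
    then show ?thesis by (simp add: g_simps)
  next
    case False
    have "sectional_curvature B g amb (?E u) (\<lambda>s. J s (?E u s)) q = \<mu>"
      using space_form V vf[of u] False dom.chart_dom_mem[of q] unfolding complex_space_form_def
      by (metis dom.coord_self)
    \<comment> \<open>\<open>u\<close> and \<open>J u\<close> are orthogonal of equal length, so the
      denominator of the sectional curvature is the square of \<open>g q u u\<close>.\<close>
    moreover have "g q u (J q u) = 0" using J_skew[of q u u] g_sym[of q "J q u" u] by simp
    moreover have "curvature B amb (?E u) (\<lambda>s. J s (?E u s)) (\<lambda>s. J s (?E u s)) q = ?R u (J q u) (J q u)"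
      using curv_tensor_eq[OF V vf J_smooth[OF V vf] J_smooth[OF V vf] dom.chart_dom_mem] by simp
    ultimately have "g q (?R u (J q u) (J q u)) u / (g q u u * g q u u) = \<mu>"
      by (simp add: sectional_curvature_def g_J)
    then show ?thesis using g_pos[OF False, of q] by (simp add: field_simps power2_eq_square)
  qed
  show ?thesis
    by (rule hol_curvature.intro; (rule l1 | rule l2 | rule l3 | rule l4 | rule k12 | rule k34 | rule bi | rule kJ | rule base | rule hl))
qed

end

subsection \<open>Semiparallel traceless cubic forms\<close>

definition kdelta :: "'i \<Rightarrow> 'i \<Rightarrow> real" where
  "kdelta i j = (if i = j then 1 else 0)"

lemma sum_kdelta: "finite I \<Longrightarrow> i \<in> I \<Longrightarrow> (\<Sum>m\<in>I. kdelta i m * f m) = f i"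
  by (simp add: kdelta_def if_distrib[of "\<lambda>x. x * _"] cong: if_cong)

lemma sum_kdelta2:
  "finite I \<Longrightarrow> i \<in> I \<Longrightarrow> j \<in> I \<Longrightarrow> (\<Sum>k\<in>I. \<Sum>l\<in>I. kdelta i k * kdelta j l * f k l) = f i j"
  by (simp add: mult.assoc sum_distrib_left[symmetric] sum_kdelta)

text \<open>\<open>S\<close> is the second fundamental form, \<open>R\<close> the curvature tensor given by the Gauss equation, both
  with respect to an orthonormal basis indexed by \<open>I\<close>.\<close>

locale semiparallel_cubic =
  fixes I :: "'i set" and S :: "'i \<Rightarrow> 'i \<Rightarrow> 'i \<Rightarrow> real" and c :: real
    and R :: "'i \<Rightarrow> 'i \<Rightarrow> 'i \<Rightarrow> 'i \<Rightarrow> real"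
  assumes fin: "finite I" and ne: "I \<noteq> {}"
    and sym12: "i \<in> I \<Longrightarrow> j \<in> I \<Longrightarrow> k \<in> I \<Longrightarrow> S i j k = S j i k"
    and sym23: "i \<in> I \<Longrightarrow> j \<in> I \<Longrightarrow> k \<in> I \<Longrightarrow> S i j k = S i k j"
    and traceless: "k \<in> I \<Longrightarrow> (\<Sum>i\<in>I. S i i k) = 0"
    and gauss: "i \<in> I \<Longrightarrow> j \<in> I \<Longrightarrow> k \<in> I \<Longrightarrow> l \<in> I \<Longrightarrow> R i j k l =
      c * (kdelta j k * kdelta i l - kdelta i k * kdelta j l)
      + ((\<Sum>m\<in>I. S j k m * S i l m) - (\<Sum>m\<in>I. S i k m * S j l m))"
    and semiparallel: "i \<in> I \<Longrightarrow> j \<in> I \<Longrightarrow> k \<in> I \<Longrightarrow> l \<in> I \<Longrightarrow> p \<in> I \<Longrightarrow>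
      (\<Sum>m\<in>I. R i j p m * S m k l + R i j k m * S m p l + R i j l m * S m k p) = 0"
begin

text \<open>The inner product of the values of \<sigma> at the index pairs \<open>a b\<close> and
  \<open>e d\<close>.\<close>

definition Q where "Q a b e d = (\<Sum>t\<in>I. S a b t * S e d t)"
definition C where "C i j k l = Q j k i l - Q i k j l"
text \<open>The curvature tensor of the unit sphere in an orthonormal basis.\<close>

definition E :: "'i \<Rightarrow> 'i \<Rightarrow> 'i \<Rightarrow> 'i \<Rightarrow> real" where "E i j k l = kdelta j k * kdelta i l - kdelta i k * kdelta j l"
definition T where "T j m = (\<Sum>i\<in>I. Q j i i m)"
definition N where "N = (\<Sum>i\<in>I. \<Sum>j\<in>I. Q i j j i)"
abbreviation "n \<equiv> real (card I)"

lemma R_eq: "i \<in> I \<Longrightarrow> j \<in> I \<Longrightarrow> k \<in> I \<Longrightarrow> l \<in> I \<Longrightarrow> R i j k l = c * E i j k l + C i j k l"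
  by (simp add: gauss E_def C_def Q_def)

lemma Q_sym: "a \<in> I \<Longrightarrow> b \<in> I \<Longrightarrow> Q a b e d = Q b a e d" "e \<in> I \<Longrightarrow> d \<in> I \<Longrightarrow> Q a b e d = Q a b d e"
  "Q a b e d = Q e d a b"
  unfolding Q_def by (auto intro!: sum.cong simp: sym12 mult.commute)

lemma Q_trace: "(\<Sum>i\<in>I. Q i i a b) = 0"
proof -
  have "(\<Sum>i\<in>I. Q i i a b) = (\<Sum>t\<in>I. (\<Sum>i\<in>I. S i i t) * S a b t)"
    unfolding Q_def by (subst sum.swap) (simp add: sum_distrib_right)
  then show ?thesis by (simp add: traceless)
qed

lemma Q_contract:
  assumes "m \<in> I" "i \<in> I" "j \<in> I" "p \<in> I"
  shows "(\<Sum>l\<in>I. S j l p * S m i l) = Q i m j p"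
  unfolding Q_def by (rule sum.cong[OF refl]) (use assms sym12[of m i] sym23[of j _ p] in auto)

lemma sum_E: "(\<Sum>i\<in>I. \<Sum>j\<in>I. \<Sum>k\<in>I. \<Sum>l\<in>I. E i j k l * f i j k l) = (\<Sum>i\<in>I. \<Sum>j\<in>I. f i j j i - f i j i j)"
proof (intro sum.cong refl)
  fix i j assume ij: "i \<in> I" "j \<in> I"
  have "(\<Sum>k\<in>I. \<Sum>l\<in>I. E i j k l * f i j k l)
    = (\<Sum>k\<in>I. \<Sum>l\<in>I. kdelta j k * kdelta i l * f i j k l) - (\<Sum>k\<in>I. \<Sum>l\<in>I. kdelta i k * kdelta j l * f i j k l)"
    by (simp add: E_def left_diff_distrib sum_subtractf)
  then show "(\<Sum>k\<in>I. \<Sum>l\<in>I. E i j k l * f i j k l) = f i j j i - f i j i j"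
    by (simp add: sum_kdelta2[OF fin] ij)
qed

text \<open>\<open>semiparallel\<close> is taken with \<open>k = i\<close>, multiplied by
  \<open>S j l p\<close> and summed over \<open>l\<close> and \<open>p\<close>. By the symmetry of
  \<open>S\<close> the terms in which \<open>R\<close> acts on \<open>p\<close> and on
  \<open>l\<close> coincide, hence the factor 2; the action on the index \<open>i\<close> produces
  \<open>T\<close>.\<close>

lemma semiparallel_contract:
  assumes "i \<in> I" "j \<in> I"
  shows "2 * (\<Sum>p\<in>I. \<Sum>m\<in>I. R i j p m * Q i m j p) + (\<Sum>m\<in>I. R i j i m * T j m) = 0"
proof -
  have "0 = (\<Sum>l\<in>I. \<Sum>p\<in>I. S j l p * (\<Sum>m\<in>I. R i j p m * S m i l + R i j i m * S m p l + R i j l m * S m i p))"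
    by (simp add: semiparallel assms)
  also have "\<dots> = (\<Sum>l\<in>I. \<Sum>p\<in>I. \<Sum>m\<in>I. S j l p * R i j p m * S m i l)
    + (\<Sum>l\<in>I. \<Sum>p\<in>I. \<Sum>m\<in>I. S j l p * R i j i m * S m p l)
    + (\<Sum>l\<in>I. \<Sum>p\<in>I. \<Sum>m\<in>I. S j l p * R i j l m * S m i p)"
    by (simp add: sum_distrib_left distrib_left sum.distrib mult.assoc)
  also have "(\<Sum>l\<in>I. \<Sum>p\<in>I. \<Sum>m\<in>I. S j l p * R i j p m * S m i l) = (\<Sum>p\<in>I. \<Sum>m\<in>I. R i j p m * Q i m j p)"
  proof -
    have "(\<Sum>l\<in>I. \<Sum>p\<in>I. \<Sum>m\<in>I. S j l p * R i j p m * S m i l) = (\<Sum>p\<in>I. \<Sum>m\<in>I. \<Sum>l\<in>I. S j l p * R i j p m * S m i l)"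
      by (subst sum.swap, rule sum.cong[OF refl], rule sum.swap)
    also have "\<dots> = (\<Sum>p\<in>I. \<Sum>m\<in>I. R i j p m * (\<Sum>l\<in>I. S j l p * S m i l))"
      by (simp add: sum_distrib_left mult_ac)
    finally show ?thesis by (simp add: Q_contract assms)
  qed
  also have "(\<Sum>l\<in>I. \<Sum>p\<in>I. \<Sum>m\<in>I. S j l p * R i j l m * S m i p) = (\<Sum>p\<in>I. \<Sum>m\<in>I. R i j p m * Q i m j p)"
  proof -
    have "(\<Sum>l\<in>I. \<Sum>p\<in>I. \<Sum>m\<in>I. S j l p * R i j l m * S m i p) = (\<Sum>l\<in>I. \<Sum>m\<in>I. \<Sum>p\<in>I. S j l p * R i j l m * S m i p)"
      by (rule sum.cong[OF refl], rule sum.swap)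
    also have "\<dots> = (\<Sum>l\<in>I. \<Sum>m\<in>I. R i j l m * (\<Sum>p\<in>I. S j p l * S m i p))"
      by (intro sum.cong refl) (simp add: sum_distrib_left mult_ac sym23[OF assms(2)] cong: sum.cong)
    finally show ?thesis by (simp add: Q_contract assms)
  qed
  also have "(\<Sum>l\<in>I. \<Sum>p\<in>I. \<Sum>m\<in>I. S j l p * R i j i m * S m p l) = (\<Sum>m\<in>I. R i j i m * T j m)"
  proof -
    have "(\<Sum>l\<in>I. \<Sum>p\<in>I. \<Sum>m\<in>I. S j l p * R i j i m * S m p l) = (\<Sum>l\<in>I. \<Sum>m\<in>I. \<Sum>p\<in>I. S j l p * R i j i m * S m p l)"
      by (rule sum.cong[OF refl], rule sum.swap)
    also have "\<dots> = (\<Sum>m\<in>I. \<Sum>l\<in>I. \<Sum>p\<in>I. S j l p * R i j i m * S m p l)" by (rule sum.swap)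
    also have "\<dots> = (\<Sum>m\<in>I. \<Sum>l\<in>I. R i j i m * (\<Sum>p\<in>I. S j l p * S l m p))"
    proof (intro sum.cong refl)
      fix m l assume ml: "m \<in> I" "l \<in> I"
      have "S m p l = S l m p" if "p \<in> I" for p using sym12 sym23 ml that by metis
      then show "(\<Sum>p\<in>I. S j l p * R i j i m * S m p l) = R i j i m * (\<Sum>p\<in>I. S j l p * S l m p)"
        by (simp add: sum_distrib_left mult_ac)
    qed
    finally show ?thesis by (simp add: T_def Q_def sum_distrib_left)
  qed
  finally show ?thesis by simp
qed

section \<open>The contracted semiparallelity condition\<close>

abbreviation "sum4 f \<equiv> \<Sum>i\<in>I. \<Sum>j\<in>I. \<Sum>k\<in>I. \<Sum>l\<in>I. f i j k l"

lemma sum4_swap: "sum4 f = sum4 (\<lambda>i j. f j i)"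
  by (rule sum.swap)

text \<open>One factor \<open>C\<close> is unfolded into its two terms; as the other factor is skew
  in the first two indices, both contribute the same.\<close>

lemma norm_C: "sum4 (\<lambda>i j p m. (C i j p m)\<^sup>2) = 2 * sum4 (\<lambda>i j p m. C i j p m * Q i m j p)"
proof -
  have "sum4 (\<lambda>i j p m. (C i j p m)\<^sup>2)
     = sum4 (\<lambda>i j p m. C i j p m * Q i m j p) - sum4 (\<lambda>i j p m. C i j p m * Q j m i p)"
    unfolding sum_subtractf[symmetric]
    by (intro sum.cong refl) (simp add: C_def Q_sym(3)[of _ _ _ "_"] power2_eq_square algebra_simps Q_sym(3))
  also have "sum4 (\<lambda>i j p m. C i j p m * Q j m i p) = sum4 (\<lambda>i j p m. C j i p m * Q i m j p)"
    by (rule sum4_swap)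
  also have "\<dots> = - sum4 (\<lambda>i j p m. C i j p m * Q i m j p)"
    unfolding sum_negf[symmetric] by (intro sum.cong refl) (simp add: C_def algebra_simps)
  finally show ?thesis by simp
qed

lemma N_eq_T: "N = (\<Sum>j\<in>I. T j j)"
  unfolding N_def T_def ..

text \<open>The algebraic content of Simons' identity.\<close>

lemma simons:
  "sum4 (\<lambda>i j p m. (C i j p m)\<^sup>2) + (\<Sum>j\<in>I. \<Sum>m\<in>I. (T j m)\<^sup>2) = (n + 1) * c * N"
proof -
  have "0 = (\<Sum>i\<in>I. \<Sum>j\<in>I. 2 * (\<Sum>p\<in>I. \<Sum>m\<in>I. R i j p m * Q i m j p) + (\<Sum>m\<in>I. R i j i m * T j m))"
    by (simp add: semiparallel_contract)
  also have "\<dots> = 2 * sum4 (\<lambda>i j p m. R i j p m * Q i m j p) + (\<Sum>i\<in>I. \<Sum>j\<in>I. \<Sum>m\<in>I. R i j i m * T j m)"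
    by (simp add: sum.distrib sum_distrib_left)
  also have "sum4 (\<lambda>i j p m. R i j p m * Q i m j p)
      = c * sum4 (\<lambda>i j p m. E i j p m * Q i m j p) + sum4 (\<lambda>i j p m. C i j p m * Q i m j p)"
    unfolding sum_distrib_left sum.distrib[symmetric] by (intro sum.cong refl) (simp add: R_eq algebra_simps)
  \<comment> \<open>Pairing with \<open>E\<close> leaves the sum of \<open>Q i i j j\<close>, zero
    by \<open>traceless\<close>, minus the sum of \<open>Q i j j i\<close>.\<close>
  also have "sum4 (\<lambda>i j p m. E i j p m * Q i m j p) = - N"
  proof -
    have "(\<Sum>i\<in>I. \<Sum>j\<in>I. Q i i j j) = 0" by (subst sum.swap) (simp add: Q_trace)
    then show ?thesis unfolding sum_E[of "\<lambda>i j p m. Q i m j p"] by (simp add: sum_subtractf N_def)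
  qed
  also have "(\<Sum>i\<in>I. \<Sum>j\<in>I. \<Sum>m\<in>I. R i j i m * T j m) = c * (1 - n) * N + (\<Sum>j\<in>I. \<Sum>m\<in>I. (T j m)\<^sup>2)"
  proof -
    \<comment> \<open>Tracing the first against the third index gives minus the Ricci tensor, which
      is \<open>c * (n - 1) * kdelta j m - T j m\<close>: by \<open>traceless\<close> only one of
      the two terms of \<open>C\<close> survives.\<close>
    have 1: "(\<Sum>i\<in>I. R i j i m) = c * (1 - n) * kdelta j m + T j m" if jm: "j \<in> I" "m \<in> I" for j m
    proof -
      have "(\<Sum>i\<in>I. R i j i m) = (\<Sum>i\<in>I. c * (kdelta j i * kdelta i m) - c * kdelta j m + Q j i i m - Q i i j m)"
        by (rule sum.cong[OF refl]) (simp add: R_eq jm E_def C_def kdelta_def)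
      also have "\<dots> = c * (\<Sum>i\<in>I. kdelta j i * kdelta i m) - n * (c * kdelta j m) + T j m"
        by (simp add: sum.distrib sum_subtractf Q_trace T_def sum_distrib_left)
      also have "(\<Sum>i\<in>I. kdelta j i * kdelta i m) = kdelta j m" by (rule sum_kdelta[OF fin jm(1)])
      finally show ?thesis by (simp add: algebra_simps)
    qed
    have "(\<Sum>i\<in>I. \<Sum>j\<in>I. \<Sum>m\<in>I. R i j i m * T j m) = (\<Sum>j\<in>I. \<Sum>i\<in>I. \<Sum>m\<in>I. R i j i m * T j m)" by (rule sum.swap)
    also have "\<dots> = (\<Sum>j\<in>I. \<Sum>m\<in>I. \<Sum>i\<in>I. R i j i m * T j m)" by (rule sum.cong[OF refl], rule sum.swap)
    also have "\<dots> = (\<Sum>j\<in>I. \<Sum>m\<in>I. c * (1 - n) * (kdelta j m * T j m) + (T j m)\<^sup>2)"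
      by (intro sum.cong refl) (simp add: sum_distrib_right[symmetric] 1 power2_eq_square distrib_right)
    also have "\<dots> = c * (1 - n) * (\<Sum>j\<in>I. \<Sum>m\<in>I. kdelta j m * T j m) + (\<Sum>j\<in>I. \<Sum>m\<in>I. (T j m)\<^sup>2)"
      by (simp add: sum.distrib sum_distrib_left)
    also have "(\<Sum>j\<in>I. \<Sum>m\<in>I. kdelta j m * T j m) = N"
      unfolding N_eq_T by (intro sum.cong refl sum_kdelta fin)
    finally show ?thesis .
  qed
  \<comment> \<open>The coefficient \<open>n + 1\<close> is composed of 2, from the pairing of
    \<open>E\<close> with \<open>Q\<close>, and \<open>n - 1\<close>, from the Ricci
    contraction.\<close>
  finally show ?thesis unfolding norm_C by (simp add: algebra_simps)
qed

section \<open>Scalar curvature and the Cauchy-Schwarz bounds\<close>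

lemma scalar_curvature_eq: "(\<Sum>i\<in>I. \<Sum>j\<in>I. R i j j i) = c * n * (n - 1) - N"
proof -
  have "(\<Sum>i\<in>I. \<Sum>j\<in>I. R i j j i) = (\<Sum>i\<in>I. \<Sum>j\<in>I. c - c * kdelta i j + Q j j i i - Q i j j i)"
    by (intro sum.cong refl) (auto simp: R_eq E_def C_def kdelta_def)
  also have "\<dots> = n * n * c - c * (\<Sum>i\<in>I. \<Sum>j\<in>I. kdelta i j * 1) + 0 - N"
    by (simp add: sum.distrib sum_subtractf Q_trace N_def sum_distrib_left)
  also have "(\<Sum>i\<in>I. \<Sum>j\<in>I. kdelta i j * 1) = n"
    using sum_kdelta[OF fin, of _ "\<lambda>_. 1"] by simp
  finally show ?thesis by (simp add: algebra_simps)
qed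

text \<open>Pairing a curvature-like tensor with \<open>E\<close> gives twice its scalar curvature,
  which for \<open>C\<close> is \<open>- N\<close>.\<close>

lemma C_E: "sum4 (\<lambda>i j k l. E i j k l * C i j k l) = - 2 * N"
proof -
  have "(\<Sum>i\<in>I. \<Sum>j\<in>I. Q j j i i) = 0" by (simp add: Q_trace)
  moreover have "(\<Sum>i\<in>I. \<Sum>j\<in>I. Q i i j j) = 0" by (subst sum.swap) (simp add: Q_trace)
  moreover have "(\<Sum>i\<in>I. \<Sum>j\<in>I. Q j i i j) = N" unfolding N_def by (rule sum.swap)
  ultimately show ?thesis
    unfolding sum_E by (simp add: C_def sum_subtractf N_def)
qed

lemma E_E: "sum4 (\<lambda>i j k l. (E i j k l)\<^sup>2) = 2 * n * (n - 1)"
proof -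
  have "sum4 (\<lambda>i j k l. (E i j k l)\<^sup>2) = (\<Sum>i\<in>I. \<Sum>j\<in>I. E i j j i - E i j i j)"
    unfolding power2_eq_square by (rule sum_E)
  also have "\<dots> = (\<Sum>i\<in>I. \<Sum>j\<in>I. 2 - 2 * (kdelta i j * 1))"
    by (intro sum.cong refl) (auto simp: E_def kdelta_def)
  also have "\<dots> = 2 * n * n - 2 * n"
    by (simp add: sum_subtractf sum_distrib_left[symmetric]) (use sum_kdelta[OF fin, of _ "\<lambda>_. 1"] in simp)
  finally show ?thesis by (simp add: algebra_simps)
qed

text \<open>The right-hand side is minimal in \<kappa> at \<open>N / (n * (n - 1))\<close>, where
  its nonnegativity is the Cauchy-Schwarz inequality for \<open>C\<close> and \<open>E\<close>.
  Keeping an identity instead of the inequality preserves the equality case.\<close>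

lemma norm_C_E: "sum4 (\<lambda>i j k l. (C i j k l + \<kappa> * E i j k l)\<^sup>2)
   = sum4 (\<lambda>i j k l. (C i j k l)\<^sup>2) - 4 * \<kappa> * N + 2 * \<kappa>\<^sup>2 * n * (n - 1)"
proof -
  have "sum4 (\<lambda>i j k l. (C i j k l + \<kappa> * E i j k l)\<^sup>2)
    = sum4 (\<lambda>i j k l. (C i j k l)\<^sup>2 + 2 * \<kappa> * (E i j k l * C i j k l) + \<kappa>\<^sup>2 * (E i j k l)\<^sup>2)"
    by (intro sum.cong refl) (simp add: power2_eq_square algebra_simps)
  also have "\<dots> = sum4 (\<lambda>i j k l. (C i j k l)\<^sup>2)
     + 2 * \<kappa> * sum4 (\<lambda>i j k l. E i j k l * C i j k l) + \<kappa>\<^sup>2 * sum4 (\<lambda>i j k l. (E i j k l)\<^sup>2)"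
    by (simp only: sum.distrib sum_distrib_left)
  finally show ?thesis unfolding C_E E_E by (simp add: algebra_simps)
qed

text \<open>The square of the trace-free part of \<open>T\<close> is nonnegative; the trace of
  \<open>T\<close> is \<open>N\<close>.\<close>

lemma norm_T: "n * (\<Sum>j\<in>I. \<Sum>m\<in>I. (T j m)\<^sup>2) \<ge> N\<^sup>2"
proof -
  have n: "n > 0" using fin ne by (simp add: card_gt_0_iff)
  have "0 \<le> (\<Sum>j\<in>I. \<Sum>m\<in>I. (T j m - N / n * kdelta j m)\<^sup>2)" by (intro sum_nonneg) auto
  also have "\<dots> = (\<Sum>j\<in>I. \<Sum>m\<in>I. (T j m)\<^sup>2 - 2 * (N / n) * (kdelta j m * T j m) + (N / n)\<^sup>2 * (kdelta j m * 1))"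
    by (intro sum.cong refl) (auto simp: power2_eq_square algebra_simps kdelta_def)
  also have "\<dots> = (\<Sum>j\<in>I. \<Sum>m\<in>I. (T j m)\<^sup>2) - 2 * (N / n) * (\<Sum>j\<in>I. \<Sum>m\<in>I. kdelta j m * T j m)
      + (N / n)\<^sup>2 * (\<Sum>j\<in>I. \<Sum>m\<in>I. kdelta j m * 1)"
    by (simp only: sum.distrib sum_subtractf sum_distrib_left)
  also have "(\<Sum>j\<in>I. \<Sum>m\<in>I. kdelta j m * T j m) = N"
    unfolding N_eq_T by (intro sum.cong refl sum_kdelta fin)
  also have "(\<Sum>i\<in>I. \<Sum>j\<in>I. kdelta i j * 1) = n"
    using sum_kdelta[OF fin, of _ "\<lambda>_. 1"] by simp
  finally show ?thesis using n by (simp add: power2_eq_square field_simps)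
qed

lemma N_eq_norm: "N = (\<Sum>i\<in>I. \<Sum>j\<in>I. \<Sum>t\<in>I. (S i j t)\<^sup>2)"
  unfolding N_def Q_def by (intro sum.cong refl) (simp add: sym12 power2_eq_square)

lemma N_nonneg: "N \<ge> 0"
  unfolding N_eq_norm by (intro sum_nonneg) auto

lemma N_eq_0D: "N = 0 \<Longrightarrow> i \<in> I \<Longrightarrow> j \<in> I \<Longrightarrow> t \<in> I \<Longrightarrow> S i j t = 0"
  unfolding N_eq_norm using fin by (simp add: sum_nonneg_eq_0_iff sum_nonneg)

text \<open>With one index, \<open>traceless\<close> says that the only component is zero. This
  secures \<open>n - 1 > 0\<close> for the divisions in the case
  \<open>N \<noteq> 0\<close>.\<close>

lemma N_eq_0_if_card_1:
  assumes "card I = 1" shows "N = 0"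
proof -
  obtain a where "I = {a}" using assms by (rule card_1_singletonE)
  then have "S i j t = 0" if "i \<in> I" "j \<in> I" "t \<in> I" for i j t
    using traceless[of a] that by auto
  then show ?thesis by (simp add: N_eq_norm)
qed

text \<open>Multiply \<open>simons\<close> by \<open>n * (n - 1)\<close>. The bounds for
  \<open>C\<close> and \<open>T\<close> contribute \<open>2 * N\<^sup>2\<close> and
  \<open>(n - 1) * N\<^sup>2\<close>, together \<open>(n + 1) * N\<^sup>2\<close>, which matches the
  factor \<open>n + 1\<close> on the other side. Thus \<open>(n + 1) * N\<close> splits off and what
  is left is \<open>c * n * (n - 1) - N\<close>, the scalar curvature.\<close>

lemma
  assumes "N \<noteq> 0"
  shows scalar_curvature_nonneg: "(\<Sum>i\<in>I. \<Sum>j\<in>I. R i j j i) \<ge> 0"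
    and norm_R_le: "n * (n - 1) * sum4 (\<lambda>i j k l. (C i j k l + N / (n * (n - 1)) * E i j k l)\<^sup>2)
      \<le> (n + 1) * N * (\<Sum>i\<in>I. \<Sum>j\<in>I. R i j j i)"
    and card_ge_2: "n \<ge> 2"
proof -
  have "card I \<noteq> 1" "card I \<noteq> 0" using N_eq_0_if_card_1 assms fin ne by auto
  then show n: "n \<ge> 2" by linarith
  let ?\<kappa> = "N / (n * (n - 1))"
  let ?C = "\<Sum>i\<in>I. \<Sum>j\<in>I. \<Sum>k\<in>I. \<Sum>l\<in>I. (C i j k l)\<^sup>2"
  let ?T = "\<Sum>j\<in>I. \<Sum>m\<in>I. (T j m)\<^sup>2"
  let ?X = "\<Sum>i\<in>I. \<Sum>j\<in>I. \<Sum>k\<in>I. \<Sum>l\<in>I. (C i j k l + ?\<kappa> * E i j k l)\<^sup>2"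
  have nz: "n \<noteq> 0" "n - 1 \<noteq> 0" "n > 0" "n - 1 > 0" using n by auto
  have "n * (n - 1) * ?X = n * (n - 1) * ?C - 4 * N * N + 2 * N * N"
  proof -
    have "x * y * (z - 4 * (N / (x * y)) * N + 2 * (N / (x * y))\<^sup>2 * x * y) = x * y * z - 4 * N * N + 2 * N * N"
      if "x \<noteq> 0" "y \<noteq> 0" for x y z :: real
      using that by (simp add: field_simps power2_eq_square)
    then show ?thesis unfolding norm_C_E using nz(1,2) by blast
  qed
  moreover have "(n - 1) * (n * ?T) \<ge> (n - 1) * N\<^sup>2" using norm_T nz by (intro mult_left_mono) auto
  moreover have "n * (n - 1) * (?C + ?T) = n * (n - 1) * ((n + 1) * c * N)" unfolding simons ..
  ultimately show le: "n * (n - 1) * ?X \<le> (n + 1) * N * (\<Sum>i\<in>I. \<Sum>j\<in>I. R i j j i)"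
    unfolding scalar_curvature_eq by (simp add: algebra_simps power2_eq_square)
  have "0 \<le> n * (n - 1) * ?X" using nz by (intro mult_nonneg_nonneg sum_nonneg) auto
  with le have "0 \<le> (n + 1) * N * (\<Sum>i\<in>I. \<Sum>j\<in>I. R i j j i)" by linarith
  moreover have "(n + 1) * N > 0" using N_nonneg assms nz by (intro mult_pos_pos) auto
  ultimately show "(\<Sum>i\<in>I. \<Sum>j\<in>I. R i j j i) \<ge> 0" by (simp add: zero_le_mult_iff)
qed

text \<open>If \<open>N = 0\<close>, only \<open>c * E\<close> is left of \<open>R\<close>, and zero
  scalar curvature means \<open>c = 0\<close> or \<open>n = 1\<close>, where \<open>E\<close>
  vanishes. Otherwise \<open>norm_R_le\<close> forces a sum of squares to vanish, and zero scalar
  curvature makes its parameter \<kappa> equal to \<open>c\<close>, so that the vanishing tensor is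
  \<open>R\<close> itself.\<close>

lemma scalar_flat_imp_flat:
  assumes 0: "(\<Sum>i\<in>I. \<Sum>j\<in>I. R i j j i) = 0" and I: "i \<in> I" "j \<in> I" "k \<in> I" "l \<in> I"
  shows "R i j k l = 0"
proof (cases "N = 0")
  case True
  then have "c * n * (n - 1) = 0" using 0 scalar_curvature_eq by simp
  moreover have "n \<noteq> 0" using fin ne by simp
  ultimately consider "c = 0" | "card I = 1" by auto
  then have "c * E i j k l = 0"
  proof cases
    case 2
    then obtain a where "I = {a}" by (rule card_1_singletonE)
    then show ?thesis using I by (simp add: E_def)
  qed simp
  moreover have "C i j k l = 0" using N_eq_0D[OF True] I by (simp add: C_def Q_def)
  ultimately show ?thesis using R_eq[OF I] by simp
next
  case False
  let ?\<kappa> = "N / (n * (n - 1))"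
  let ?X = "\<Sum>i\<in>I. \<Sum>j\<in>I. \<Sum>k\<in>I. \<Sum>l\<in>I. (C i j k l + ?\<kappa> * E i j k l)\<^sup>2"
  have nz: "n > 0" "n - 1 > 0" using card_ge_2[OF False] by auto
  have \<kappa>: "?\<kappa> = c" using 0 scalar_curvature_eq nz by (simp add: field_simps)
  have "n * (n - 1) * ?X \<le> 0" using norm_R_le[OF False] 0 by simp
  then have "?X \<le> 0" using nz by (simp add: mult_le_0_iff)
  then have "?X = 0" by (intro antisym sum_nonneg) auto
  then have "(C i j k l + ?\<kappa> * E i j k l)\<^sup>2 = 0"
    using I fin by (simp add: sum_nonneg_eq_0_iff sum_nonneg)
  then show ?thesis using R_eq[OF I] \<kappa> by simp
qed

end

subsection \<open>Orthogonal frames\<close>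

text \<open>The linear map taking the standard basis to the vectors \<open>e i\<close> is injective
  by orthogonality, hence surjective by dimension.\<close>

lemma orthogonal_expansion:
  fixes e :: "'d::euclidean_space \<Rightarrow> 'd" and ip :: "'d \<Rightarrow> 'd \<Rightarrow> real"
  assumes "bilinear ip" and pos: "\<And>v. v \<noteq> 0 \<Longrightarrow> ip v v > 0"
    and nz: "\<And>i. i \<in> Basis \<Longrightarrow> e i \<noteq> 0"
    and orth: "\<And>i j. i \<in> Basis \<Longrightarrow> j \<in> Basis \<Longrightarrow> i \<noteq> j \<Longrightarrow> ip (e i) (e j) = 0"
  shows "v = (\<Sum>i\<in>Basis. (ip v (e i) / ip (e i) (e i)) *\<^sub>R e i)"
proof -
  let ?T = "\<lambda>x. \<Sum>i\<in>Basis. (x \<bullet> i) *\<^sub>R e i"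
  have lin: "linear ?T"
    by (intro linearI) (simp_all add: inner_add_left scaleR_add_left sum.distrib scaleR_sum_right)
  have l: "linear (\<lambda>x. ip x y)" for y using assms(1) by (simp add: bilinear_def)
  have ipT: "ip (?T x) (e j) = (x \<bullet> j) * ip (e j) (e j)" if j: "j \<in> Basis" for x j
  proof -
    have "ip (?T x) (e j) = (\<Sum>i\<in>Basis. if i = j then (x \<bullet> j) * ip (e j) (e j) else 0)"
      unfolding linear_sum[OF l] by (intro sum.cong refl) (auto simp: linear_cmul[OF l] orth j)
    then show ?thesis using j by simp
  qed
  have "inj ?T"
  proof (rule linear_injective_0[OF lin, THEN iffD2], intro allI impI)
    fix x assume "?T x = 0"
    then have "(x \<bullet> j) * ip (e j) (e j) = 0" if "j \<in> Basis" for j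
      using ipT[OF that, of x] linear_0[OF l, of "e j"] by simp
    then have "x \<bullet> j = 0" if "j \<in> Basis" for j using pos[OF nz[OF that]] that by fastforce
    then show "x = 0" by - (rule euclidean_eqI, simp)
  qed
  from linear_injective_imp_surjective[OF lin this refl] obtain x where x: "v = ?T x" by (rule surjE)
  have "ip v (e i) / ip (e i) (e i) = x \<bullet> i" if "i \<in> Basis" for i
    using ipT[OF that, of x] pos[OF nz[OF that]] x by simp
  then show ?thesis using x by simp
qed

lemma linear_eq_0_on_frame:
  assumes "linear L" "v = (\<Sum>i\<in>I. a i *\<^sub>R e i)" "\<And>i. i \<in> I \<Longrightarrow> L (e i) = 0"
  shows "L v = 0"
  using assms(3) by (simp add: assms(2) linear_sum[OF assms(1)] linear_cmul[OF assms(1)])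

text \<open>Makes the tensoriality of curvature available for the connection of the submanifold
  itself.\<close>

lemma pullback_map_id:
  assumes "smooth_manifold A" "connection_along A A (\<lambda>p. p) conn"
  shows "pullback_map A A (\<lambda>p. p) conn conn"
proof -
  interpret smooth_manifold A by fact
  interpret smooth_manifold_map A A "\<lambda>p. p" by (rule smooth_manifold_map_id)
  show ?thesis by unfold_locales (use assms in \<open>auto simp: pullback_connection_def\<close>)
qed

subsection \<open>Totally real submanifolds with parallel f-structure\<close>

locale totally_real_submanifold = kaehler_map A B \<phi> D amb g J
  for A :: "('b::{second_countable_topology,t2_space}, 'd::euclidean_space) atlas"
    and B :: "('a::{second_countable_topology,t2_space}, 'e::euclidean_space) atlas"
    and \<phi> :: "'b \<Rightarrow> 'a" and D :: "('b \<Rightarrow> 'e) \<Rightarrow> 'b \<Rightarrow> 'd \<Rightarrow> 'e"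
    and amb :: "('a \<Rightarrow> 'e) \<Rightarrow> 'a \<Rightarrow> 'e \<Rightarrow> 'e"
    and g :: "'a \<Rightarrow> 'e \<Rightarrow> 'e \<Rightarrow> real" and J :: "'a \<Rightarrow> 'e \<Rightarrow> 'e" +
  fixes conn :: "('b \<Rightarrow> 'd) \<Rightarrow> 'b \<Rightarrow> 'd \<Rightarrow> 'd" and \<mu> :: real
  assumes space_form: "complex_space_form B g J amb \<mu>"
    and immersion: "immersion A B \<phi>"
    and levi_civita: "levi_civita A (induced_metric A B \<phi> g) conn"
    and totally_real: "totally_real A B \<phi> g J"
    and parallel_f: "parallel_f_structure A B \<phi> g J D"
begin

sublocale con: pullback_map A A "\<lambda>p. p" conn conn
  by (rule pullback_map_id) (use levi_civita dom.smooth_manifold_axioms in \<open>auto simp: levi_civita_def\<close>)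

abbreviation "im \<equiv> induced_metric A B \<phi> g"
abbreviation "vf \<equiv> vector_field A"
abbreviation "\<sigma> \<equiv> second_fundamental_form A B \<phi> conn D"
abbreviation "np \<equiv> normal_part A B \<phi> g"

section \<open>The induced metric and orthogonal frames\<close>

lemma im_eq: "im p v w = g (\<phi> p) (tm p v) (tm p w)"
  by (simp add: induced_metric_def)

lemma tm_inj: "tm p v = tm p w \<Longrightarrow> v = w"
  using immersion unfolding immersion_def inj_def by blast

lemmas tm_simps = linear_add[OF linear_tangent_map] linear_diff[OF linear_tangent_map] linear_cmul[OF linear_tangent_map]
  linear_neg[OF linear_tangent_map] linear_0[OF linear_tangent_map]

lemma bilinear_im: "bilinear (im p)"
  by (simp add: bilinear_def im_eq[abs_def] linear_iff tm_simps g_simps)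

lemma im_sym: "im p v w = im p w v" by (simp add: im_eq g_sym[of _ "tm p v"])

lemma im_pos: "v \<noteq> 0 \<Longrightarrow> im p v v > 0"
  unfolding im_eq by (rule g_pos) (use tm_inj[of p v 0] tm_simps(5) in auto)

lemma J_tm_normal: "g (\<phi> p) (J (\<phi> p) (tm p v)) (tm p w) = 0"
  using totally_real unfolding totally_real_def by blast

lemma J_tm_normal': "g (\<phi> p) (tm p w) (J (\<phi> p) (tm p v)) = 0"
  using J_tm_normal g_sym by metis

lemma vf_smooth_sec: "open U \<Longrightarrow> vf U X \<Longrightarrow> smooth_sec U (\<lambda>q. tm q (X q))"
  by (rule smooth_along_tangent_map)

lemma im_smooth: "open U \<Longrightarrow> vf U X \<Longrightarrow> vf U Y \<Longrightarrow> smooth_fun A U (\<lambda>q. im q (X q) (Y q))"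
  unfolding im_eq by (intro smooth_metric vf_smooth_sec)

text \<open>The fields are nonvanishing but not normalized, so that the Gram-Schmidt process needs
  smooth quotients only and no square roots.\<close>

definition orthogonal_frame_on :: "'b set \<Rightarrow> ('d \<Rightarrow> 'b \<Rightarrow> 'd) \<Rightarrow> bool" where
  "orthogonal_frame_on U e \<longleftrightarrow> (\<forall>i\<in>Basis. vf U (e i)) \<and> (\<forall>q\<in>U. \<forall>i\<in>Basis. e i q \<noteq> 0) \<and>
     (\<forall>q\<in>U. \<forall>i\<in>Basis. \<forall>j\<in>Basis. i \<noteq> j \<longrightarrow> im q (e i q) (e j q) = 0)"

lemma orthogonal_frame_onD:
  assumes "orthogonal_frame_on U e"
  shows "\<And>i. i \<in> Basis \<Longrightarrow> vf U (e i)" "\<And>i q. i \<in> Basis \<Longrightarrow> q \<in> U \<Longrightarrow> e i q \<noteq> 0"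
    "\<And>i j q. i \<in> Basis \<Longrightarrow> j \<in> Basis \<Longrightarrow> i \<noteq> j \<Longrightarrow> q \<in> U \<Longrightarrow> im q (e i q) (e j q) = 0"
  using assms unfolding orthogonal_frame_on_def by auto

text \<open>Gram-Schmidt on the coordinate fields, by induction on a set \<open>F\<close> of basis
  vectors. The invariant that the fields built so far have coordinates in \<open>span F\<close>
  keeps the next one nonzero: its coordinates are a new basis vector minus an element of
  \<open>span F\<close>.\<close>

lemma ex_orthogonal_frame: "\<exists>e. orthogonal_frame_on (chart_dom A p) e"
proof -
  let ?U = "chart_dom A p"
  let ?L = "\<lambda>q. mderiv A (chart A p) q"
  have "\<exists>e :: 'd \<Rightarrow> 'b \<Rightarrow> 'd. (\<forall>i\<in>F. vf ?U (e i)) \<and> (\<forall>q\<in>?U. \<forall>i\<in>F. e i q \<noteq> 0 \<and> ?L q (e i q) \<in> span F) \<and>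
     (\<forall>q\<in>?U. \<forall>i\<in>F. \<forall>j\<in>F. i \<noteq> j \<longrightarrow> im q (e i q) (e j q) = 0)" if "finite F" "F \<subseteq> Basis" for F
    using that
  proof (induction F rule: finite_induct)
    case empty
    then show ?case by simp
  next
    case (insert b F)
    have "F \<subseteq> Basis" using insert(4) by simp
    from insert(3)[OF this] obtain e where E: "(\<forall>i\<in>F. vf ?U (e i)) \<and> (\<forall>q\<in>?U. \<forall>i\<in>F. e i q \<noteq> 0 \<and> ?L q (e i q) \<in> span F) \<and>
     (\<forall>q\<in>?U. \<forall>i\<in>F. \<forall>j\<in>F. i \<noteq> j \<longrightarrow> im q (e i q) (e j q) = 0)" by (rule exE)
    have e: "\<And>i. i \<in> F \<Longrightarrow> vf ?U (e i)"
      "\<And>q i. q \<in> ?U \<Longrightarrow> i \<in> F \<Longrightarrow> e i q \<noteq> 0" "\<And>q i. q \<in> ?U \<Longrightarrow> i \<in> F \<Longrightarrow> ?L q (e i q) \<in> span F"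
      "\<And>q i j. q \<in> ?U \<Longrightarrow> i \<in> F \<Longrightarrow> j \<in> F \<Longrightarrow> i \<noteq> j \<Longrightarrow> im q (e i q) (e j q) = 0"
      using E by auto
    define x where "x = dom.coord p b"
    define a where "a i q = im q (x q) (e i q) * inverse (im q (e i q) (e i q))" for i q
    define y where "y q = x q - (\<Sum>i\<in>F. a i q *\<^sub>R e i q)" for q
    define e' where "e' i = (if i = b then y else e i)" for i
    have x: "vf ?U x" unfolding x_def by (rule dom.vector_field_coord)
    have a: "smooth_fun A ?U (a i)" if "i \<in> F" for i
      unfolding a_def[abs_def]
      by (intro dom.smooth_fun_mult dom.smooth_fun_inverse im_smooth dom.open_chart_dom x e(1) that)
        (use im_pos e(2) that in \<open>metis less_irrefl\<close>)
    have y: "vf ?U y" unfolding y_def[abs_def]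
      by (intro dom.vector_field_diff dom.vector_field_sum dom.vector_field_scale dom.open_chart_dom x a e(1) insert(1))
    have Ly: "?L q (y q) = b - (\<Sum>i\<in>F. a i q *\<^sub>R ?L q (e i q))" if q: "q \<in> ?U" for q
      unfolding y_def x_def
      by (simp add: linear_diff[OF dom.linear_mderiv_chart[OF q]] linear_sum[OF dom.linear_mderiv_chart[OF q]]
          linear_cmul[OF dom.linear_mderiv_chart[OF q]] q)
    have sp: "(\<Sum>i\<in>F. a i q *\<^sub>R ?L q (e i q)) \<in> span F" if "q \<in> ?U" for q
      by (intro span_sum span_scale e(3) that)
    have b: "b \<notin> span F"
      using independent_Basis insert(2,4) span_mono[of F "Basis - {b}"] unfolding dependent_def by blast
    have y0: "y q \<noteq> 0" if q: "q \<in> ?U" for q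
    proof
      assume "y q = 0"
      then have "b = (\<Sum>i\<in>F. a i q *\<^sub>R ?L q (e i q))"
        using Ly[OF q] linear_0[OF dom.linear_mderiv_chart[OF q]] by simp
      then show False using sp[OF q] b by simp
    qed
    have Lsp: "?L q (y q) \<in> span (insert b F)" if q: "q \<in> ?U" for q
      unfolding Ly[OF q] using sp[OF q] span_mono[of F "insert b F"]
      by (intro span_diff) (auto intro: span_base)
    have orth: "im q (y q) (e j q) = 0" if q: "q \<in> ?U" and j: "j \<in> F" for q j
    proof -
      have l: "linear (\<lambda>v. im q v w)" for w using bilinear_im[of q] by (simp add: bilinear_def)
      have "im q (\<Sum>i\<in>F. a i q *\<^sub>R e i q) (e j q) = (\<Sum>i\<in>F. if i = j then a j q * im q (e j q) (e j q) else 0)"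
        unfolding linear_sum[OF l] by (intro sum.cong refl) (auto simp: linear_cmul[OF l] e(4) q j)
      also have "\<dots> = im q (x q) (e j q)"
        using insert(1) j im_pos[OF e(2)[OF q j], of q] by (simp add: a_def)
      finally show ?thesis by (simp add: y_def linear_diff[OF l])
    qed
    have ne: "i \<noteq> b" if "i \<in> F" for i using that insert(2) by blast
    have spF: "span F \<subseteq> span (insert b F)" by (rule span_mono) auto
    show ?case
      by (rule exI[of _ e'])
        (use e(1,2,4) y y0 Lsp orth ne spF e(3) in \<open>auto simp: e'_def im_sym[of _ _ "y _"]\<close>)
  qed
  from this[OF finite_Basis subset_refl] show ?thesis
    unfolding orthogonal_frame_on_def by (elim exE, intro exI) auto
qed

section \<open>Tangential and normal projections\<close>

lemma ex_tangential: "\<exists>v. \<forall>x. g (\<phi> p) (w - tm p v) (tm p x) = 0"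
proof -
  obtain e where e0: "orthogonal_frame_on (chart_dom A p) e" using ex_orthogonal_frame by blast
  note e = orthogonal_frame_onD[OF e0]
  \<comment> \<open>The orthogonal projection of \<open>w\<close> to the tangent space. Its
    existence, with uniqueness in \<open>tangential_part_eqI\<close>, gives the definite description
    \<open>tangential_part\<close> its meaning.\<close>
  define v where "v = (\<Sum>i\<in>Basis. (g (\<phi> p) w (tm p (e i p)) / im p (e i p) (e i p)) *\<^sub>R e i p)"
  have l: "linear (\<lambda>v. im p v w)" for w using bilinear_im[of p] by (simp add: bilinear_def)
  have 1: "g (\<phi> p) (w - tm p v) (tm p (e j p)) = 0" if j: "j \<in> Basis" for j
  proof -
    have "im p v (e j p) = (\<Sum>i\<in>Basis. if i = j then g (\<phi> p) w (tm p (e j p)) else 0)"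
      unfolding v_def linear_sum[OF l]
    proof (intro sum.cong refl)
      fix i :: 'd assume i: "i \<in> Basis"
      have "im p (e i p) (e i p) \<noteq> 0" using im_pos[OF e(2)[OF i dom.chart_dom_mem], of p] by simp
      then show "im p ((g (\<phi> p) w (tm p (e i p)) / im p (e i p) (e i p)) *\<^sub>R e i p) (e j p)
        = (if i = j then g (\<phi> p) w (tm p (e j p)) else 0)"
        by (cases "i = j") (simp_all add: linear_cmul[OF l] e(3) i j)
    qed
    then show ?thesis using j by (simp add: g_simps im_eq)
  qed
  have "g (\<phi> p) (w - tm p v) (tm p x) = 0" for x
  proof (rule linear_eq_0_on_frame[where L = "\<lambda>x. g (\<phi> p) (w - tm p v) (tm p x)"])
    show "linear (\<lambda>x. g (\<phi> p) (w - tm p v) (tm p x))" by (simp add: linear_iff tm_simps g_simps right_diff_distrib)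
    show "x = (\<Sum>i\<in>Basis. (im p x (e i p) / im p (e i p) (e i p)) *\<^sub>R e i p)"
      by (rule orthogonal_expansion[where e = "\<lambda>i. e i p" and ip = "im p", OF bilinear_im im_pos]) (use e in auto)
  qed (rule 1)
  then show ?thesis by blast
qed

lemma tangential_part_eqI:
  assumes "\<And>x. g (\<phi> p) (w - tm p v) (tm p x) = 0"
  shows "tangential_part A B \<phi> g p w = v"
  unfolding tangential_part_def
proof (rule the_equality)
  show "\<forall>x. g (\<phi> p) (w - tm p v) (tm p x) = 0" using assms by blast
next
  fix v' assume v': "\<forall>x. g (\<phi> p) (w - tm p v') (tm p x) = 0"
  have "im p (v' - v) (v' - v) = g (\<phi> p) (w - tm p v) (tm p (v' - v)) - g (\<phi> p) (w - tm p v') (tm p (v' - v))"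
    by (simp add: im_eq tm_simps g_simps)
  also have "\<dots> = 0" using assms v' by simp
  finally show "v' = v" using im_pos[of "v' - v" p] by fastforce
qed

lemma np_normal: "g (\<phi> p) (np p w) (tm p x) = 0"
proof -
  obtain v where v: "\<And>x. g (\<phi> p) (w - tm p v) (tm p x) = 0" using ex_tangential by blast
  show ?thesis unfolding normal_part_def tangential_part_eqI[OF v] by (rule v)
qed

lemma np_decomp: obtains t where "w = tm p t + np p w"
  by (rule that[of "tangential_part A B \<phi> g p w"]) (simp add: normal_part_def)

lemma np_eqI:
  assumes "w = tm p t + u" "\<And>x. g (\<phi> p) u (tm p x) = 0" shows "np p w = u"
proof -
  have "tangential_part A B \<phi> g p w = t" by (rule tangential_part_eqI) (simp add: assms)
  then show ?thesis using assms(1) by (simp add: normal_part_def)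
qed

lemma np_tm: "np p (tm p t) = 0"
  by (rule np_eqI[of _ _ t]) (simp_all add: g_simps)

lemma g_np:
  assumes "\<And>x. g (\<phi> p) u (tm p x) = 0" shows "g (\<phi> p) (np p w) u = g (\<phi> p) w u"
proof -
  obtain t where t: "w = tm p t + np p w" by (rule np_decomp)
  have "g (\<phi> p) w u = g (\<phi> p) (tm p t) u + g (\<phi> p) (np p w) u" by (subst t) (rule g_simps)
  then show ?thesis using assms[of t] g_sym[of _ u] by simp
qed

text \<open>The projection is defined pointwise by a description; smoothness comes from its formula
  in a smooth orthogonal frame.\<close>

lemma smooth_np:
  assumes "open U" "smooth_sec U W" shows "smooth_sec U (\<lambda>q. np q (W q))"
proof (rule smooth_along_local)
  fix p assume p: "p \<in> U"
  let ?U = "U \<inter> chart_dom A p"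
  have U: "open ?U" "p \<in> ?U" using assms(1) p by (auto intro!: open_Int)
  obtain e where e0: "orthogonal_frame_on (chart_dom A p) e" using ex_orthogonal_frame by blast
  note e = orthogonal_frame_onD[OF e0]
  have e': "vf ?U (e i)" if "i \<in> Basis" for i by (rule dom.vector_field_subset[OF e(1)[OF that]]) auto
  let ?a = "\<lambda>i q. g (\<phi> q) (W q) (tm q (e i q)) * inverse (im q (e i q) (e i q))"
  have a: "smooth_fun A ?U (?a i)" if i: "i \<in> Basis" for i
  proof (rule dom.smooth_fun_mult[OF U(1) smooth_metric[OF U(1) smooth_along_subset[OF assms(2)] vf_smooth_sec[OF U(1) e'[OF i]]]
        dom.smooth_fun_inverse[OF U(1) im_smooth[OF U(1) e'[OF i] e'[OF i]]]])
    show "im q (e i q) (e i q) \<noteq> 0" if "q \<in> ?U" for q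
      using im_pos[OF e(2)[OF i], of q q] that by simp
  qed auto
  have s: "smooth_sec ?U (\<lambda>q. W q - (\<Sum>i\<in>Basis. ?a i q *\<^sub>R tm q (e i q)))"
    by (rule smooth_along_diff[OF U(1) smooth_along_subset[OF assms(2)] smooth_along_sum[OF U(1) finite_Basis
          smooth_along_scale[OF U(1) a vf_smooth_sec[OF U(1) e']]]]) auto
  have "smooth_sec ?U (\<lambda>q. np q (W q))"
  proof (rule smooth_along_cong[OF s U(1)])
    fix q assume "q \<in> ?U"
    then have q: "q \<in> chart_dom A p" by simp
    obtain t where t: "W q = tm q t + np q (W q)" by (rule np_decomp)
    have g: "g (\<phi> q) (W q) (tm q (e i q)) = im q t (e i q)" for i
      by (subst t) (simp add: g_simps np_normal im_eq)
    have te: "t = (\<Sum>i\<in>Basis. (im q t (e i q) / im q (e i q) (e i q)) *\<^sub>R e i q)"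
      by (rule orthogonal_expansion[where e = "\<lambda>i. e i q" and ip = "im q", OF bilinear_im im_pos]) (use e q in auto)
    have "tm q t = tm q (\<Sum>i\<in>Basis. (im q t (e i q) / im q (e i q) (e i q)) *\<^sub>R e i q)"
      by (rule arg_cong[OF te])
    also have "\<dots> = (\<Sum>i\<in>Basis. ?a i q *\<^sub>R tm q (e i q))"
      by (simp add: g divide_inverse linear_sum[OF linear_tangent_map] tm_simps(3))
    finally have tq: "tm q t = (\<Sum>i\<in>Basis. ?a i q *\<^sub>R tm q (e i q))" .
    show "W q - (\<Sum>i\<in>Basis. ?a i q *\<^sub>R tm q (e i q)) = np q (W q)"
      unfolding tq[symmetric] diff_eq_eq by (rule trans[OF t add.commute])
  qed
  then show "\<exists>V. open V \<and> p \<in> V \<and> smooth_sec V (\<lambda>q. np q (W q))" using U by blast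
qed

section \<open>The second fundamental form\<close>

lemma conn_smooth: "open U \<Longrightarrow> vf U Y \<Longrightarrow> vf U X \<Longrightarrow> vf U (\<lambda>q. conn Y q (X q))"
  using con.D_smooth[of U Y X] by (simp add: vector_field_def)

lemma conn_linear: "open U \<Longrightarrow> vf U Y \<Longrightarrow> p \<in> U \<Longrightarrow> linear (conn Y p)"
  using con.D_linear[of U Y p] by (simp add: vector_field_def)

lemma conn_metric:
  "open U \<Longrightarrow> vf U X \<Longrightarrow> vf U Y \<Longrightarrow> p \<in> U
    \<Longrightarrow> mderiv A (\<lambda>q. im q (X q) (Y q)) p v = im p (conn X p v) (Y p) + im p (X p) (conn Y p v)"
  and conn_torsion: "open U \<Longrightarrow> vf U X \<Longrightarrow> vf U Y \<Longrightarrow> p \<in> U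
    \<Longrightarrow> conn Y p (X p) - conn X p (Y p) = lie_bracket A X Y p"
  using levi_civita unfolding levi_civita_def by blast+

lemma D_tm: "D (\<lambda>q. tm q (Y q)) p (X p) = tm p (conn Y p (X p)) + \<sigma> X Y p"
  by (simp add: second_fundamental_form_def)

lemma \<sigma>_sym:
  assumes "open U" "vf U X" "vf U Y" "p \<in> U" shows "\<sigma> X Y p = \<sigma> Y X p"
  using D_torsion[OF assms] conn_torsion[OF assms, symmetric] unfolding D_tm by (simp add: tm_simps algebra_simps)

text \<open>Uniqueness of the Levi-Civita connection: the tangential part of \<open>\<sigma>\<close> is symmetric in two
  arguments and skew in two arguments.\<close>

lemma \<sigma>_normal_field:
  assumes "open U" "vf U X" "vf U Y" "vf U Z" "p \<in> U"
  shows "g (\<phi> p) (\<sigma> X Y p) (tm p (Z p)) = 0"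
proof -
  let ?h = "\<lambda>X Y Z. g (\<phi> p) (\<sigma> X Y p) (tm p (Z p))"
  have skew: "?h X Y Z = - ?h X Z Y" if "vf U X" "vf U Y" "vf U Z" for X Y Z
  proof -
    have "mderiv A (\<lambda>q. im q (Y q) (Z q)) p (X p) = im p (conn Y p (X p)) (Z p) + im p (Y p) (conn Z p (X p))"
      by (rule conn_metric) (use that assms in auto)
    moreover have "mderiv A (\<lambda>q. im q (Y q) (Z q)) p (X p)
      = g (\<phi> p) (D (\<lambda>q. tm q (Y q)) p (X p)) (tm p (Z p)) + g (\<phi> p) (tm p (Y p)) (D (\<lambda>q. tm q (Z q)) p (X p))"
      unfolding im_eq by (rule D_metric[OF assms(1,5)]) (intro vf_smooth_sec that assms)+
    ultimately show ?thesis
      unfolding D_tm im_eq using g_sym[of _ "tm p (Y p)" "\<sigma> X Z p"] by (simp add: g_simps)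
  qed
  have sym: "?h X Y Z = ?h Y X Z" if "vf U X" "vf U Y" for X Y Z
    using \<sigma>_sym[OF assms(1) that assms(5)] by simp
  note v = assms(2-4)
  show ?thesis
    using skew[OF v(1,2,3)] sym[OF v(1,3), of Y] skew[OF v(3,1,2)] sym[OF v(3,2), of X] skew[OF v(2,3,1)] sym[OF v(2,1), of Z]
    by linarith
qed

lemma \<sigma>_normal:
  assumes "open U" "vf U X" "vf U Y" "p \<in> U"
  shows "g (\<phi> p) (\<sigma> X Y p) (tm p z) = 0"
proof -
  let ?U = "U \<inter> chart_dom A p"
  have U: "open ?U" "p \<in> ?U" using assms by (auto intro!: open_Int)
  have "vf ?U X" "vf ?U Y" "vf ?U (dom.coord p z)"
    using dom.vector_field_subset assms dom.vector_field_coord by blast+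
  from \<sigma>_normal_field[OF U(1) this U(2)] show ?thesis by simp
qed

lemma \<sigma>_smooth:
  assumes "open U" "vf U X" "vf U Y" shows "smooth_sec U (\<sigma> X Y)"
  unfolding second_fundamental_form_def[abs_def]
  by (intro smooth_along_diff D_smooth vf_smooth_sec conn_smooth assms)

text \<open>Differentiate the totally real condition for \<open>Y\<close> and \<open>J Z\<close>
  along \<open>X\<close> and move \<open>J\<close> across the metric. Since \<open>J\<close> maps
  tangent vectors to normal ones, only the \<sigma> terms survive.\<close>

lemma \<sigma>_J_sym:
  assumes "open U" "vf U X" "vf U Y" "vf U Z" "p \<in> U"
  shows "g (\<phi> p) (\<sigma> X Y p) (J (\<phi> p) (tm p (Z p))) = g (\<phi> p) (\<sigma> X Z p) (J (\<phi> p) (tm p (Y p)))"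
proof -
  note s = vf_smooth_sec[OF assms(1)]
  have "0 = mderiv A (\<lambda>q. g (\<phi> q) (tm q (Y q)) (J (\<phi> q) (tm q (Z q)))) p (X p)"
    by (simp add: J_tm_normal')
  also have "\<dots> = g (\<phi> p) (D (\<lambda>q. tm q (Y q)) p (X p)) (J (\<phi> p) (tm p (Z p)))
      + g (\<phi> p) (tm p (Y p)) (D (\<lambda>q. J (\<phi> q) (tm q (Z q))) p (X p))"
    by (rule D_metric[OF assms(1,5) s[OF assms(3)] smooth_J[OF assms(1) s[OF assms(4)]]])
  also have "D (\<lambda>q. J (\<phi> q) (tm q (Z q))) p (X p) = J (\<phi> p) (D (\<lambda>q. tm q (Z q)) p (X p))"
    by (rule D_J[OF assms(1,5) s[OF assms(4)]])
  finally show ?thesis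
    unfolding D_tm using J_skew[of "\<phi> p" "\<sigma> X Z p" "tm p (Y p)"] g_sym[of "\<phi> p" "tm p (Y p)" "J (\<phi> p) (\<sigma> X Z p)"]
    by (simp add: g_simps J_tm_normal' linear_add[OF J_linear])
qed

text \<open>The field \<open>J Y\<close> has \<open>f (J Y) = 0\<close>, because
  \<open>J (J Y) = - Y\<close> is tangent. Parallelity therefore makes \<open>f\<close> vanish on
  the normal derivative of \<open>J Y\<close>, which is
  \<open>J (conn Y p (X p)) + f \<sigma>\<close>. So \<open>J (f \<sigma>)\<close> is tangent, and
  \<open>f \<sigma>\<close> lies in \<open>J TM\<close>. Applying \<open>J\<close> to the
  decomposition of \<open>J \<sigma>\<close> writes \<sigma> as a vector of \<open>J TM\<close> plus
  a tangent vector.\<close>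

lemma \<sigma>_in_J_tangent:
  assumes "open U" "vf U X" "vf U Y" "p \<in> U"
  obtains t where "\<sigma> X Y p = J (\<phi> p) (tm p t)"
proof -
  let ?\<xi> = "\<lambda>q. J (\<phi> q) (tm q (Y q))"
  let ?s = "\<sigma> X Y p" and ?a = "conn Y p (X p)" and ?J = "J (\<phi> p)"
  have nf: "normal_field A B \<phi> g U ?\<xi>"
    unfolding normal_field_def using smooth_J[OF assms(1) vf_smooth_sec[OF assms(1,3)]] by (simp add: J_tm_normal)
  have f0: "f_structure A B \<phi> g J q (?\<xi> q) = 0" for q
    using np_tm[of q "- Y q"] by (simp add: f_structure_def J_J tm_simps)
  have np0: "np p 0 = 0" using np_tm[of p 0] by (simp add: tm_simps)
  have "np p (?J (np p (D ?\<xi> p (X p)))) = 0"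
  proof -
    have f0': "(\<lambda>q. f_structure A B \<phi> g J q (?\<xi> q)) = (\<lambda>q. 0)" by (rule ext) (rule f0)
    show ?thesis
      using parallel_f[unfolded parallel_f_structure_def, rule_format, OF conjI[OF assms(1) nf] assms(4), of "X p"]
      unfolding f0' unfolding normal_connection_def D_zero np0 f_structure_def by simp
  qed
  moreover have "D ?\<xi> p (X p) = ?J (tm p ?a) + ?J ?s"
    unfolding D_J[OF assms(1,4) vf_smooth_sec[OF assms(1,3)]] D_tm by (rule linear_add[OF J_linear])
  moreover obtain t where t: "?J ?s = tm p t + np p (?J ?s)" by (rule np_decomp)
  moreover have "np p (?J (tm p ?a) + ?J ?s) = ?J (tm p ?a) + np p (?J ?s)"
    by (rule np_eqI[of _ _ t]) (use t in \<open>simp_all add: g_simps J_tm_normal np_normal algebra_simps\<close>)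
  ultimately have 0: "np p (- tm p ?a + ?J (np p (?J ?s))) = 0"
    by (simp add: linear_add[OF J_linear] J_J)
  \<comment> \<open>The normal part being zero, this vector is tangent.\<close>
  obtain r' where "- tm p ?a + ?J (np p (?J ?s)) = tm p r' + np p (- tm p ?a + ?J (np p (?J ?s)))" by (rule np_decomp)
  then have Ju: "?J (np p (?J ?s)) = tm p (r' + ?a)" unfolding 0 by (simp add: tm_simps algebra_simps)
  have u: "np p (?J ?s) = - ?J (tm p (r' + ?a))"
    using J_J[of "\<phi> p" "np p (?J ?s)", unfolded Ju] by simp
  have Js: "?J ?s = tm p t + - ?J (tm p (r' + ?a))" using t unfolding u .
  have "- ?s = ?J (tm p t + - ?J (tm p (r' + ?a)))" using J_J[of "\<phi> p" ?s, unfolded Js] by (rule sym)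
  also have "\<dots> = ?J (tm p t) + tm p (r' + ?a)"
    by (simp only: linear_add[OF J_linear] linear_neg[OF J_linear] J_J minus_minus)
  finally have s: "?s = - ?J (tm p t) - tm p (r' + ?a)"
    by (simp only: minus_equation_iff[of ?s] minus_add_distrib[symmetric] diff_conv_add_uminus)
  \<comment> \<open>As \<sigma> is normal, its tangent component is orthogonal to itself and
    vanishes.\<close>
  have "g (\<phi> p) (tm p (r' + ?a)) (tm p (r' + ?a)) = 0"
    using \<sigma>_normal[OF assms, of "r' + ?a"] unfolding s by (simp add: g_simps J_tm_normal)
  then have "tm p (r' + ?a) = 0" by (simp add: g_eq_0_iff)
  then show thesis using that[of "- t"] s by (simp add: tm_simps linear_neg[OF J_linear])
qed

lemma J_\<sigma>_tangent:
  assumes "open U" "vf U X" "vf U Y" "p \<in> U" and u: "\<And>x. g (\<phi> p) u (tm p x) = 0"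
  shows "g (\<phi> p) u (J (\<phi> p) (\<sigma> X Y p)) = 0"
proof -
  obtain t where "\<sigma> X Y p = J (\<phi> p) (tm p t)" by (rule \<sigma>_in_J_tangent[OF assms(1-4)])
  then show ?thesis using u[of t] by (simp add: J_J g_simps)
qed

text \<open>In the first argument tensoriality is just linearity of both connections in the
  direction. The second argument is reached through \<open>\<sigma>_sym\<close>.\<close>

lemma \<sigma>_expansion_left:
  assumes "open U" "\<And>i. i \<in> I \<Longrightarrow> vf U (X i)" "vf U Y" "p \<in> U" "finite I" "Z p = (\<Sum>i\<in>I. a i *\<^sub>R X i p)"
  shows "\<sigma> Z Y p = (\<Sum>i\<in>I. a i *\<^sub>R \<sigma> (X i) Y p)"
proof -
  have l: "linear (D (\<lambda>q. tm q (Y q)) p)" "linear (conn Y p)"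
    by (rule D_linear[OF assms(1) vf_smooth_sec[OF assms(1,3)] assms(4)], rule conn_linear[OF assms(1,3,4)])
  show ?thesis
    unfolding second_fundamental_form_def assms(6)
    by (simp add: linear_sum[OF l(1)] linear_cmul[OF l(1)] linear_sum[OF l(2)] linear_cmul[OF l(2)]
        linear_sum[OF linear_tangent_map] tm_simps scaleR_diff_right sum_subtractf)
qed

section \<open>Gauss, Weingarten and Ricci equations\<close>

lemma gauss_tangential:
  assumes "open U" "vf U V" "vf U X" "vf U W" "p \<in> U"
  shows "g (\<phi> p) (D (\<lambda>q. tm q (V q)) p (X p)) (tm p (W p)) = im p (conn V p (X p)) (W p)"
  unfolding D_tm by (simp add: g_simps \<sigma>_normal[OF assms(1,3,2,5)] im_eq)

lemma weingarten:
  assumes "open U" "vf U X" "vf U W" "p \<in> U" "smooth_sec U \<xi>" "\<And>q x. q \<in> U \<Longrightarrow> g (\<phi> q) (\<xi> q) (tm q x) = 0"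
  shows "g (\<phi> p) (D \<xi> p (X p)) (tm p (W p)) = - g (\<phi> p) (\<xi> p) (\<sigma> X W p)"
proof -
  have "mderiv A (\<lambda>q. g (\<phi> q) (\<xi> q) (tm q (W q))) p (X p) = mderiv A (\<lambda>q. 0) p (X p)"
    by (rule dom.mderiv_cong[OF assms(1,4)]) (rule assms(6))
  then have "g (\<phi> p) (D \<xi> p (X p)) (tm p (W p)) + g (\<phi> p) (\<xi> p) (D (\<lambda>q. tm q (W q)) p (X p)) = 0"
    using D_metric[OF assms(1,4,5) vf_smooth_sec[OF assms(1,3)], of "X p"] by simp
  then show ?thesis unfolding D_tm by (simp add: g_simps assms(6)[OF assms(4)])
qed

text \<open>Each inner derivative of \<open>tm Z\<close> splits into \<open>conn\<close> and
  \<sigma>; the derivative of the \<sigma> part is tested against a tangent field by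
  \<open>weingarten\<close>.\<close>

lemma gauss_D:
  assumes "open U" "vf U X" "vf U Y" "vf U Z" "vf U W" "p \<in> U"
  shows "g (\<phi> p) (curvature A D X Y (\<lambda>q. tm q (Z q)) p) (tm p (W p))
    = im p (curvature A conn X Y Z p) (W p) - g (\<phi> p) (\<sigma> Y Z p) (\<sigma> X W p) + g (\<phi> p) (\<sigma> X Z p) (\<sigma> Y W p)"
proof -
  note br = dom.vector_field_lie_bracket[OF assms(1-3)]
  have *: "g (\<phi> p) (D (\<lambda>q. D (\<lambda>q. tm q (Z q)) q (Y q)) p (X p)) (tm p (W p))
    = im p (conn (\<lambda>q. conn Z q (Y q)) p (X p)) (W p) - g (\<phi> p) (\<sigma> Y Z p) (\<sigma> X W p)"
    if "vf U X" "vf U Y" for X Y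
  proof -
    note c = conn_smooth[OF assms(1,4) that(2)]
    note s = \<sigma>_smooth[OF assms(1) that(2) assms(4)]
    have "D (\<lambda>q. D (\<lambda>q. tm q (Z q)) q (Y q)) p (X p) = D (\<lambda>q. tm q (conn Z q (Y q))) p (X p) + D (\<sigma> Y Z) p (X p)"
      unfolding D_tm by (rule D_add[OF assms(1) vf_smooth_sec[OF assms(1) c] s assms(6)])
    then show ?thesis
      using weingarten[OF assms(1) that(1) assms(5,6) s \<sigma>_normal[OF assms(1) that(2) assms(4)]]
        gauss_tangential[OF assms(1) c that(1) assms(5,6)] by (simp add: g_simps)
  qed
  show ?thesis
    unfolding curvature_def
    using *[OF assms(2,3)] *[OF assms(3,2)] gauss_tangential[OF assms(1,4) br assms(5,6)]
    by (simp add: g_simps bilinear_lsub[OF bilinear_im])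
qed

text \<open>On a totally real subspace the ambient curvature looks like constant curvature \<mu>/4,
  which is the constant of the cubic form.\<close>

lemma gauss:
  assumes "open U" "vf U X" "vf U Y" "vf U Z" "vf U W" "p \<in> U"
  shows "im p (curvature A conn X Y Z p) (W p)
    = \<mu> / 4 * (im p (Y p) (Z p) * im p (X p) (W p) - im p (X p) (Z p) * im p (Y p) (W p))
      + (g (\<phi> p) (\<sigma> Y Z p) (\<sigma> X W p) - g (\<phi> p) (\<sigma> X Z p) (\<sigma> Y W p))"
proof -
  interpret sf: space_form B g J amb \<mu> by unfold_locales (rule space_form)
  interpret K: hol_curvature "\<lambda>x y z w. g (\<phi> p) (curv_tensor B amb (\<phi> p) x y z) w" "g (\<phi> p)" "J (\<phi> p)" \<mu>
    by (rule sf.hol_curvature)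
  have c: "curvature A D X Y (\<lambda>q. tm q (Z q)) p = curv_tensor B amb (\<phi> p) (tm p (X p)) (tm p (Y p)) (tm p (Z p))"
    by (rule curvature_eq_curv_tensor[OF assms(1-3) vf_smooth_sec[OF assms(1,4)] assms(6)])
  have k: "g (\<phi> p) (curv_tensor B amb (\<phi> p) (tm p (X p)) (tm p (Y p)) (tm p (Z p))) (tm p (W p))
    = \<mu> / 4 * (im p (Y p) (Z p) * im p (X p) (W p) - im p (X p) (Z p) * im p (Y p) (W p))"
    unfolding im_eq by (rule K.totally_real_curvature) (rule J_tm_normal')+
  show ?thesis using gauss_D[OF assms, unfolded c k] by linarith
qed

text \<open>As \<open>J \<sigma>\<close> is tangent, the normal derivative of \<open>J V\<close> is
  \<open>J\<close> applied to the Levi-Civita derivative of \<open>V\<close>. Hence \<open>R\<close>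
  acts on \<open>V\<close> dually to the action of the normal curvature on \<sigma>, whence the
  minus sign; the ambient curvature does not enter.\<close>

lemma ricci:
  assumes "open U" "vf U X" "vf U Y" "vf U Z" "vf U W" "vf U V" "p \<in> U"
  shows "g (\<phi> p) (curvature A (normal_connection A B \<phi> g D) X Y (\<sigma> Z W) p) (J (\<phi> p) (tm p (V p)))
    = - g (\<phi> p) (\<sigma> Z W p) (J (\<phi> p) (tm p (curvature A conn X Y V p)))"
proof -
  define h where "h V q = g (\<phi> q) (\<sigma> Z W q) (J (\<phi> q) (tm q (V q)))" for V q
  note s = \<sigma>_smooth[OF assms(1,4,5)]
  note eta = smooth_J[OF assms(1) vf_smooth_sec[OF assms(1)]]
  have h: "smooth_fun A U (h V)" if "vf U V" for V
    unfolding h_def[abs_def] by (rule smooth_metric[OF assms(1) s eta[OF that]])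
  have D_eta: "D (\<lambda>q. J (\<phi> q) (tm q (V q))) q (X q) = J (\<phi> q) (tm q (conn V q (X q))) + J (\<phi> q) (\<sigma> X V q)"
    if "q \<in> U" "vf U V" for q and X V :: "'b \<Rightarrow> 'd"
    unfolding D_J[OF assms(1) that(1) vf_smooth_sec[OF assms(1) that(2)]] D_tm by (rule linear_add[OF J_linear])
  have D_\<xi>: "g (\<phi> q) (D (\<sigma> Z W) q (Y q)) (J (\<phi> q) (tm q (V q))) = mderiv A (h V) q (Y q) - h (\<lambda>q. conn V q (Y q)) q"
    if q: "q \<in> U" and V: "vf U V" and Y: "vf U Y" for q V Y
  proof -
    have "mderiv A (h V) q (Y q) = g (\<phi> q) (D (\<sigma> Z W) q (Y q)) (J (\<phi> q) (tm q (V q)))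
       + g (\<phi> q) (\<sigma> Z W q) (D (\<lambda>q. J (\<phi> q) (tm q (V q))) q (Y q))"
      unfolding h_def[abs_def] by (rule D_metric[OF assms(1) q s eta[OF V]])
    then show ?thesis
      unfolding D_eta[OF q V] h_def
      using J_\<sigma>_tangent[OF assms(1) Y V q \<sigma>_normal[OF assms(1,4,5) q]] by (simp add: g_simps)
  qed
  have np_\<xi>: "g (\<phi> q) (np q (D (\<sigma> Z W) q (Y q))) (J (\<phi> q) (tm q (V q))) = mderiv A (h V) q (Y q) - h (\<lambda>q. conn V q (Y q)) q"
    if "q \<in> U" "vf U V" "vf U Y" for q V Y
    unfolding D_\<xi>[OF that, symmetric] by (rule g_np) (rule J_tm_normal)
  \<comment> \<open>The two terms with a single outer derivative of \<open>h\<close> are exchanged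
    when \<open>X\<close> and \<open>Y\<close> are, so they drop out of the curvature; the iterated
    derivatives of \<open>h V\<close> give its derivative along the bracket.\<close>
  have DD: "g (\<phi> p) (np p (D (\<lambda>q. np q (D (\<sigma> Z W) q (Y q))) p (X p))) (J (\<phi> p) (tm p (V p)))
    = mderiv A (\<lambda>q. mderiv A (h V) q (Y q)) p (X p) - mderiv A (h (\<lambda>q. conn V q (Y q))) p (X p)
      - (mderiv A (h (\<lambda>q. conn V q (X q))) p (Y p) - h (\<lambda>q. conn (\<lambda>q. conn V q (X q)) q (Y q)) p)"
    if X: "vf U X" and Y: "vf U Y" for X Y
  proof -
    let ?\<zeta> = "\<lambda>q. np q (D (\<sigma> Z W) q (Y q))"
    note z = smooth_np[OF assms(1) D_smooth[OF assms(1) s Y]]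
    note cX = conn_smooth[OF assms(1,6) X] and cY = conn_smooth[OF assms(1,6) Y]
    have "g (\<phi> p) (np p (D ?\<zeta> p (X p))) (J (\<phi> p) (tm p (V p))) = g (\<phi> p) (D ?\<zeta> p (X p)) (J (\<phi> p) (tm p (V p)))"
      by (rule g_np) (rule J_tm_normal)
    also have "\<dots> = mderiv A (\<lambda>q. g (\<phi> q) (?\<zeta> q) (J (\<phi> q) (tm q (V q)))) p (X p)
       - g (\<phi> p) (?\<zeta> p) (D (\<lambda>q. J (\<phi> q) (tm q (V q))) p (X p))"
      using D_metric[OF assms(1,7) z eta[OF assms(6)], of "X p"] by simp
    also have "g (\<phi> p) (?\<zeta> p) (D (\<lambda>q. J (\<phi> q) (tm q (V q))) p (X p)) = g (\<phi> p) (?\<zeta> p) (J (\<phi> p) (tm p (conn V p (X p))))"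
      unfolding D_eta[OF assms(7,6)] using J_\<sigma>_tangent[OF assms(1) X assms(6,7) np_normal] by (simp add: g_simps)
    also have "\<dots> = mderiv A (h (\<lambda>q. conn V q (X q))) p (Y p) - h (\<lambda>q. conn (\<lambda>q. conn V q (X q)) q (Y q)) p"
      by (rule np_\<xi>[OF assms(7) cX Y])
    also have "mderiv A (\<lambda>q. g (\<phi> q) (?\<zeta> q) (J (\<phi> q) (tm q (V q)))) p (X p)
      = mderiv A (\<lambda>q. mderiv A (h V) q (Y q) - h (\<lambda>q. conn V q (Y q)) q) p (X p)"
      by (rule dom.mderiv_cong[OF assms(1,7)]) (rule np_\<xi>[OF _ assms(6) Y])
    also have "\<dots> = mderiv A (\<lambda>q. mderiv A (h V) q (Y q)) p (X p) - mderiv A (h (\<lambda>q. conn V q (Y q))) p (X p)"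
      by (rule dom.mderiv_diff[OF assms(1) dom.smooth_fun_mderiv[OF assms(1) h[OF assms(6)] Y] h[OF cY] assms(7)])
    finally show ?thesis .
  qed
  have br: "g (\<phi> p) (np p (D (\<sigma> Z W) p (lie_bracket A X Y p))) (J (\<phi> p) (tm p (V p)))
     = mderiv A (h V) p (lie_bracket A X Y p) - h (\<lambda>q. conn V q (lie_bracket A X Y q)) p"
    by (rule np_\<xi>[OF assms(7,6) dom.vector_field_lie_bracket[OF assms(1-3)]])
  have lin_h: "h (curvature A conn X Y V) p = h (\<lambda>q. conn (\<lambda>q. conn V q (Y q)) q (X q)) p
      - h (\<lambda>q. conn (\<lambda>q. conn V q (X q)) q (Y q)) p - h (\<lambda>q. conn V q (lie_bracket A X Y q)) p"
    by (simp add: h_def curvature_def tm_simps linear_diff[OF J_linear] g_simps)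
  have "g (\<phi> p) (curvature A (normal_connection A B \<phi> g D) X Y (\<sigma> Z W) p) (J (\<phi> p) (tm p (V p))) = - h (curvature A conn X Y V) p"
    unfolding lin_h curvature_def normal_connection_def
    using DD[OF assms(2,3)] DD[OF assms(3,2)] br dom.mderiv_lie_bracket[OF assms(1) h[OF assms(6)] assms(2,3,7)]
    by (simp add: g_simps)
  then show ?thesis by (simp add: h_def)
qed

section \<open>Orthonormal frames at a point\<close>

lemma ex_orthonormal_at: "\<exists>e. orthonormal_at A im p e"
proof -
  obtain e where e0: "orthogonal_frame_on (chart_dom A p) e" using ex_orthogonal_frame by blast
  note e = orthogonal_frame_onD[OF e0]
  \<comment> \<open>Constant factors computed at \<open>p\<close> suffice, since orthonormality is
    required at \<open>p\<close> only.\<close>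
  define c where "c i = inverse (sqrt (im p (e i p) (e i p)))" for i
  have "im p (c i *\<^sub>R e i p) (c j *\<^sub>R e j p) = (if i = j then 1 else 0)" if ij: "i \<in> Basis" "j \<in> Basis" for i j
  proof (cases "i = j")
    case True
    have "im p (e j p) (e j p) > 0" by (rule im_pos[OF e(2)]) (use ij in auto)
    then show ?thesis
      using True by (simp add: bilinear_lmul[OF bilinear_im] bilinear_rmul[OF bilinear_im] c_def field_simps)
  next
    case False
    then show ?thesis using e(3) ij by (simp add: bilinear_lmul[OF bilinear_im] bilinear_rmul[OF bilinear_im])
  qed
  then have "orthonormal_at A im p (\<lambda>i q. c i *\<^sub>R e i q)"
    unfolding orthonormal_at_def
    by (intro conjI exI[of _ "chart_dom A p"] ballI dom.open_chart_dom dom.chart_dom_mem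
        dom.vector_field_cscale[OF dom.open_chart_dom e(1)]) auto
  then show ?thesis by blast
qed

lemma orthonormal_frame: "orthonormal_at A im p (frame A im p)"
  unfolding frame_def by (rule someI_ex[OF ex_orthonormal_at])

lemma orthonormal_at_expansion:
  assumes "orthonormal_at A im p e" shows "v = (\<Sum>i\<in>Basis. im p v (e i p) *\<^sub>R e i p)"
proof -
  have o: "im p (e i p) (e j p) = (if i = j then 1 else 0)" if "i \<in> Basis" "j \<in> Basis" for i j
    using assms that unfolding orthonormal_at_def by blast
  have nz: "e i p \<noteq> 0" if "i \<in> Basis" for i
    using o[OF that that] bilinear_lzero[OF bilinear_im, of p] by auto
  have "v = (\<Sum>i\<in>Basis. (im p v (e i p) / im p (e i p) (e i p)) *\<^sub>R e i p)"
    by (rule orthogonal_expansion[where e = "\<lambda>i. e i p" and ip = "im p", OF bilinear_im im_pos]) (use nz o in auto)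
  then show ?thesis by (simp add: o)
qed

text \<open>Parseval's identity: the vectors \<open>J (tm e_m)\<close> form an orthonormal basis of
  \<open>J TM\<close>, where \<sigma> takes its values, so the component of \<open>w\<close>
  orthogonal to \<open>J TM\<close> does not contribute.\<close>

lemma g_\<sigma>_expansion:
  assumes "orthonormal_at A im p e" "open U" "vf U X" "vf U Y" "p \<in> U"
  shows "g (\<phi> p) (\<sigma> X Y p) w = (\<Sum>m\<in>Basis. g (\<phi> p) (\<sigma> X Y p) (J (\<phi> p) (tm p (e m p))) * g (\<phi> p) w (J (\<phi> p) (tm p (e m p))))"
proof -
  obtain t where t: "\<sigma> X Y p = J (\<phi> p) (tm p t)" by (rule \<sigma>_in_J_tangent[OF assms(2-5)])
  have im: "g (\<phi> p) (\<sigma> X Y p) (J (\<phi> p) (tm p (e m p))) = im p t (e m p)" for m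
    unfolding t by (simp add: g_J im_eq)
  have "\<sigma> X Y p = (\<Sum>m\<in>Basis. im p t (e m p) *\<^sub>R J (\<phi> p) (tm p (e m p)))"
    unfolding t by (subst orthonormal_at_expansion[OF assms(1), of t])
      (simp add: linear_sum[OF linear_tangent_map] linear_sum[OF J_linear] tm_simps linear_cmul[OF J_linear])
  then have "g (\<phi> p) (\<sigma> X Y p) w = g (\<phi> p) (\<Sum>m\<in>Basis. im p t (e m p) *\<^sub>R J (\<phi> p) (tm p (e m p))) w" by simp
  also have "\<dots> = (\<Sum>m\<in>Basis. im p t (e m p) * g (\<phi> p) w (J (\<phi> p) (tm p (e m p))))"
    by (simp add: linear_sum[OF g_linear_left] g_simps g_sym[of "\<phi> p" w])
  finally show ?thesis unfolding im .
qed

end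

section \<open>The cubic form at a point and its consequences\<close>

context totally_real_submanifold
begin

lemma vf_curvature:
  assumes "open U" "vf U X" "vf U Y" "vf U Z"
  shows "vf U (curvature A conn X Y Z)"
  unfolding curvature_def[abs_def]
  by (intro dom.vector_field_diff conn_smooth dom.vector_field_lie_bracket assms)

abbreviation ob :: "'b \<Rightarrow> 'd \<Rightarrow> 'b \<Rightarrow> 'd" where "ob \<equiv> frame A im"

abbreviation cub :: "'b \<Rightarrow> 'd \<Rightarrow> 'd \<Rightarrow> 'd \<Rightarrow> real" where
  "cub p i j k \<equiv> g (\<phi> p) (\<sigma> (ob p i) (ob p j) p) (J (\<phi> p) (tm p (ob p k p)))"

abbreviation Riem :: "'b \<Rightarrow> 'd \<Rightarrow> 'd \<Rightarrow> 'd \<Rightarrow> 'd \<Rightarrow> real" where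
  "Riem p i j k l \<equiv> im p (curvature A conn (ob p i) (ob p j) (ob p k) p) (ob p l p)"

lemma ob_fields:
  obtains U where "open U" "p \<in> U" "\<And>i. i \<in> Basis \<Longrightarrow> vf U (ob p i)"
  using orthonormal_frame[of p] unfolding orthonormal_at_def by auto

lemma ob_orthonormal: "i \<in> Basis \<Longrightarrow> j \<in> Basis \<Longrightarrow> im p (ob p i p) (ob p j p) = kdelta i j"
  using orthonormal_frame[of p] unfolding orthonormal_at_def kdelta_def by blast

lemma ob_expansion: "v = (\<Sum>i\<in>Basis. im p v (ob p i p) *\<^sub>R ob p i p)"
  by (rule orthonormal_at_expansion[OF orthonormal_frame])

text \<open>Semiparallelity is paired with \<open>J e_r\<close>, which loses nothing as \<sigma> has
  values in \<open>J TM\<close>. By the minus sign in \<open>ricci\<close> all three terms get the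
  same sign, so that the index \<open>r\<close> of the normal direction is treated like the two
  tangent indices.\<close>

lemma cubic:
  assumes min: "minimal A B \<phi> g conn D" and sp: "semiparallel A B \<phi> g conn D"
  shows "semiparallel_cubic Basis (cub p) (\<mu> / 4) (Riem p)"
proof -
  obtain U where U: "open U" "p \<in> U" and e: "\<And>i. i \<in> Basis \<Longrightarrow> vf U (ob p i)" by (rule ob_fields[of p]) blast
  have s12: "cub p i j k = cub p j i k" if "i \<in> Basis" "j \<in> Basis" "k \<in> Basis" for i j k
    using \<sigma>_sym[OF U(1) e[OF that(1)] e[OF that(2)] U(2)] by simp
  have s23: "cub p i j k = cub p i k j" if "i \<in> Basis" "j \<in> Basis" "k \<in> Basis" for i j k
    by (rule \<sigma>_J_sym[OF U(1) e[OF that(1)] e[OF that(2)] e[OF that(3)] U(2)])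
  have tr: "(\<Sum>i\<in>Basis. cub p i i k) = 0" if "k \<in> Basis" for k
  proof -
    have "(\<Sum>i\<in>Basis. \<sigma> (ob p i) (ob p i) p) = 0"
      using min unfolding minimal_def mean_curvature_def Let_def by simp
    then have "g (\<phi> p) (\<Sum>i\<in>Basis. \<sigma> (ob p i) (ob p i) p) (J (\<phi> p) (tm p (ob p k p))) = 0"
      by (simp add: g_simps)
    then show ?thesis by (simp add: linear_sum[OF g_linear_left])
  qed
  have ga: "Riem p i j k l = \<mu> / 4 * (kdelta j k * kdelta i l - kdelta i k * kdelta j l)
      + ((\<Sum>m\<in>Basis. cub p j k m * cub p i l m) - (\<Sum>m\<in>Basis. cub p i k m * cub p j l m))"
    if i: "i \<in> Basis" and j: "j \<in> Basis" and k: "k \<in> Basis" and l: "l \<in> Basis" for i j k l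
    unfolding gauss[OF U(1) e[OF i] e[OF j] e[OF k] e[OF l] U(2)] ob_orthonormal[OF j k] ob_orthonormal[OF i l]
      ob_orthonormal[OF i k] ob_orthonormal[OF j l]
      g_\<sigma>_expansion[OF orthonormal_frame U(1) e[OF j] e[OF k] U(2), of "\<sigma> (ob p i) (ob p l) p"]
      g_\<sigma>_expansion[OF orthonormal_frame U(1) e[OF i] e[OF k] U(2), of "\<sigma> (ob p j) (ob p l) p"] ..
  have se: "(\<Sum>m\<in>Basis. Riem p i j r m * cub p m k l + Riem p i j k m * cub p m r l + Riem p i j l m * cub p m k r) = 0"
    if i: "i \<in> Basis" and j: "j \<in> Basis" and k: "k \<in> Basis" and l: "l \<in> Basis" and r: "r \<in> Basis" for i j k l r
  proof -
    let ?C = "curvature A conn (ob p i) (ob p j)"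
    let ?\<eta> = "J (\<phi> p) (tm p (ob p r p))"
    note C = vf_curvature[OF U(1) e[OF i] e[OF j]]
    have left: "g (\<phi> p) (\<sigma> (?C (ob p a)) (ob p b) p) ?\<eta> = (\<Sum>m\<in>Basis. Riem p i j a m * cub p m b r)"
      if b: "b \<in> Basis" for a b
    proof -
      have "\<sigma> (?C (ob p a)) (ob p b) p = (\<Sum>m\<in>Basis. Riem p i j a m *\<^sub>R \<sigma> (ob p m) (ob p b) p)"
        by (rule \<sigma>_expansion_left[OF U(1) e e[OF b] U(2) finite_Basis ob_expansion])
      then show ?thesis by (simp add: linear_sum[OF g_linear_left] g_simps)
    qed
    have right: "g (\<phi> p) (\<sigma> (ob p k) (ob p l) p) (J (\<phi> p) (tm p (?C (ob p r) p))) = (\<Sum>m\<in>Basis. Riem p i j r m * cub p k l m)"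
      by (subst ob_expansion[of "?C (ob p r) p" p])
        (simp add: linear_sum[OF linear_tangent_map] linear_sum[OF J_linear] linear_sum[OF g_linear_right]
          tm_simps linear_cmul[OF J_linear] g_simps)
    have "curvature A (normal_connection A B \<phi> g D) (ob p i) (ob p j) (\<sigma> (ob p k) (ob p l)) p
        - \<sigma> (?C (ob p k)) (ob p l) p - \<sigma> (ob p k) (?C (ob p l)) p = 0"
      using sp[unfolded semiparallel_def Let_def, rule_format, OF conjI[OF U(1) conjI[OF e[OF i] conjI[OF e[OF j] conjI[OF e[OF k] e[OF l]]]]] U(2)] .
    then have "g (\<phi> p) (curvature A (normal_connection A B \<phi> g D) (ob p i) (ob p j) (\<sigma> (ob p k) (ob p l)) p
        - \<sigma> (?C (ob p k)) (ob p l) p - \<sigma> (ob p k) (?C (ob p l)) p) ?\<eta> = 0" by (simp add: g_simps)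
    then have "- (\<Sum>m\<in>Basis. Riem p i j r m * cub p k l m) - (\<Sum>m\<in>Basis. Riem p i j k m * cub p m l r)
        - (\<Sum>m\<in>Basis. Riem p i j l m * cub p m k r) = 0"
      unfolding \<sigma>_sym[OF U(1) e[OF k] C[OF e[OF l]] U(2)] g_simps(3)
        ricci[OF U(1) e[OF i] e[OF j] e[OF k] e[OF l] e[OF r] U(2)] right left[OF l] left[OF k] .
    moreover have "(\<Sum>m\<in>Basis. Riem p i j r m * cub p k l m) = (\<Sum>m\<in>Basis. Riem p i j r m * cub p m k l)"
      using s23[OF k l] s12[OF k _ l] by (intro sum.cong refl) simp
    moreover have "(\<Sum>m\<in>Basis. Riem p i j k m * cub p m l r) = (\<Sum>m\<in>Basis. Riem p i j k m * cub p m r l)"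
      using s23[OF _ l r] by (intro sum.cong refl) simp
    ultimately show ?thesis unfolding sum.distrib by linarith
  qed
  show ?thesis
    by (rule semiparallel_cubic.intro[OF finite_Basis nonempty_Basis s12 s23 tr ga se])
qed

lemma sff_length_sq_eq: "sff_length_sq A B \<phi> g conn D p = (\<Sum>i\<in>Basis. \<Sum>j\<in>Basis. \<Sum>m\<in>Basis. (cub p i j m)\<^sup>2)"
proof -
  obtain U where U: "open U" "p \<in> U" and e: "\<And>i. i \<in> Basis \<Longrightarrow> vf U (ob p i)" by (rule ob_fields[of p]) blast
  show ?thesis
    unfolding sff_length_sq_def Let_def
  proof (intro sum.cong refl)
    fix i j :: 'd assume ij: "i \<in> Basis" "j \<in> Basis"
    show "g (\<phi> p) (\<sigma> (ob p i) (ob p j) p) (\<sigma> (ob p i) (ob p j) p) = (\<Sum>m\<in>Basis. (cub p i j m)\<^sup>2)"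
      unfolding g_\<sigma>_expansion[OF orthonormal_frame U(1) e[OF ij(1)] e[OF ij(2)] U(2), of "\<sigma> (ob p i) (ob p j) p"]
      by (simp add: power2_eq_square)
  qed
qed

lemma \<sigma>_eq_0:
  assumes "\<And>i j k. i \<in> Basis \<Longrightarrow> j \<in> Basis \<Longrightarrow> k \<in> Basis \<Longrightarrow> cub p i j k = 0"
    and V: "open V" "vf V X" "vf V Y" "p \<in> V"
  shows "\<sigma> X Y p = 0"
proof -
  obtain U where U: "open U" "p \<in> U" and e: "\<And>i. i \<in> Basis \<Longrightarrow> vf U (ob p i)" by (rule ob_fields[of p]) blast
  let ?W = "U \<inter> V"
  have W: "open ?W" "p \<in> ?W" using U V by auto
  have eW: "vf ?W (ob p i)" if "i \<in> Basis" for i by (rule dom.vector_field_subset[OF e[OF that]]) auto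
  have XW: "vf ?W X" "vf ?W Y" using dom.vector_field_subset V by auto
  have 0: "\<sigma> (ob p i) (ob p j) p = 0" if ij: "i \<in> Basis" "j \<in> Basis" for i j
  proof -
    have "g (\<phi> p) (\<sigma> (ob p i) (ob p j) p) (\<sigma> (ob p i) (ob p j) p) = 0"
      unfolding g_\<sigma>_expansion[OF orthonormal_frame U(1) e[OF ij(1)] e[OF ij(2)] U(2), of "\<sigma> (ob p i) (ob p j) p"]
      using assms(1)[OF ij] by simp
    then show ?thesis by (simp add: g_eq_0_iff)
  qed
  have exp: "\<sigma> Z Y p = (\<Sum>i\<in>Basis. im p (Z p) (ob p i p) *\<^sub>R \<sigma> (ob p i) Y p)" if "vf ?W Y" for Z Y
    by (rule \<sigma>_expansion_left[OF W(1) eW that W(2) finite_Basis ob_expansion])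
  have "\<sigma> (ob p i) Y p = 0" if i: "i \<in> Basis" for i
  proof -
    have "\<sigma> (ob p i) Y p = \<sigma> Y (ob p i) p" by (rule \<sigma>_sym[OF W(1) eW[OF i] XW(2) W(2)])
    also have "\<dots> = (\<Sum>j\<in>Basis. im p (Y p) (ob p j p) *\<^sub>R \<sigma> (ob p j) (ob p i) p)" by (rule exp[OF eW[OF i]])
    finally show ?thesis by (simp add: 0 i)
  qed
  then show ?thesis using exp[OF XW(2), of X] by simp
qed

text \<open>Tensoriality of the curvature of \<open>conn\<close> reduces arbitrary fields to the
  frame, one argument at a time.\<close>

lemma curvature_eq_0:
  assumes "\<And>i j k l. i \<in> Basis \<Longrightarrow> j \<in> Basis \<Longrightarrow> k \<in> Basis \<Longrightarrow> l \<in> Basis \<Longrightarrow> Riem p i j k l = 0"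
    and V: "open V" "vf V X" "vf V Y" "vf V Z" "p \<in> V"
  shows "curvature A conn X Y Z p = 0"
proof -
  obtain U where U: "open U" "p \<in> U" and e: "\<And>i. i \<in> Basis \<Longrightarrow> vf U (ob p i)" by (rule ob_fields[of p]) blast
  have tens: "curvature A conn X Y Z p = curv_tensor A conn p (X p) (Y p) (Z p)"
    if "open V" "vf V X" "vf V Y" "vf V Z" "p \<in> V" for V X Y Z
    using con.curvature_eq_curv_tensor[OF that(1-3) that(4)[unfolded vector_field_def] that(5)] by simp
  have 0: "curv_tensor A conn p (ob p i p) (ob p j p) (ob p k p) = 0" if "i \<in> Basis" "j \<in> Basis" "k \<in> Basis" for i j k
    using assms(1)[OF that] ob_expansion[of "curvature A conn (ob p i) (ob p j) (ob p k) p" p]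
    unfolding tens[OF U(1) e[OF that(1)] e[OF that(2)] e[OF that(3)] U(2), symmetric] by simp
  have 1: "curv_tensor A conn p (ob p i p) (ob p j p) z = 0" if "i \<in> Basis" "j \<in> Basis" for i j z
    by (rule linear_eq_0_on_frame[OF linear_curv_tensor(3) ob_expansion]) (rule 0[OF that])
  have 2: "curv_tensor A conn p (ob p i p) y z = 0" if "i \<in> Basis" for i y z
    by (rule linear_eq_0_on_frame[OF linear_curv_tensor(2) ob_expansion]) (rule 1[OF that])
  show ?thesis
    unfolding tens[OF V]
    by (rule linear_eq_0_on_frame[OF linear_curv_tensor(1) ob_expansion]) (rule 2)
qed

lemma scalar_curvature_sum: "scalar_curvature A im conn p = (\<Sum>i\<in>Basis. \<Sum>j\<in>Basis. Riem p i j j i)"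
  by (simp add: scalar_curvature_def Let_def)

lemma scalar_curvature_sff:
  assumes "minimal A B \<phi> g conn D" "semiparallel A B \<phi> g conn D"
  shows "scalar_curvature A im conn p = \<mu> / 4 * real DIM('d) * (real DIM('d) - 1) - sff_length_sq A B \<phi> g conn D p"
proof -
  interpret c: semiparallel_cubic Basis "cub p" "\<mu> / 4" "Riem p" by (rule cubic[OF assms])
  show ?thesis
    unfolding scalar_curvature_sum sff_length_sq_eq c.scalar_curvature_eq c.N_eq_norm ..
qed

text \<open>A nonzero value of \<sigma> at \<open>p\<close> makes some component of the cubic form,
  and hence \<open>N\<close>, nonzero there.\<close>

lemma scalar_curvature_nonneg_or_geodesic_at:
  assumes "minimal A B \<phi> g conn D" "semiparallel A B \<phi> g conn D"
    and "open V" "vf V X" "vf V Y" "p \<in> V" "\<sigma> X Y p \<noteq> 0"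
  shows "scalar_curvature A im conn p \<ge> 0"
proof -
  interpret c: semiparallel_cubic Basis "cub p" "\<mu> / 4" "Riem p" by (rule cubic[OF assms(1,2)])
  have "c.N \<noteq> 0"
  proof
    assume "c.N = 0"
    from \<sigma>_eq_0[OF c.N_eq_0D[OF this] assms(3-6)] assms(7) show False by simp
  qed
  then show ?thesis unfolding scalar_curvature_sum by (rule c.scalar_curvature_nonneg)
qed

lemma flat_if_scalar_flat:
  assumes "minimal A B \<phi> g conn D" "semiparallel A B \<phi> g conn D"
    and "\<And>p. scalar_curvature A im conn p = 0"
  shows "flat A conn"
  unfolding flat_def
proof (intro allI impI ballI, elim conjE)
  fix U X Y Z p assume V: "open U" "vf U X" "vf U Y" "vf U Z" "p \<in> U"
  interpret c: semiparallel_cubic Basis "cub p" "\<mu> / 4" "Riem p" by (rule cubic[OF assms(1,2)])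
  have "(\<Sum>i\<in>Basis. \<Sum>j\<in>Basis. Riem p i j j i) = 0" using assms(3)[of p] by (simp add: scalar_curvature_sum)
  from curvature_eq_0[OF c.scalar_flat_imp_flat[OF this] V] show "curvature A conn X Y Z p = 0" .
qed

end

theorem theorem2:
  fixes B :: "('a::{second_countable_topology,t2_space}, 'e::euclidean_space) atlas"
    and A :: "('b::{second_countable_topology,t2_space}, 'd::euclidean_space) atlas"
    and g :: "'a \<Rightarrow> 'e \<Rightarrow> 'e \<Rightarrow> real"
    and J :: "'a \<Rightarrow> 'e \<Rightarrow> 'e"
    and ambient_conn :: "('a \<Rightarrow> 'e) \<Rightarrow> 'a \<Rightarrow> 'e \<Rightarrow> 'e"
    and \<mu> :: real
    and \<phi> :: "'b \<Rightarrow> 'a"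
    and conn :: "('b \<Rightarrow> 'd) \<Rightarrow> 'b \<Rightarrow> 'd \<Rightarrow> 'd"
    and D :: "('b \<Rightarrow> 'e) \<Rightarrow> 'b \<Rightarrow> 'd \<Rightarrow> 'e"
  assumes "complex_space_form B g J ambient_conn \<mu>"
    and "smooth_atlas A"
    and "immersion A B \<phi>"
    and "levi_civita A (induced_metric A B \<phi> g) conn"
    and "pullback_connection A B \<phi> ambient_conn D"
    and "totally_real A B \<phi> g J"
    and "minimal A B \<phi> g conn D"
    and "semiparallel A B \<phi> g conn D"
    and "parallel_f_structure A B \<phi> g J D"
  shows "((\<exists>s::real. \<forall>p. sff_length_sq A B \<phi> g conn D p = s) \<longleftrightarrow>
            (\<exists>\<tau>. \<forall>p. scalar_curvature A (induced_metric A B \<phi> g) conn p = \<tau>)) \<and>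
         (\<forall>\<tau>::real. (\<forall>p. scalar_curvature A (induced_metric A B \<phi> g) conn p = \<tau>) \<longrightarrow>
            (totally_geodesic A B \<phi> conn D \<or> \<tau> \<ge> 0) \<and> (\<tau> = 0 \<longrightarrow> flat A conn))"
proof -
  have k: "kaehler B g J ambient_conn" using assms(1) by (simp add: complex_space_form_def)
  interpret totally_real_submanifold A B \<phi> D ambient_conn g J conn \<mu>
    by unfold_locales
      (use k assms in \<open>simp_all add: kaehler_def levi_civita_def immersion_def pullback_connection_def\<close>)
  let ?\<tau> = "scalar_curvature A im conn"
  let ?s = "sff_length_sq A B \<phi> g conn D"
  \<comment> \<open>The scalar curvature belonging to constant curvature \<mu>/4. It does not depend
    on the point, so one of the two functions is constant exactly when the other is.\<close>
  define K where "K = \<mu> / 4 * real DIM('d) * (real DIM('d) - 1)"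
  have \<tau>: "?\<tau> p = K - ?s p" for p
    unfolding K_def by (rule scalar_curvature_sff[OF assms(7,8)])
  have "(\<exists>s. \<forall>p. ?s p = s) \<longleftrightarrow> (\<exists>\<tau>. \<forall>p. ?\<tau> p = \<tau>)"
  proof
    assume "\<exists>s. \<forall>p. ?s p = s"
    then obtain s where "\<And>p. ?s p = s" by blast
    then have "\<forall>p. ?\<tau> p = K - s" by (simp add: \<tau>)
    then show "\<exists>\<tau>. \<forall>p. ?\<tau> p = \<tau>" by (rule exI)
  next
    assume "\<exists>\<tau>. \<forall>p. ?\<tau> p = \<tau>"
    then obtain t where "\<And>p. ?\<tau> p = t" by blast
    then have "\<forall>p. ?s p = K - t" using \<tau> by (simp add: algebra_simps)
    then show "\<exists>s. \<forall>p. ?s p = s" by (rule exI)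
  qed
  moreover have "(totally_geodesic A B \<phi> conn D \<or> t \<ge> 0) \<and> (t = 0 \<longrightarrow> flat A conn)" if t: "\<forall>p. ?\<tau> p = t" for t
  proof (intro conjI impI)
    show "totally_geodesic A B \<phi> conn D \<or> t \<ge> 0"
    proof (rule disjCI)
      \<comment> \<open>A point with nonzero \<sigma> would have nonnegative scalar curvature,
        contradicting the negative constant value.\<close>
      assume t0: "\<not> t \<ge> 0"
      show "totally_geodesic A B \<phi> conn D"
        unfolding totally_geodesic_def
      proof (intro allI impI ballI, elim conjE)
        fix U X Y p assume V: "open U" "vf U X" "vf U Y" "p \<in> U"
        show "\<sigma> X Y p = 0"
          using scalar_curvature_nonneg_or_geodesic_at[OF assms(7,8) V] t t0 by auto
      qed
    qed
    show "flat A conn" if "t = 0"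
      by (rule flat_if_scalar_flat[OF assms(7,8)]) (use t that in simp)
  qed
  ultimately show ?thesis by blast
qed

end
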